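(* Let $p$ be a prime and let ${\mathbb Q}_p^{\mathrm{nr}}$ be the maximal unramified extension of ${\mathbb Q}_p$. Let $\rho^{\mathrm{nr}}(p)$ be the probability, with respect to the normalized Haar measure on ${\mathbb Z}_p^{10}$, that a random ternary cubic form $C(X,Y,Z)$ with coefficients in ${\mathbb Z}_p$ has a nontrivial zero over ${\mathbb Q}_p^{\mathrm{nr}}$ (i.e. the associated plane cubic curve has a ${\mathbb Q}_p^{\mathrm{nr}}$-rational point). Then \[ \rho^{\mathrm{nr}}(p) = 1-\frac{p^{11}(p-1)(p^2-1)(p^3-1)}{(p^8-1)(p^9-1)(p^{10}-1)}. \] *)

theory Defs
  imports
    "HOL-Probability.Probability"
    "HOL-Algebra.Algebraic_Closure_Type"
    "Berlekamp_Zassenhaus.Finite_Field"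
begin

no_notation fps_nth (infixl "$" 75)

section \<open>The ring of $p$-adic integers\<close>

text \<open>
  The prime is the cardinality of the type parameter. A $p$-adic integer is an element of
  the inverse limit of the rings $\mathbb{Z}/p^n\mathbb{Z}$, each represented
  by its least nonnegative residues.
\<close>

typedef 'p padic_int =
  "{x :: nat \<Rightarrow> int. \<forall>n. x n \<in> {0..<int CARD('p::prime_card) ^ n} \<and>
     x (Suc n) mod int CARD('p) ^ n = x n}"
  morphisms padic_residue Abs_padic_int
  by (rule exI[of _ "\<lambda>_. 0"]) (simp add: prime_gt_0_nat[OF prime_card])

setup_lifting type_definition_padic_int

lemma card_pow_pos: "0 < int CARD('p::prime_card) ^ n"
  by (simp add: prime_gt_0_nat[OF prime_card])

lemma mod_mod_pow_Suc: "a mod int q ^ Suc n mod int q ^ n = a mod int q ^ n"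
  by (simp add: mod_mod_cancel)

lemma mod_pow_SucI:
  assumes "a mod int q ^ n = b mod int q ^ n"
  shows "a mod int q ^ Suc n mod int q ^ n = b mod int q ^ n"
  using assms mod_mod_pow_Suc[of a q n] by simp

instantiation padic_int :: (prime_card) comm_ring_1
begin

lift_definition zero_padic_int :: "'a padic_int" is "\<lambda>_. 0"
  by (simp add: card_pow_pos)

lift_definition one_padic_int :: "'a padic_int" is "\<lambda>n. 1 mod int CARD('a) ^ n"
  by (simp add: card_pow_pos mod_mod_pow_Suc del: power_Suc)

lift_definition plus_padic_int :: "'a padic_int \<Rightarrow> 'a padic_int \<Rightarrow> 'a padic_int"
  is "\<lambda>x y n. (x n + y n) mod int CARD('a) ^ n"
  by (simp add: card_pow_pos mod_mod_pow_Suc del: power_Suc) (metis mod_add_eq)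

lift_definition uminus_padic_int :: "'a padic_int \<Rightarrow> 'a padic_int"
  is "\<lambda>x n. (- x n) mod int CARD('a) ^ n"
  by (simp add: card_pow_pos mod_mod_pow_Suc del: power_Suc) (metis mod_minus_eq)

lift_definition minus_padic_int :: "'a padic_int \<Rightarrow> 'a padic_int \<Rightarrow> 'a padic_int"
  is "\<lambda>x y n. (x n - y n) mod int CARD('a) ^ n"
  by (simp add: card_pow_pos mod_mod_pow_Suc del: power_Suc) (metis mod_diff_eq)

lift_definition times_padic_int :: "'a padic_int \<Rightarrow> 'a padic_int \<Rightarrow> 'a padic_int"
  is "\<lambda>x y n. (x n * y n) mod int CARD('a) ^ n"
  by (simp add: card_pow_pos mod_mod_pow_Suc del: power_Suc) (metis mod_mult_eq)

instance
proof
  fix a b c :: "'a padic_int"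
  show "a * b * c = a * (b * c)"
    by transfer (simp add: fun_eq_iff mod_simps mult.assoc)
  show "a * b = b * a"
    by transfer (simp add: fun_eq_iff mult.commute)
  show "1 * a = a"
    by transfer (simp add: fun_eq_iff mod_simps)
  show "a + b + c = a + (b + c)"
    by transfer (simp add: fun_eq_iff mod_simps add.assoc)
  show "a + b = b + a"
    by transfer (simp add: fun_eq_iff add.commute)
  show "0 + a = a"
    by transfer (simp add: fun_eq_iff)
  show "- a + a = 0"
    by transfer (simp add: fun_eq_iff mod_simps)
  show "a - b = a + - b"
    by transfer (simp add: fun_eq_iff mod_simps)
  show "(a + b) * c = a * c + b * c"
    by transfer (simp add: fun_eq_iff mod_simps algebra_simps)
  show "(0 :: 'a padic_int) \<noteq> 1"
  proof transfer
    have "int CARD('a) > 1"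
      using prime_gt_1_nat[OF prime_card] by simp
    then show "(\<lambda>_. 0) \<noteq> (\<lambda>n. 1 mod int CARD('a) ^ n)"
      by (auto simp: fun_eq_iff intro!: exI[of _ 1])
  qed
qed

end

lemma padic_residue_bounds: "padic_residue (x :: 'p::prime_card padic_int) n \<in> {0..<int CARD('p) ^ n}"
  by transfer simp

lemma padic_residue_mod:
  assumes "m \<le> n"
  shows "padic_residue (x :: 'p::prime_card padic_int) n mod int CARD('p) ^ m = padic_residue x m"
  using assms
proof (induction n rule: dec_induct)
  case base
  show ?case using padic_residue_bounds[of x m] by simp
next
  case (step n)
  have "padic_residue x (Suc n) mod int CARD('p) ^ n = padic_residue x n"
    by transfer simp
  moreover have "padic_residue x (Suc n) mod int CARD('p) ^ n mod int CARD('p) ^ m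
      = padic_residue x (Suc n) mod int CARD('p) ^ m"
    by (rule mod_mod_cancel) (simp add: le_imp_power_dvd step.hyps)
  ultimately show ?case using step.IH by simp
qed

lemma padic_int_eqI: "(\<And>n. padic_residue x n = padic_residue y n) \<Longrightarrow> x = y"
  by (metis ext padic_residue_inject)

lemma padic_residue_add:
  "padic_residue (x + y :: 'p::prime_card padic_int) n =
     (padic_residue x n + padic_residue y n) mod int CARD('p) ^ n"
  by transfer simp

instance padic_int :: (prime_card) idom
proof
  fix x y :: "'a padic_int"
  assume "x \<noteq> 0" "y \<noteq> 0"
  let ?q = "int CARD('a)"
  have zero: "padic_residue (0 :: 'a padic_int) n = 0" for n
    by transfer simp
  have "\<exists>m. padic_residue x m \<noteq> 0" "\<exists>k. padic_residue y k \<noteq> 0"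
    using \<open>x \<noteq> 0\<close> \<open>y \<noteq> 0\<close> by (metis padic_int_eqI zero)+
  then obtain m k where mk: "padic_residue x m \<noteq> 0" "padic_residue y k \<noteq> 0"
    by blast
  define a where "a = padic_residue x (m + k)"
  define b where "b = padic_residue y (m + k)"
  have "a mod ?q ^ m \<noteq> 0" "b mod ?q ^ k \<noteq> 0"
    using mk by (simp_all add: a_def b_def padic_residue_mod)
  then have a: "\<not> ?q ^ m dvd a" and b: "\<not> ?q ^ k dvd b"
    by auto
  then have nz: "a \<noteq> 0" "b \<noteq> 0" by auto
  have pr: "prime_elem ?q"
    using prime_card_int[where 'a='a] by (simp add: prime_def)
  have u: "\<not> is_unit ?q"
    using pr by (rule prime_elem_not_unit)
  have "multiplicity ?q a < m" "multiplicity ?q b < k"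
    using a b nz u by (simp_all add: power_dvd_iff_le_multiplicity not_le)
  then have "\<not> ?q ^ (m + k) dvd a * b"
    using nz pr u
    by (simp add: power_dvd_iff_le_multiplicity prime_elem_multiplicity_mult_distrib)
  moreover have "padic_residue (x * y) (m + k) = a * b mod ?q ^ (m + k)"
    unfolding a_def b_def by transfer simp
  ultimately have "padic_residue (x * y) (m + k) \<noteq> 0"
    by (simp add: dvd_eq_mod_eq_0)
  then show "x * y \<noteq> 0"
    by (metis zero)
qed

text \<open>The $p$-adic topology: the residue classes modulo the powers of $p$ form a base.\<close>

instantiation padic_int :: (prime_card) topological_space
begin

definition open_padic_int :: "'a padic_int set \<Rightarrow> bool" where
  "open_padic_int U \<longleftrightarrow>
     (\<forall>x\<in>U. \<exists>n. \<forall>y. padic_residue y n = padic_residue x n \<longrightarrow> y \<in> U)"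

instance
proof
  show "open (UNIV :: 'a padic_int set)"
    by (simp add: open_padic_int_def)
next
  fix S T :: "'a padic_int set"
  assume ST: "open S" "open T"
  show "open (S \<inter> T)"
    unfolding open_padic_int_def
  proof
    fix x assume "x \<in> S \<inter> T"
    then obtain m n where m: "\<And>y. padic_residue y m = padic_residue x m \<Longrightarrow> y \<in> S"
      and n: "\<And>y. padic_residue y n = padic_residue x n \<Longrightarrow> y \<in> T"
      using ST unfolding open_padic_int_def by blast
    have "y \<in> S \<inter> T" if "padic_residue y (max m n) = padic_residue x (max m n)" for y
      using m[of y] n[of y] that
      by (metis IntI max.cobounded1 max.cobounded2 padic_residue_mod)
    then show "\<exists>n. \<forall>y. padic_residue y n = padic_residue x n \<longrightarrow> y \<in> S \<inter> T"
      by blast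
  qed
next
  fix K :: "'a padic_int set set"
  assume K: "\<forall>S\<in>K. open S"
  show "open (\<Union>K)"
    unfolding open_padic_int_def
  proof
    fix x assume "x \<in> \<Union>K"
    then obtain S where S: "S \<in> K" "x \<in> S" by blast
    with K obtain n where "\<forall>y. padic_residue y n = padic_residue x n \<longrightarrow> y \<in> S"
      unfolding open_padic_int_def by meson
    with S show "\<exists>n. \<forall>y. padic_residue y n = padic_residue x n \<longrightarrow> y \<in> \<Union>K"
      by blast
  qed
qed

end

section \<open>Normalized Haar measure\<close>

text \<open>
  On a compact second countable group every finite Borel measure is Radon, so that no
  regularity condition has to be imposed.
\<close>

definition normalized_haar :: "'a::{topological_space, ab_group_add} measure \<Rightarrow> bool" where
  "normalized_haar \<mu> \<longleftrightarrow> prob_space \<mu> \<and> sets \<mu> = sets borel \<and>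
     (\<forall>a. \<forall>A\<in>sets borel. emeasure \<mu> ((+) a ` A) = emeasure \<mu> A)"

lemma padic_residue_add_cong:
  fixes x y c :: "'p::prime_card padic_int"
  shows "padic_residue (c + x) n = padic_residue (c + y) n \<longleftrightarrow> padic_residue x n = padic_residue y n"
proof -
  have *: "padic_residue (d + u) n = padic_residue (d + v) n"
    if "padic_residue u n = padic_residue v n" for d u v :: "'p padic_int"
    using that by (simp add: padic_residue_add)
  show ?thesis
    using *[of x y c] *[of "c + x" "c + y" "- c"] by (auto simp: add.assoc[symmetric])
qed

definition padic_cyl :: "nat \<Rightarrow> ('n \<Rightarrow> int) \<Rightarrow> ('p::prime_card padic_int ^ 'n) set" where
  "padic_cyl n r = {y. \<forall>i. padic_residue (y $ i) n = r i}"

lemma padic_cyl_Int: "\<exists>k t. padic_cyl n r \<inter> padic_cyl m s = (padic_cyl k t :: ('p::prime_card padic_int ^ 'n) set)"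
proof -
  have *: "\<exists>k t. padic_cyl n r \<inter> padic_cyl m s = (padic_cyl k t :: ('p padic_int ^ 'n) set)"
    if "n \<le> m" for n m and r s :: "'n \<Rightarrow> int"
  proof (cases "padic_cyl n r \<inter> padic_cyl m s = ({} :: ('p padic_int ^ 'n) set)")
    case True
    have "padic_residue (x :: 'p padic_int) 0 = 0" for x
      using padic_residue_bounds[of x 0] by simp
    then have "padic_cyl 0 (\<lambda>_. 1) = ({} :: ('p padic_int ^ 'n) set)"
      by (simp add: padic_cyl_def)
    with True show ?thesis by metis
  next
    case False
    then obtain z :: "'p padic_int ^ 'n" where z: "\<And>i. padic_residue (z $ i) n = r i" "\<And>i. padic_residue (z $ i) m = s i"
      unfolding padic_cyl_def by blast
    have "padic_residue (y $ i) n = r i" if "padic_residue (y $ i) m = s i" for y :: "'p padic_int ^ 'n" and i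
      using that z \<open>n \<le> m\<close> by (metis padic_residue_mod)
    then have "padic_cyl n r \<inter> padic_cyl m s = (padic_cyl m s :: ('p padic_int ^ 'n) set)"
      by (auto simp: padic_cyl_def)
    then show ?thesis by blast
  qed
  show ?thesis
    using *[of n m r s] *[of m n s r] by (cases "n \<le> m") (auto simp: Int_commute)
qed

lemma open_padic_residue: "open {y :: 'p::prime_card padic_int. padic_residue y n = c}"
  unfolding open_padic_int_def by (auto intro!: exI[of _ n])

lemma open_padic_cyl: "open (padic_cyl n r :: ('p::prime_card padic_int ^ 'n) set)"
proof -
  have "open {x :: 'p padic_int ^ 'n. \<forall>i. x $ i \<in> {y. padic_residue y n = r i}}"
    by (rule open_vector_box) (simp add: open_padic_residue)
  then show ?thesis by (simp add: padic_cyl_def)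
qed

lemma padic_cyl_base:
  fixes U :: "('p::prime_card padic_int ^ 'n) set"
  assumes "open U" "x \<in> U"
  shows "\<exists>n. padic_cyl n (\<lambda>i. padic_residue (x $ i) n) \<subseteq> U"
proof -
  have "\<exists>A. (\<forall>i. open (A i) \<and> x $ i \<in> A i) \<and> (\<forall>y. (\<forall>i. y $ i \<in> A i) \<longrightarrow> y \<in> U)"
    using assms(1) unfolding open_vec_def by (rule bspec) (rule assms(2))
  then obtain A where A: "\<And>i. open (A i)" "\<And>i. x $ i \<in> A i" "\<And>y. (\<And>i. y $ i \<in> A i) \<Longrightarrow> y \<in> U"
    by auto
  have "\<exists>n. \<forall>y. padic_residue y n = padic_residue (x $ i) n \<longrightarrow> y \<in> A i" for i
    using A(1)[of i] unfolding open_padic_int_def by (rule bspec) (rule A(2))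
  then obtain N where N: "\<And>i y. padic_residue y (N i) = padic_residue (x $ i) (N i) \<Longrightarrow> y \<in> A i"
    by metis
  define n where "n = Max (range N)"
  have le: "N i \<le> n" for i by (simp add: n_def)
  have "y \<in> U" if "y \<in> padic_cyl n (\<lambda>i. padic_residue (x $ i) n)" for y
  proof (rule A(3), rule N)
    fix i
    have "padic_residue (y $ i) n = padic_residue (x $ i) n"
      using that by (simp add: padic_cyl_def)
    then show "padic_residue (y $ i) (N i) = padic_residue (x $ i) (N i)"
      using le[of i] by (metis padic_residue_mod)
  qed
  then show ?thesis by blast
qed

abbreviation padic_cyls :: "('p::prime_card padic_int ^ 'n) set set" where
  "padic_cyls \<equiv> range (\<lambda>(n, r). padic_cyl n r)"

lemma sets_borel_padic_vec: "sets (borel :: ('p::prime_card padic_int ^ 'n) measure) = sigma_sets UNIV padic_cyls"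
proof
  show "sigma_sets UNIV padic_cyls \<subseteq> sets (borel :: ('p padic_int ^ 'n) measure)"
    by (rule sets.sigma_sets_subset[of _ borel, simplified]) (auto intro!: borel_open open_padic_cyl)
  have "U \<in> sigma_sets UNIV padic_cyls" if "open U" for U :: "('p padic_int ^ 'n) set"
  proof -
    let ?K = "{C \<in> padic_cyls. C \<subseteq> U}"
    have "countable (padic_cyls :: ('p padic_int ^ 'n) set set)"
      by (rule countable_image) simp
    then have "countable ?K" by (rule countable_subset[rotated]) auto
    moreover have "\<Union> ?K = U"
    proof
      show "U \<subseteq> \<Union> ?K"
      proof
        fix x assume "x \<in> U"
        with padic_cyl_base[OF that] obtain n where "padic_cyl n (\<lambda>i. padic_residue (x $ i) n) \<subseteq> U"
          by blast
        moreover have "x \<in> padic_cyl n (\<lambda>i. padic_residue (x $ i) n)"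
          by (simp add: padic_cyl_def)
        ultimately show "x \<in> \<Union> ?K" by blast
      qed
    qed auto
    moreover have "\<Union> ?K \<in> sigma_sets UNIV padic_cyls"
      by (rule sigma_sets_UNION) (use \<open>countable ?K\<close> in auto)
    ultimately show ?thesis by simp
  qed
  then show "sets (borel :: ('p padic_int ^ 'n) measure) \<subseteq> sigma_sets UNIV padic_cyls"
    unfolding borel_def by (subst sets_measure_of) (auto intro!: sigma_sets_mono)
qed

lemma digits_unique:
  fixes x :: "'p::prime_card padic_int" and d :: "nat \<Rightarrow> int"
  assumes d: "\<And>k. d k \<in> {0..<int CARD('p)}"
  shows "(\<Sum>k<n. d k * int CARD('p) ^ k) mod int CARD('p) ^ n = padic_residue x n \<longleftrightarrow>
    (\<forall>k<n. d k = (padic_residue x (Suc k) - padic_residue x k) div int CARD('p) ^ k)"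
proof -
  let ?q = "int CARD('p)"
  define S where "S = (\<lambda>n. \<Sum>k<n. d k * ?q ^ k)"
  have q: "?q > 0" using card_pow_pos[where 'p='p, of 1] by simp
  have S: "S n \<in> {0..<?q ^ n}" for n
  proof (induction n)
    case (Suc n)
    have "d n * ?q ^ n \<le> (?q - 1) * ?q ^ n"
      by (rule mult_right_mono) (use d[of n] in auto)
    moreover have "0 \<le> d n * ?q ^ n" using d[of n] by simp
    ultimately show ?case using Suc by (auto simp: S_def algebra_simps)
  qed (simp add: S_def)
  have Smod: "S n mod ?q ^ m = S m" if "m \<le> n" for m n
    using that
  proof (induction n rule: dec_induct)
    case base
    show ?case using S[of m] by simp
  next
    case (step n)
    have "S (Suc n) mod ?q ^ m = (S n + d n * ?q ^ n) mod ?q ^ m" by (simp add: S_def)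
    also have "\<dots> = S n mod ?q ^ m"
      using step.hyps by (metis dvd_mult le_imp_power_dvd mod_0_imp_dvd mod_add_right_eq
          add.right_neutral dvd_imp_mod_0)
    finally show ?case using step.IH by simp
  qed
  have Sn: "S n mod ?q ^ n = S n" for n using Smod[of n n] by simp
  have fold: "(\<Sum>k<n. d k * ?q ^ k) = S n" by (simp add: S_def)
  show ?thesis
    unfolding fold Sn
  proof
    assume *: "S n = padic_residue x n"
    have **: "S m = padic_residue x m" if "m \<le> n" for m
      using that * Smod[OF that] padic_residue_mod[OF that, of x] by simp
    show "\<forall>k<n. d k = (padic_residue x (Suc k) - padic_residue x k) div ?q ^ k"
    proof (intro allI impI)
      fix k assume "k < n"
      then have "padic_residue x (Suc k) - padic_residue x k = S (Suc k) - S k"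
        using **[of k] **[of "Suc k"] by simp
      also have "\<dots> = d k * ?q ^ k" by (simp add: S_def)
      finally show "d k = (padic_residue x (Suc k) - padic_residue x k) div ?q ^ k"
        using q by simp
    qed
  next
    assume *: "\<forall>k<n. d k = (padic_residue x (Suc k) - padic_residue x k) div ?q ^ k"
    have dv: "?q ^ k dvd padic_residue x (Suc k) - padic_residue x k" for k
      using padic_residue_mod[of k "Suc k" x] by (metis mod_eq_dvd_iff mod_mod_trivial le_SucI order_refl)
    have "m \<le> n \<Longrightarrow> S m = padic_residue x m" for m
    proof (induction m)
      case 0
      show ?case using padic_residue_bounds[of x 0] by (simp add: S_def)
    next
      case (Suc m)
      have "S (Suc m) = S m + d m * ?q ^ m" by (simp add: S_def)
      also have "d m * ?q ^ m = padic_residue x (Suc m) - padic_residue x m"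
        using * Suc.prems dv[of m] by simp
      finally show ?case using Suc by simp
    qed
    then show "S n = padic_residue x n" by simp
  qed
qed

lemma digit_range:
  fixes x :: "'p::prime_card padic_int"
  shows "(padic_residue x (Suc k) - padic_residue x k) div int CARD('p) ^ k \<in> {0..<int CARD('p)}"
proof -
  let ?q = "int CARD('p)"
  let ?a = "padic_residue x (Suc k)"
  have q: "?q ^ k > 0" by (rule card_pow_pos)
  have r: "padic_residue x k = ?a mod ?q ^ k" by (simp add: padic_residue_mod)
  have "(?a - ?a mod ?q ^ k) div ?q ^ k = ?a div ?q ^ k"
    by (simp add: minus_mod_eq_mult_div)
  moreover have "0 \<le> ?a" "?a < ?q * ?q ^ k" using padic_residue_bounds[of x "Suc k"] by auto
  moreover have "?a div ?q ^ k < ?q"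
  proof (rule ccontr)
    assume "\<not> ?a div ?q ^ k < ?q"
    then have "?q * ?q ^ k \<le> ?a div ?q ^ k * ?q ^ k"
      using q by (intro mult_right_mono) auto
    also have "\<dots> \<le> ?a"
      using q pos_mod_sign[OF q, of ?a] div_mult_mod_eq[of ?a "?q ^ k"] by linarith
    finally show False using \<open>?a < ?q * ?q ^ k\<close> by simp
  qed
  ultimately show ?thesis
    unfolding r using q by (simp add: pos_imp_zdiv_nonneg_iff)
qed

theorem normalized_haar_exists:
  "\<exists>\<mu> :: ('p::prime_card padic_int ^ 'n) measure. normalized_haar \<mu>"
proof -
  let ?q = "int CARD('p)"
  define D where "D = measure_pmf (pmf_of_set {0..<?q})"
  have q: "?q > 0" using card_pow_pos[where 'p='p, of 1] by simp
  then have D_set: "set_pmf (pmf_of_set {0..<?q}) = {0..<?q}" by (simp add: set_pmf_of_set)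
  interpret D: prob_space D unfolding D_def by (rule measure_pmf.prob_space_axioms)
  define M where "M = PiM (UNIV :: (nat \<times> 'n) set) (\<lambda>_. D)"
  interpret P: product_prob_space "\<lambda>_ :: nat \<times> 'n. D" UNIV ..
  interpret M: prob_space M unfolding M_def by (rule P.P.prob_space_axioms)
  define res where "res = (\<lambda>(\<omega> :: nat \<times> 'n \<Rightarrow> int) i n. (\<Sum>k<n. \<omega> (k, i) * ?q ^ k) mod ?q ^ n)"
  define T where "T = (\<lambda>\<omega>. \<chi> i. (Abs_padic_int (res \<omega> i) :: 'p padic_int))"
  have res: "padic_residue (T \<omega> $ i) n = res \<omega> i n" for \<omega> i n
  proof -
    have "res \<omega> i n \<in> {0..<?q ^ n}" for n
      unfolding res_def using card_pow_pos[where 'p='p, of n] by simp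
    moreover have "res \<omega> i (Suc n) mod ?q ^ n = res \<omega> i n" for n
      unfolding res_def by (simp add: mod_mod_pow_Suc del: power_Suc)
    ultimately show ?thesis
      unfolding T_def by (simp add: Abs_padic_int_inverse)
  qed
  have meas_res: "(\<lambda>\<omega>. res \<omega> i n) \<in> M \<rightarrow>\<^sub>M count_space UNIV" for i n
  proof -
    have comp: "(\<lambda>\<omega>. \<omega> (k, i)) \<in> M \<rightarrow>\<^sub>M count_space UNIV" for k
    proof -
      have "(\<lambda>\<omega>. \<omega> (k, i)) \<in> M \<rightarrow>\<^sub>M D"
        unfolding M_def by (rule measurable_component_singleton) simp
      also have "(M \<rightarrow>\<^sub>M D) = (M \<rightarrow>\<^sub>M count_space UNIV)"
        by (rule measurable_cong_sets) (simp_all add: D_def)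
      finally show ?thesis .
    qed
    then show ?thesis
    proof -
      have "(\<lambda>\<omega>. \<Sum>k\<in>K. \<omega> (k, i) * ?q ^ k) \<in> M \<rightarrow>\<^sub>M count_space UNIV" if "finite K" for K
        using that
      proof (induction K)
        case (insert k K)
        have "(\<lambda>\<omega>. \<omega> (k, i) * ?q ^ k + (\<Sum>k\<in>K. \<omega> (k, i) * ?q ^ k)) \<in> M \<rightarrow>\<^sub>M count_space UNIV"
          by (rule measurable_compose_countable[OF _ insert.IH, of "\<lambda>b \<omega>. \<omega> (k, i) * ?q ^ k + b"])
            (rule measurable_compose[OF comp, of "\<lambda>a. a * ?q ^ k + _"], simp)
        then show ?case using insert.hyps by simp
      qed simp
      from measurable_compose[OF this[of "{..<n}"], of "\<lambda>a. a mod ?q ^ n" "count_space UNIV"]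
      show ?thesis unfolding res_def by simp
    qed
  qed
  have pre: "T -` padic_cyl n r \<inter> space M = {\<omega> \<in> space M. \<forall>i. res \<omega> i n = r i}" for n r
    by (auto simp: padic_cyl_def res)
  have pre_meas: "T -` padic_cyl n r \<inter> space M \<in> sets M" for n r
    unfolding pre using meas_res by measurable
  have T: "T \<in> M \<rightarrow>\<^sub>M borel"
  proof (rule measurable_sigma_sets[OF sets_borel_padic_vec])
    fix A :: "('p padic_int ^ 'n) set"
    assume "A \<in> padic_cyls"
    then obtain n r where "A = padic_cyl n r" by auto
    then show "T -` A \<inter> space M \<in> sets M" using pre_meas by simp
  qed auto
  define \<mu> where "\<mu> = distr M borel T"
  interpret \<mu>: prob_space \<mu> unfolding \<mu>_def by (rule M.prob_space_distr[OF T])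
  have cyl: "emeasure \<mu> (padic_cyl n (\<lambda>i. padic_residue (x $ i) n)) =
      (\<Prod>ki\<in>{..<n} \<times> (UNIV :: 'n set). ennreal (1 / ?q))" for n and x :: "'p padic_int ^ 'n"
  proof -
    let ?C = "padic_cyl n (\<lambda>i. padic_residue (x $ i) n) :: ('p padic_int ^ 'n) set"
    let ?\<delta> = "\<lambda>(k, i). (padic_residue (x $ i) (Suc k) - padic_residue (x $ i) k) div ?q ^ k"
    let ?J = "{..<n} \<times> (UNIV :: 'n set)"
    let ?E = "{\<omega> \<in> space M. \<forall>j\<in>?J. \<omega> j \<in> {?\<delta> j}}"
    have "emeasure \<mu> ?C = emeasure M (T -` ?C \<inter> space M)"
      unfolding \<mu>_def by (rule emeasure_distr[OF T]) (auto intro!: borel_open open_padic_cyl)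
    also have "\<dots> = emeasure M ?E"
    proof (rule emeasure_eq_AE)
      have "AE \<omega> in M. \<omega> j \<in> {0..<?q}" for j
        unfolding M_def
      proof (rule P.AE_component)
        show "AE y in D. y \<in> {0..<?q}"
          unfolding D_def using D_set by (auto simp: AE_measure_pmf_iff)
      qed simp
      then have "AE \<omega> in M. \<forall>j. \<omega> j \<in> {0..<?q}"
        by (simp add: AE_all_countable)
      then show "AE \<omega> in M. \<omega> \<in> T -` ?C \<inter> space M \<longleftrightarrow> \<omega> \<in> ?E"
      proof (rule AE_mp, intro AE_I2 impI)
        fix \<omega> assume "\<omega> \<in> space M" and d: "\<forall>j. \<omega> j \<in> {0..<?q}"
        have "res \<omega> i n = padic_residue (x $ i) n \<longleftrightarrow> (\<forall>k<n. \<omega> (k, i) = ?\<delta> (k, i))" for i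
          unfolding res_def using digits_unique[of "\<lambda>k. \<omega> (k, i)" n "x $ i"] d by simp
        then show "\<omega> \<in> T -` ?C \<inter> space M \<longleftrightarrow> \<omega> \<in> ?E"
          unfolding pre using \<open>\<omega> \<in> space M\<close> by auto
      qed
    next
      show "T -` ?C \<inter> space M \<in> sets M" by (rule pre_meas)
      show "?E \<in> sets M"
      proof (rule sets.sets_Collect_finite_All)
        fix j :: "nat \<times> 'n"
        have "(\<lambda>\<omega>. \<omega> j) \<in> M \<rightarrow>\<^sub>M D"
          unfolding M_def by (rule measurable_component_singleton) simp
        from measurable_sets[OF this, of "{?\<delta> j}"]
        show "{\<omega> \<in> space M. \<omega> j \<in> {?\<delta> j}} \<in> sets M"
          by (simp add: D_def vimage_def Int_def conj_commute)
      qed auto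
    qed
    also have "\<dots> = (\<Prod>j\<in>?J. emeasure D {?\<delta> j})"
      unfolding M_def space_PiM[symmetric]
      by (rule P.emeasure_PiM_Collect) (auto simp: D_def)
    also have "\<dots> = (\<Prod>j\<in>?J. ennreal (1 / ?q))"
    proof (rule prod.cong[OF refl])
      fix j :: "nat \<times> 'n"
      obtain k i where j: "j = (k, i)" by (cases j)
      have "?\<delta> j \<in> {0..<?q}" using digit_range[of "x $ i" k] by (simp add: j)
      then have "pmf (pmf_of_set {0..<?q}) (?\<delta> j) = 1 / ?q"
        using q by (subst pmf_of_set) auto
      then show "emeasure D {?\<delta> j} = ennreal (1 / ?q)"
        by (simp add: D_def emeasure_pmf_single)
    qed
    finally show ?thesis .
  qed
  have shift: "(\<lambda>x. - a + x) -` padic_cyl n (\<lambda>i. padic_residue (x0 $ i) n) =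
      padic_cyl n (\<lambda>i. padic_residue ((a + x0) $ i) n)" for n and a x0 :: "'p padic_int ^ 'n"
  proof -
    have "padic_residue (- (a $ i) + x $ i) n = padic_residue (x0 $ i) n \<longleftrightarrow>
        padic_residue (x $ i) n = padic_residue (a $ i + x0 $ i) n" for x :: "'p padic_int ^ 'n" and i
      using padic_residue_add_cong[of "a $ i" "- (a $ i) + x $ i" n "x0 $ i"] by simp
    then show ?thesis by (auto simp: padic_cyl_def)
  qed
  have shift_ex: "\<exists>s. (\<lambda>x. - a + x) -` padic_cyl n r = padic_cyl n s \<and>
      emeasure \<mu> (padic_cyl n s) = emeasure \<mu> (padic_cyl n r)" for n r and a :: "'p padic_int ^ 'n"
  proof (cases "\<exists>x0 :: 'p padic_int ^ 'n. \<forall>i. r i = padic_residue (x0 $ i) n")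
    case True
    then obtain x0 :: "'p padic_int ^ 'n" where r: "r = (\<lambda>i. padic_residue (x0 $ i) n)"
      by auto
    show ?thesis
      unfolding r by (intro exI[of _ "\<lambda>i. padic_residue ((a + x0) $ i) n"] conjI shift) (simp only: cyl)
  next
    case False
    then have "\<not> (\<forall>i. padic_residue (y $ i) n = r i)" for y :: "'p padic_int ^ 'n"
      by metis
    then have "padic_cyl n r = ({} :: ('p padic_int ^ 'n) set)"
      unfolding padic_cyl_def by blast
    then show ?thesis by (intro exI[of _ r]) simp
  qed
  have trans: "(\<lambda>x. - a + x) \<in> borel \<rightarrow>\<^sub>M borel" for a :: "'p padic_int ^ 'n"
  proof (rule measurable_sigma_sets[OF sets_borel_padic_vec])
    fix A :: "('p padic_int ^ 'n) set"
    assume "A \<in> padic_cyls"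
    then obtain n r where "A = padic_cyl n r" by auto
    with shift_ex[of a n r] obtain s where "(\<lambda>x. - a + x) -` A = padic_cyl n s" by auto
    then show "(\<lambda>x. - a + x) -` A \<inter> space borel \<in> sets borel"
      by (simp add: borel_open open_padic_cyl)
  qed auto
  have inv: "distr \<mu> borel (\<lambda>x. - a + x) = \<mu>" for a
  proof (rule measure_eqI_generator_eq[where E = padic_cyls and \<Omega> = UNIV and A = "\<lambda>_. UNIV"])
    have tr: "(\<lambda>x. - a + x) \<in> \<mu> \<rightarrow>\<^sub>M borel" using trans[of a] by (simp add: \<mu>_def)
    show "Int_stable (padic_cyls :: ('p padic_int ^ 'n) set set)"
    proof (rule Int_stableI)
      fix A B :: "('p padic_int ^ 'n) set"
      assume "A \<in> padic_cyls" "B \<in> padic_cyls"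
      then obtain n r m s where "A = padic_cyl n r" "B = padic_cyl m s" by auto
      moreover obtain k t where "padic_cyl n r \<inter> padic_cyl m s = (padic_cyl k t :: ('p padic_int ^ 'n) set)"
        using padic_cyl_Int by blast
      ultimately show "A \<inter> B \<in> padic_cyls" by auto
    qed
    show "padic_cyls \<subseteq> Pow (UNIV :: ('p padic_int ^ 'n) set)" by simp
    show "sets (distr \<mu> borel (\<lambda>x. - a + x)) = sigma_sets UNIV padic_cyls"
      by (simp add: sets_borel_padic_vec)
    show "sets \<mu> = sigma_sets UNIV padic_cyls" by (simp add: \<mu>_def sets_borel_padic_vec)
    have "padic_residue (x :: 'p padic_int) 0 = 0" for x
      using padic_residue_bounds[of x 0] by simp
    then have "UNIV = (padic_cyl 0 (\<lambda>_. 0) :: ('p padic_int ^ 'n) set)"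
      by (auto simp: padic_cyl_def)
    then show "range (\<lambda>_ :: nat. UNIV) \<subseteq> (padic_cyls :: ('p padic_int ^ 'n) set set)" by auto
    show "(\<Union>i :: nat. UNIV) = (UNIV :: ('p padic_int ^ 'n) set)" by simp
    show "emeasure (distr \<mu> borel (\<lambda>x. - a + x)) UNIV \<noteq> \<infinity>" for i :: nat
      using prob_space.emeasure_space_1[OF \<mu>.prob_space_distr[OF tr]] by simp
    fix C :: "('p padic_int ^ 'n) set"
    assume "C \<in> padic_cyls"
    then obtain n r where C: "C = padic_cyl n r" by auto
    obtain s where s: "(\<lambda>x. - a + x) -` C = padic_cyl n s" "emeasure \<mu> (padic_cyl n s) = emeasure \<mu> C"
      using shift_ex[of a n r] unfolding C by blast
    have "emeasure (distr \<mu> borel (\<lambda>x. - a + x)) C = emeasure \<mu> ((\<lambda>x. - a + x) -` C \<inter> space \<mu>)"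
      by (rule emeasure_distr[OF tr]) (simp add: C borel_open open_padic_cyl)
    then show "emeasure (distr \<mu> borel (\<lambda>x. - a + x)) C = emeasure \<mu> C"
      using s by (simp add: \<mu>_def)
  qed
  have "emeasure \<mu> ((+) a ` A) = emeasure \<mu> A" if "A \<in> sets borel" for a A
  proof -
    have "(+) a ` A = (\<lambda>x. - a + x) -` A"
    proof safe
      fix x assume "- a + x \<in> A"
      then have "a + (- a + x) \<in> (+) a ` A" by blast
      then show "x \<in> (+) a ` A" by simp
    qed simp
    moreover have "emeasure (distr \<mu> borel (\<lambda>x. - a + x)) A = emeasure \<mu> ((\<lambda>x. - a + x) -` A)"
      using emeasure_distr[of "\<lambda>x. - a + x" \<mu> borel A] trans[of a] that by (simp add: \<mu>_def)
    ultimately show ?thesis by (simp only: inv)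
  qed
  then have "normalized_haar \<mu>"
    unfolding normalized_haar_def using \<mu>.prob_space_axioms by (simp add: \<mu>_def)
  then show ?thesis by blast
qed

section \<open>The maximal unramified extension\<close>

type_synonym 'p padic = "'p padic_int fract"

type_synonym 'p padic_closure = "'p padic alg_closure"

definition of_padic_int :: "'p::prime_card padic_int \<Rightarrow> 'p padic_closure" where
  "of_padic_int a = to_ac (Fract a 1)"

definition finite_extension :: "'p::prime_card padic_closure set \<Rightarrow> bool" where
  "finite_extension L \<longleftrightarrow> subfield L ring_of_type_algebra \<and> range to_ac \<subseteq> L \<and>
     ring.finite_dimension ring_of_type_algebra (range to_ac) L"

definition integer_ring :: "'p::prime_card padic_closure set \<Rightarrow> 'p padic_closure set" where
  "integer_ring L = {x \<in> L. \<exists>f :: 'p padic_int poly.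
     Polynomial.lead_coeff f = 1 \<and> poly (Polynomial.map_poly of_padic_int f) x = 0}"

definition maximal_ideal :: "'p::prime_card padic_closure set \<Rightarrow> 'p padic_closure set" where
  "maximal_ideal L = {x \<in> integer_ring L. \<not> (\<exists>y\<in>integer_ring L. x * y = 1)}"

text \<open>
  A finite extension is unramified if its ramification index is 1, that is, if $p$ generates
  the maximal ideal of its ring of integers (the set of non-units, as that ring is local).
  The residue fields are finite, so that the residue extension is automatically separable.
\<close>

definition unramified :: "'p::prime_card padic_closure set \<Rightarrow> bool" where
  "unramified L \<longleftrightarrow> maximal_ideal L = (\<lambda>x. of_nat CARD('p) * x) ` integer_ring L"

definition padic_nr :: "'p::prime_card padic_closure set" where
  "padic_nr = \<Union> {L. finite_extension L \<and> unramified L}"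

section \<open>Ternary cubic forms\<close>

definition ternary_cubic :: "'a::comm_ring_1 ^ 10 \<Rightarrow> 'a \<Rightarrow> 'a \<Rightarrow> 'a \<Rightarrow> 'a" where
  "ternary_cubic c x y z =
     c $ 0 * x ^ 3 + c $ 1 * y ^ 3 + c $ 2 * z ^ 3
     + c $ 3 * x ^ 2 * y + c $ 4 * x ^ 2 * z + c $ 5 * y ^ 2 * x
     + c $ 6 * y ^ 2 * z + c $ 7 * z ^ 2 * x + c $ 8 * z ^ 2 * y
     + c $ 9 * x * y * z"

definition soluble_nr :: "'p::prime_card padic_int ^ 10 \<Rightarrow> bool" where
  "soluble_nr c \<longleftrightarrow> (\<exists>x\<in>padic_nr. \<exists>y\<in>padic_nr. \<exists>z\<in>padic_nr.
     (x, y, z) \<noteq> (0, 0, 0) \<and> ternary_cubic (\<chi> i. of_padic_int (c $ i)) x y z = 0)"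

end

theory Submission
  imports Defs "Jordan_Normal_Form.Char_Poly"
begin

text \<open>
  Call a form insoluble if it has no zero over any single unramified extension of \<open>\<rat>\<^sub>p\<close>. If the
  restriction of a form to a line is \<open>p\<^sup>k g\<close>, where \<open>g\<close> is modulo \<open>p\<close> neither zero nor a constant times the
  cube of a linear form, then \<open>g\<close> has a simple root modulo \<open>p\<close>, which lifts by Hensel's lemma, or it is
  irreducible modulo \<open>p\<close>, and then adjoining a root of it is unramified. Hence an insoluble form that is
  not divisible by \<open>p\<close> is equivalent to one that is congruent to \<open>c\<^sub>0 X\<^sup>3\<close>. Applying the same remark to
  \<open>C(pX, Y, Z)\<close> and \<open>C(pX, pY, Z)\<close> one ends up either with a form that can be divided by a higher power
  of \<open>p\<close> than the determinant of the substitution, or with a terminal form in which the coefficients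
  of \<open>X\<^sup>3, Y\<^sup>3, Z\<^sup>3\<close> have valuations \<open>0, 1, 2\<close>. Each step is a disjoint union of
  images under linear maps of known determinant, so that the measures of the states satisfy a linear
  system, whose solution is the formula.

  The coordinates of a zero over the maximal unramified extension may lie in different finite extensions.
  Instead of proving that the compositum is unramified, we embed all rings of integers into one ring in which every
  element is a unit of a fixed valuation ring or divisible by \<open>p\<close>. A terminal form has no zeros there.
  This also shows that insolubility is an open condition, hence measurable.
\<close>

hide_const (open) up_ring.coeff up_ring.monom Polynomials.degree Polynomials.lead_coeff
  Divisibility.prime Divisibility.irreducible module.smult Determinant.det

no_notation Matrix.vec_index (infixl "$" 100)

section \<open>Divisibility in the ring of $p$-adic integers\<close>

text \<open>Only binary cubics are ever solved: the coordinate lines and the line Y = Z force all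
  the congruences that the reduction uses, so no geometry of plane cubics over finite fields enters.
  Each division step replaces C by C(p^i X, p^j Y, Z) / p^(i+j+1). On the coefficient space the
  substitution has index p^(10(i+j)), because each variable occurs 10 times in total in the ten
  cubic monomials, while the division removes p^(10(i+j+1)). Hence every division step carries the
  same factor p^-10. Between two divisions there are p or p^2 shears to choose from. The loop
  through \<open>IS2\<close> therefore has weight p^2 / p^10, the loop through \<open>IS1\<close>
  and \<open>IT\<close> has weight p^2 / p^20, and the loop of all insoluble forms has weight p^-10.
  These loops produce the factors p^8 - 1, p^18 - 1 and p^10 - 1, and p^9 + 1 cancels from the
  second one.\<close>

abbreviation pp :: "'p::prime_card padic_int" where
  "pp \<equiv> of_nat CARD('p)"

lemma padic_residue_0 [simp]: "padic_residue (0 :: 'p::prime_card padic_int) n = 0"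
  by transfer simp

lemma padic_residue_1: "padic_residue (1 :: 'p::prime_card padic_int) n = 1 mod int CARD('p) ^ n"
  by transfer simp

lemma padic_residue_mult:
  "padic_residue (x * y :: 'p::prime_card padic_int) n =
     (padic_residue x n * padic_residue y n) mod int CARD('p) ^ n"
  by transfer simp

lemma padic_residue_diff:
  "padic_residue (x - y :: 'p::prime_card padic_int) n =
     (padic_residue x n - padic_residue y n) mod int CARD('p) ^ n"
  by transfer simp

lemma padic_residue_of_nat:
  "padic_residue (of_nat k :: 'p::prime_card padic_int) n = int k mod int CARD('p) ^ n"
  by (induction k) (simp_all add: padic_residue_add padic_residue_1 mod_simps)

lemma padic_residue_of_int:
  "padic_residue (of_int k :: 'p::prime_card padic_int) n = k mod int CARD('p) ^ n"
  by (cases k rule: int_cases2)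
    (simp_all add: padic_residue_of_nat padic_residue_diff[of 0, simplified] mod_simps)

lemma pp_power_dvd_iff:
  fixes x :: "'p::prime_card padic_int"
  shows "pp ^ n dvd x \<longleftrightarrow> padic_residue x n = 0"
proof
  have "padic_residue (pp ^ n :: 'p padic_int) n = 0"
    using padic_residue_of_nat[of "CARD('p) ^ n" n, where 'p='p] by simp
  then show "padic_residue x n = 0" if "pp ^ n dvd x"
    using that by (auto simp: padic_residue_mult)
next
  assume x: "padic_residue x n = 0"
  let ?q = "int CARD('p)"
  \<comment> \<open>The quotient modulo p^m is determined by \<open>x\<close> modulo p^(m+n), hence
    the shifted index.\<close>
  define y where "y = (\<lambda>m. padic_residue x (m + n) div ?q ^ n)"
  have q: "?q > 0" using card_pow_pos[where 'p='p, of 1] by simp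
  have dv: "?q ^ n dvd padic_residue x (m + n)" for m
    using padic_residue_mod[of n "m + n" x] x by auto
  have eq: "padic_residue x (m + n) = y m * ?q ^ n" for m
    using dv[of m] by (simp add: y_def)
  have "y m \<in> {0..<?q ^ m}" for m
    using padic_residue_bounds[of x "m + n"] q zero_less_power[OF q, of n] unfolding eq
    by (auto simp: power_add zero_le_mult_iff)
  moreover have "y (Suc m) mod ?q ^ m = y m" for m
  proof -
    have "(y (Suc m) * ?q ^ n) mod (?q ^ m * ?q ^ n) = y m * ?q ^ n"
      using padic_residue_mod[of "m + n" "Suc m + n" x] unfolding eq by (simp add: power_add)
    then show ?thesis using q by simp
  qed
  ultimately have Y: "padic_residue (Abs_padic_int y :: 'p padic_int) m = y m" for m
    by (simp add: Abs_padic_int_inverse)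
  have "x = pp ^ n * Abs_padic_int y"
  proof (rule padic_int_eqI)
    fix m
    have "padic_residue (pp ^ n :: 'p padic_int) m = ?q ^ n mod ?q ^ m"
      using padic_residue_of_nat[of "CARD('p) ^ n" m, where 'p='p] by simp
    then have "padic_residue (pp ^ n * Abs_padic_int y :: 'p padic_int) m = (y m * ?q ^ n) mod ?q ^ m"
      by (simp add: padic_residue_mult Y mod_simps mult.commute)
    also have "\<dots> = padic_residue x m"
      unfolding eq[symmetric] by (simp add: padic_residue_mod)
    finally show "padic_residue x m = padic_residue (pp ^ n * Abs_padic_int y :: 'p padic_int) m" by (rule sym)
  qed
  then show "pp ^ n dvd x" by simp
qed

lemma padic_residue_eq_iff:
  fixes x y :: "'p::prime_card padic_int"
  shows "padic_residue x n = padic_residue y n \<longleftrightarrow> pp ^ n dvd x - y"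
  using padic_residue_bounds[of x n] padic_residue_bounds[of y n]
  by (auto simp: pp_power_dvd_iff padic_residue_diff mod_eq_dvd_iff[symmetric] mod_pos_pos_trivial
      dvd_eq_mod_eq_0[symmetric])

lemma pp_not_unit: "\<not> (pp :: 'p::prime_card padic_int) dvd 1"
  using pp_power_dvd_iff[of 1 "1 :: 'p padic_int"] prime_gt_1_nat[OF prime_card[where 'a='p]]
  by (simp add: padic_residue_1)

lemma pp_nonzero: "(pp :: 'p::prime_card padic_int) \<noteq> 0"
proof
  assume "(pp :: 'p padic_int) = 0"
  then have "padic_residue (pp :: 'p padic_int) 2 = 0" by simp
  then have "int CARD('p) mod int CARD('p) ^ 2 = 0" by (simp only: padic_residue_of_nat)
  moreover have "int CARD('p) < int CARD('p) ^ 2"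
    using prime_gt_1_nat[OF prime_card[where 'a='p]] by (simp add: power2_eq_square)
  ultimately show False by simp
qed

lemma pp_dvd_iff: "(pp :: 'p::prime_card padic_int) dvd x \<longleftrightarrow> padic_residue x 1 = 0"
  using pp_power_dvd_iff[of 1 x] by simp

lemma padic_eq_0_iff: "(x :: 'p::prime_card padic_int) = 0 \<longleftrightarrow> (\<forall>n. pp ^ n dvd x)"
  by (auto simp: pp_power_dvd_iff intro!: padic_int_eqI)

lemma pp_dvd_mult_iff: "(pp :: 'p::prime_card padic_int) dvd x * y \<longleftrightarrow> pp dvd x \<or> pp dvd y"
proof -
  have "Factorial_Ring.prime (int CARD('p))" by (simp add: prime_card)
  note prime_dvd_mult_iff[OF this]
  then show ?thesis
    by (simp add: pp_dvd_iff padic_residue_mult dvd_eq_mod_eq_0[symmetric])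
      (use padic_residue_bounds[of x 1] padic_residue_bounds[of y 1] in
        \<open>auto simp: dvd_eq_mod_eq_0 mod_pos_pos_trivial\<close>)
qed

lemma pp_dvd_power_iff: "(pp :: 'p::prime_card padic_int) dvd x ^ k \<longleftrightarrow> pp dvd x \<and> k > 0"
  by (induction k) (auto simp: pp_dvd_mult_iff pp_not_unit)

lemma padic_decomp:
  fixes x :: "'p::prime_card padic_int"
  assumes "x \<noteq> 0"
  obtains k u where "x = pp ^ k * u" "\<not> pp dvd u"
proof -
  obtain n where n: "\<not> pp ^ n dvd x" using assms padic_eq_0_iff by blast
  define k where "k = (LEAST n. \<not> pp ^ n dvd x) - 1"
  have "\<not> pp ^ (LEAST n. \<not> pp ^ n dvd x) dvd x" by (rule LeastI[of _ n]) (rule n)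
  moreover have "(LEAST n. \<not> pp ^ n dvd x) \<noteq> 0" using calculation by (auto simp del: of_nat_power intro!: gr0I)
  ultimately have k: "\<not> pp ^ Suc k dvd x" "k < (LEAST n. \<not> pp ^ n dvd x)" unfolding k_def by auto
  have "pp ^ k dvd x" using not_less_Least[OF k(2)] by blast
  then obtain u where u: "x = pp ^ k * u" by (auto elim: dvdE)
  have "\<not> pp dvd u" using k(1) unfolding u by (auto simp: mult_ac elim!: dvdE)
  with u show ?thesis by (rule that)
qed

text \<open>Compactness in the form of a cluster point, which spares the choice of a subsequence. At
  each level there are finitely many residue vectors, so compatible classes that contain infinitely
  many \<open>v m\<close> can be chosen one level after another.\<close>

lemma padic_limit_point:
  fixes v :: "nat \<Rightarrow> 'p::prime_card padic_int ^ 'n"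
  shows "\<exists>w. \<forall>n. \<exists>m\<ge>n. \<forall>i. pp ^ n dvd v m $ i - w $ i"
proof -
  let ?q = "int CARD('p)"
  let ?res = "\<lambda>n m i. padic_residue (v m $ i) n"
  let ?A = "\<lambda>n r. {m. ?res n m = r}"
  have fin: "finite (range (?res n))" for n
  proof (rule finite_subset)
    show "range (?res n) \<subseteq> (\<Pi>\<^sub>E i\<in>UNIV. {0..<?q ^ n})"
      by (auto simp: PiE_def extensional_def intro!: padic_residue_bounds[THEN atLeastLessThan_iff[THEN iffD1], THEN conjunct1]
          padic_residue_bounds[THEN atLeastLessThan_iff[THEN iffD1], THEN conjunct2])
  qed (simp add: finite_PiE)
  have "\<exists>r. (infinite (?A 0 (r 0)) \<and> True) \<and> (\<forall>n. (infinite (?A (Suc n) (r (Suc n)))) \<and> (\<forall>i. r (Suc n) i mod ?q ^ n = r n i))"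
  proof -
    have "\<exists>r. \<forall>n. infinite (?A n (r n)) \<and> (\<forall>i. r (Suc n) i mod ?q ^ n = r n i)"
    proof (rule dependent_nat_choice)
      have "padic_residue (x :: 'p padic_int) 0 = 0" for x
        using padic_residue_bounds[of x 0] by simp
      then show "\<exists>r. infinite (?A 0 r)" by (auto intro!: exI[of _ "\<lambda>_. 0"])
    next
      fix r n
      assume r: "infinite (?A n r)"
      have "\<exists>m0\<in>?A n r. infinite {m \<in> ?A n r. ?res (Suc n) m = ?res (Suc n) m0}"
        by (rule pigeonhole_infinite[OF r]) (rule finite_subset[OF _ fin[of "Suc n"]], auto)
      then obtain m0 where m0: "?res n m0 = r" "infinite {m \<in> ?A n r. ?res (Suc n) m = ?res (Suc n) m0}"
        by blast
      have "infinite (?A (Suc n) (?res (Suc n) m0))"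
        by (rule infinite_super[OF _ m0(2)]) auto
      moreover have "\<forall>i. ?res (Suc n) m0 i mod ?q ^ n = r i"
        using m0(1) by (auto simp: padic_residue_mod)
      ultimately show "\<exists>r'. infinite (?A (Suc n) r') \<and> (\<forall>i. r' i mod ?q ^ n = r i)" by blast
    qed
    then show ?thesis by blast
  qed
  then obtain r where r: "\<And>n. infinite (?A n (r n))" "\<And>n i. r (Suc n) i mod ?q ^ n = r n i"
    by (metis not0_implies_Suc)
  have bnd: "r n i \<in> {0..<?q ^ n}" for n i
  proof -
    obtain m where "?res n m = r n" using r(1)[of n] by (metis (mono_tags) Collect_empty_eq finite.emptyI)
    then show ?thesis using padic_residue_bounds[of "v m $ i" n] by metis
  qed
  define w :: "'p padic_int ^ 'n" where "w = (\<chi> i. Abs_padic_int (\<lambda>n. r n i))"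
  have w: "padic_residue (w $ i) n = r n i" for n i
    using bnd r(2) by (simp add: w_def Abs_padic_int_inverse)
  have "\<exists>m\<ge>n. \<forall>i. pp ^ n dvd v m $ i - w $ i" for n
  proof -
    obtain m where "m \<ge> n" "?res n m = r n"
      using r(1)[of n] unfolding infinite_nat_iff_unbounded_le by blast
    then show ?thesis
      by (intro exI[of _ m]) (simp only: padic_residue_eq_iff[symmetric] w fun_eq_iff, simp)
  qed
  then show ?thesis by blast
qed

section \<open>Reduction modulo p onto the prime field\<close>

definition red :: "'p::prime_card padic_int \<Rightarrow> 'p mod_ring" where
  "red x = of_int_mod_ring (padic_residue x 1)"

lemma of_int_mod_ring_eq_iff:
  "(of_int_mod_ring a :: 'p::nontriv mod_ring) = of_int_mod_ring b \<longleftrightarrow> a mod int CARD('p) = b mod int CARD('p)"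
  by (metis of_int_mod_ring.rep_eq to_int_mod_ring.rep_eq of_int_mod_ring_to_int_mod_ring)

lemma of_int_mod_ring_mod: "(of_int_mod_ring (a mod int CARD('p)) :: 'p::nontriv mod_ring) = of_int_mod_ring a"
  by (simp add: of_int_mod_ring_eq_iff)

lemma red_0 [simp]: "red 0 = 0"
  by (simp add: red_def)

lemma red_add [simp]: "red (x + y) = red x + red y"
  by (simp add: red_def padic_residue_add of_int_mod_ring_mod) (simp add: of_int_of_int_mod_ring[symmetric])

lemma red_mult [simp]: "red (x * y) = red x * red y"
  by (simp add: red_def padic_residue_mult of_int_mod_ring_mod) (simp add: of_int_of_int_mod_ring[symmetric])

lemma red_1 [simp]: "red 1 = 1"
  by (simp add: red_def padic_residue_1 of_int_mod_ring_mod) (simp add: of_int_of_int_mod_ring[symmetric])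

lemma red_eq_0_iff: "red x = 0 \<longleftrightarrow> pp dvd x"
  using padic_residue_bounds[of x 1]
  by (simp add: red_def pp_dvd_iff of_int_mod_ring_eq_iff[of _ 0, simplified] mod_pos_pos_trivial)

lemma red_uminus [simp]: "red (- x) = - red x"
  using red_add[of x "- x"] by (simp add: eq_neg_iff_add_eq_0 add.commute)

lemma red_diff [simp]: "red (x - y) = red x - red y"
  using red_add[of x "- y"] by simp

lemma red_power [simp]: "red (x ^ k) = red x ^ k"
  by (induction k) simp_all

lemma red_of_int [simp]: "red (of_int k) = of_int k"
  by (simp add: red_def padic_residue_of_int of_int_mod_ring_mod of_int_of_int_mod_ring)

lemma red_of_nat [simp]: "red (of_nat k) = of_nat k"
  using red_of_int[of "int k"] by (simp del: red_of_int)

lemma red_numeral [simp]: "red (numeral k) = numeral k"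
  using red_of_int[of "numeral k"] by (simp del: red_of_int)

lemma red_eq_iff: "red x = red y \<longleftrightarrow> pp dvd x - y"
  by (simp add: red_eq_0_iff[symmetric])

text \<open>Bounded representatives are kept because \<open>cube_mod\<close> ranges over them and
  the shears are counted later.\<close>

lemma red_surj: "\<exists>k < CARD('p). red (of_nat k) = (a :: 'p::prime_card mod_ring)"
proof -
  have "a = of_int (to_int_mod_ring a)" by (simp add: of_int_of_int_mod_ring)
  moreover have "to_int_mod_ring a \<in> {0..<int CARD('p)}"
    using range_to_int_mod_ring[where 'a='p] by blast
  ultimately show ?thesis
    by (intro exI[of _ "nat (to_int_mod_ring a)"]) auto
qed

section \<open>Valuation rings\<close>

definition is_subring :: "'a::comm_ring_1 set \<Rightarrow> bool" where
  "is_subring A \<longleftrightarrow> 1 \<in> A \<and> (\<forall>x\<in>A. \<forall>y\<in>A. x - y \<in> A) \<and> (\<forall>x\<in>A. \<forall>y\<in>A. x * y \<in> A)"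

lemma is_subringI:
  assumes "1 \<in> A" "\<And>x y. x \<in> A \<Longrightarrow> y \<in> A \<Longrightarrow> x - y \<in> A" "\<And>x y. x \<in> A \<Longrightarrow> y \<in> A \<Longrightarrow> x * y \<in> A"
  shows "is_subring A"
  using assms by (simp add: is_subring_def)

context
  fixes A :: "'a::comm_ring_1 set"
  assumes A: "is_subring A"
begin

lemma subring_1: "1 \<in> A"
  using A by (simp add: is_subring_def)

lemma subring_diff: "x \<in> A \<Longrightarrow> y \<in> A \<Longrightarrow> x - y \<in> A"
  using A by (simp add: is_subring_def)

lemma subring_mult: "x \<in> A \<Longrightarrow> y \<in> A \<Longrightarrow> x * y \<in> A"
  using A by (simp add: is_subring_def)

lemma subring_0: "0 \<in> A"
  using subring_diff[OF subring_1 subring_1] by simp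

lemma subring_uminus: "x \<in> A \<Longrightarrow> - x \<in> A"
  using subring_diff[OF subring_0, of x] by simp

lemma subring_add: "x \<in> A \<Longrightarrow> y \<in> A \<Longrightarrow> x + y \<in> A"
  using subring_diff[of x "- y"] subring_uminus by simp

lemma subring_power: "x \<in> A \<Longrightarrow> x ^ n \<in> A"
  by (induction n) (simp_all add: subring_1 subring_mult)

lemma subring_of_nat: "of_nat n \<in> A"
  by (induction n) (simp_all add: subring_0 subring_1 subring_add)

lemma subring_sum: "(\<And>i. i \<in> I \<Longrightarrow> f i \<in> A) \<Longrightarrow> sum f I \<in> A"
  by (induction I rule: infinite_finite_induct) (simp_all add: subring_0 subring_add)

lemmas subring_intros = subring_1 subring_0 subring_diff subring_mult subring_uminus subring_add
  subring_power subring_of_nat subring_sum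

lemma is_subring_adjoin: "is_subring {poly f x |f. \<forall>i. coeff f i \<in> A}"
proof (rule is_subringI)
  show "1 \<in> {poly f x |f. \<forall>i. coeff f i \<in> A}"
    by (rule CollectI, rule exI[of _ 1]) (simp add: subring_intros)
next
  fix a b assume "a \<in> {poly f x |f. \<forall>i. coeff f i \<in> A}" "b \<in> {poly f x |f. \<forall>i. coeff f i \<in> A}"
  then obtain f g where fg: "a = poly f x" "b = poly g x" "\<And>i. coeff f i \<in> A" "\<And>i. coeff g i \<in> A"
    by blast
  show "a - b \<in> {poly f x |f. \<forall>i. coeff f i \<in> A}"
    by (rule CollectI, rule exI[of _ "f - g"]) (simp add: fg subring_intros)
  show "a * b \<in> {poly f x |f. \<forall>i. coeff f i \<in> A}"
    by (rule CollectI, rule exI[of _ "f * g"]) (simp add: fg coeff_mult subring_intros)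
qed

end

lemma adjoin_superset:
  assumes "is_subring A"
  shows "A \<subseteq> {poly f x |f. \<forall>i. coeff f i \<in> A}" "x \<in> {poly f x |f. \<forall>i. coeff f i \<in> A}"
proof
  fix a assume "a \<in> A"
  then show "a \<in> {poly f x |f. \<forall>i. coeff f i \<in> A}"
    by (intro CollectI exI[of _ "[:a:]"]) (auto simp: coeff_pCons subring_0[OF assms] split: nat.split)
next
  show "x \<in> {poly f x |f. \<forall>i. coeff f i \<in> A}"
    by (intro CollectI exI[of _ "[:0, 1:]"])
      (auto simp: coeff_pCons subring_0[OF assms] subring_1[OF assms] split: nat.split)
qed

text \<open>
  Chevalley: a subring that is maximal among those in which \<open>\<pi>\<close> is not invertible is a
  valuation ring. If neither \<open>x\<close> nor its inverse belonged to it, then \<open>1/\<pi>\<close> would be a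
  polynomial in each of them, and the lengths of these two relations could be decreased forever.
\<close>

theorem exists_valuation_ring:
  fixes A :: "'a::field set" and \<pi> :: 'a
  assumes A: "is_subring A" "\<pi> \<in> A" "inverse \<pi> \<notin> A"
  obtains V where "is_subring V" "A \<subseteq> V" "inverse \<pi> \<notin> V" "\<And>x. x \<in> V \<or> inverse x \<in> V"
proof -
  define C where "C = {V. is_subring V \<and> A \<subseteq> V \<and> inverse \<pi> \<notin> V}"
  have "\<exists>V\<in>C. \<forall>W\<in>C. V \<subseteq> W \<longrightarrow> W = V"
  proof (rule subset_Zorn)
    fix K assume K: "subset.chain C K"
    show "\<exists>U\<in>C. \<forall>M\<in>K. M \<subseteq> U"
    proof (cases "K = {}")
      case True
      then show ?thesis using A by (auto simp: C_def)
    next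
      case False
      have KC: "K \<subseteq> C" and lin: "\<And>M N. M \<in> K \<Longrightarrow> N \<in> K \<Longrightarrow> M \<subseteq> N \<or> N \<subseteq> M"
        using K by (auto simp: subset_chain_def)
      have sub: "is_subring M" if "M \<in> K" for M using that KC by (auto simp: C_def)
      have common: "\<exists>M\<in>K. x \<in> M \<and> y \<in> M" if "x \<in> \<Union>K" "y \<in> \<Union>K" for x y
      proof -
        obtain M N where "M \<in> K" "N \<in> K" "x \<in> M" "y \<in> N" using \<open>x \<in> \<Union>K\<close> \<open>y \<in> \<Union>K\<close> by blast
        then show ?thesis using lin[of M N] by blast
      qed
      have "is_subring (\<Union>K)"
      proof (rule is_subringI)
        show "1 \<in> \<Union>K" using False sub subring_1 by blast
        show "x - y \<in> \<Union>K" "x * y \<in> \<Union>K" if "x \<in> \<Union>K" "y \<in> \<Union>K" for x y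
          using common[OF that] sub subring_diff subring_mult by blast+
      qed
      then have "\<Union>K \<in> C" using False KC by (auto simp: C_def)
      then show ?thesis by blast
    qed
  qed
  then obtain V where "V \<in> C" and max: "\<And>W. W \<in> C \<Longrightarrow> V \<subseteq> W \<Longrightarrow> W = V" by blast
  then have V: "is_subring V" "A \<subseteq> V" "inverse \<pi> \<notin> V" by (auto simp: C_def)
  note VI = subring_intros[OF V(1)]
  have pV: "\<pi> \<in> V" using A V by blast
  have p0: "\<pi> \<noteq> 0" using V(3) VI by auto
  have no1: "1 \<noteq> \<pi> * b" if "b \<in> V" for b
    using that V(3) p0 by (metis inverse_unique)
  \<comment> \<open>Maximality of \<open>V\<close>: adjoining \<open>x\<close> gives a strictly
    larger ring, so \<open>\<pi>\<close> must become invertible in it.\<close>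
  have adj: "\<exists>f. (\<forall>i. coeff f i \<in> V) \<and> 1 = \<pi> * poly f x" if "x \<notin> V" for x
  proof (rule ccontr)
    assume *: "\<not> ?thesis"
    let ?W = "{poly f x |f. \<forall>i. coeff f i \<in> V}"
    have "inverse \<pi> \<notin> ?W"
    proof
      assume "inverse \<pi> \<in> ?W"
      then obtain f where f: "\<forall>i. coeff f i \<in> V" "inverse \<pi> = poly f x" by blast
      have "1 = \<pi> * poly f x" using p0 by (simp flip: f(2))
      with f(1) * show False by blast
    qed
    then have "?W \<in> C"
      unfolding C_def using is_subring_adjoin[OF V(1)] adjoin_superset(1)[OF V(1)] V(2) by blast
    then have "?W = V" using max adjoin_superset(1)[OF V(1)] by blast
    then show False using adjoin_superset(2)[OF V(1), of x] that by (simp only:)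
  qed
  \<comment> \<open>Let w be \<open>1 - \<pi> * b\<close>. If 1/w were not in \<open>V\<close>,
    clearing denominators in the relation for 1/w would make a power of w divisible by
    \<open>\<pi>\<close>, whereas every power of w is 1 modulo \<open>\<pi>\<close>.\<close>
  have unit: "inverse (1 - \<pi> * b) \<in> V" if b: "b \<in> V" for b
  proof (rule ccontr)
    define w where "w = 1 - \<pi> * b"
    assume "inverse (1 - \<pi> * b) \<notin> V"
    then obtain f where f: "\<And>i. coeff f i \<in> V" "1 = \<pi> * poly f (inverse w)"
      using adj[of "inverse w"] by (auto simp: w_def)
    have w0: "w \<noteq> 0" using no1[OF b] by (simp add: w_def)
    have "w ^ degree f = 1 * w ^ degree f" by simp
    also have "\<dots> = \<pi> * (\<Sum>i\<le>degree f. coeff f i * inverse w ^ i) * w ^ degree f"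
      by (subst f(2)) (simp only: poly_altdef)
    also have "\<dots> = \<pi> * (\<Sum>i\<le>degree f. coeff f i * (inverse w ^ i * w ^ degree f))"
      by (simp add: sum_distrib_right mult.assoc)
    also have "(\<Sum>i\<le>degree f. coeff f i * (inverse w ^ i * w ^ degree f)) =
        (\<Sum>i\<le>degree f. coeff f i * w ^ (degree f - i))"
      by (rule sum.cong) (use w0 in \<open>auto simp: power_diff field_simps\<close>)
    finally have eq: "w ^ degree f = \<pi> * (\<Sum>i\<le>degree f. coeff f i * w ^ (degree f - i))" .
    have wV: "w \<in> V" unfolding w_def using b pV by (intro VI)
    have 1: "\<exists>v\<in>V. w ^ degree f = \<pi> * v"
      using eq by (rule bexI) (intro VI f(1) wV)
    have 2: "\<exists>v\<in>V. w ^ n = 1 - \<pi> * v" for n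
    proof (induction n)
      case 0 then show ?case using VI(2) by (auto intro!: bexI[of _ 0])
    next
      case (Suc n)
      then obtain v where v: "v \<in> V" "w ^ n = 1 - \<pi> * v" by blast
      have "w ^ Suc n = 1 - \<pi> * (b + v - b * (\<pi> * v))"
        unfolding power_Suc v(2) by (simp add: w_def algebra_simps)
      moreover have "b + v - b * (\<pi> * v) \<in> V" using b v pV by (intro VI)
      ultimately show ?case by blast
    qed
    obtain v where v: "v \<in> V" "w ^ degree f = \<pi> * v" using 1 by blast
    obtain v' where v': "v' \<in> V" "w ^ degree f = 1 - \<pi> * v'" using 2 by blast
    have "\<pi> * v = 1 - \<pi> * v'" by (rule trans[OF sym[OF v(2)] v'(2)])
    then have "1 = \<pi> * (v + v')" by (simp add: distrib_left)
    then show False using no1 VI(6)[OF v(1) v'(1)] by blast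
  qed
  \<comment> \<open>Descent on \<open>n + m\<close>. The shorter relation, multiplied by
    \<open>x ^ n\<close>, can be solved for \<open>x ^ n\<close> because
    \<open>1 - \<pi> * b 0\<close> is a unit; substituting lower powers for \<open>x ^ n\<close>
    shortens the other relation.\<close>
  have no2: False if "1 = \<pi> * (\<Sum>i\<le>n. a i * x ^ i)" "1 = \<pi> * (\<Sum>i\<le>m. b i * inverse x ^ i)"
      "\<And>i. a i \<in> V" "\<And>i. b i \<in> V" "m \<le> n" "x \<noteq> 0" for x a b n m
    using that
  proof (induction "n + m" arbitrary: n m a b x rule: less_induct)
    case less
    have "n \<noteq> 0"
    proof
      assume "n = 0"
      then have "1 = \<pi> * a 0" using less.prems(1) by simp
      then show False using no1 less.prems(3) by blast
    qed
    then obtain n' where n: "n = Suc n'" by (cases n) auto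
    define b' where "b' = (\<lambda>i. if i \<le> m then b i else 0)"
    have b'V: "b' i \<in> V" for i unfolding b'_def using less.prems(4) VI(2) by presburger
    have bs: "(\<Sum>i\<le>n. b' i * inverse x ^ i) = (\<Sum>i\<le>m. b i * inverse x ^ i)"
    proof (rule sum.mono_neutral_cong_right)
      show "finite {..n}" by simp
      show "{..m} \<subseteq> {..n}" using less.prems(5) by auto
      show "\<forall>i\<in>{..n} - {..m}. b' i * inverse x ^ i = 0" unfolding b'_def by simp
      show "b' i * inverse x ^ i = b i * inverse x ^ i" if "i \<in> {..m}" for i using that unfolding b'_def by simp
    qed
    define w where "w = 1 - \<pi> * b' 0"
    have w: "inverse w \<in> V" unfolding w_def using b'V by (rule unit)
    have w0: "w \<noteq> 0" using no1[OF b'V] by (simp add: w_def)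
    have "x ^ n = 1 * x ^ n" by simp
    also have "\<dots> = \<pi> * (\<Sum>i\<le>n. b' i * inverse x ^ i) * x ^ n"
      by (subst less.prems(2)) (simp only: bs)
    also have "\<dots> = \<pi> * (\<Sum>i\<le>n. b' i * (inverse x ^ i * x ^ n))"
      by (simp add: sum_distrib_right mult.assoc)
    also have "(\<Sum>i\<le>n. b' i * (inverse x ^ i * x ^ n)) = (\<Sum>i\<le>n. b' i * x ^ (n - i))"
      by (rule sum.cong) (use less.prems(6) in \<open>auto simp: power_diff field_simps\<close>)
    also have "\<dots> = (\<Sum>i\<le>n. b' (n - i) * x ^ i)"
      by (rule sum.reindex_bij_witness[of _ "\<lambda>i. n - i" "\<lambda>i. n - i"]) auto
    also have "\<dots> = b' 0 * x ^ n + (\<Sum>i\<le>n'. b' (n - i) * x ^ i)" by (simp add: n)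
    finally have "w * x ^ n = \<pi> * (\<Sum>i\<le>n'. b' (n - i) * x ^ i)"
      unfolding w_def by (simp only: left_diff_distrib distrib_left mult_1 mult.assoc) (metis add_diff_cancel_left')
    then have xn: "x ^ n = inverse w * (\<pi> * (\<Sum>i\<le>n'. b' (n - i) * x ^ i))"
      using w0 by (simp add: field_simps)
    define a' where "a' = (\<lambda>i. a i + a n * inverse w * \<pi> * b' (n - i))"
    have a'V: "a' i \<in> V" for i
      unfolding a'_def using less.prems(3) w pV b'V by (intro VI)
    have "(\<Sum>i\<le>n. a i * x ^ i) = (\<Sum>i\<le>n'. a i * x ^ i) + a n * x ^ n" by (simp add: n)
    also have "\<dots> = (\<Sum>i\<le>n'. a' i * x ^ i)"
      unfolding xn by (simp add: a'_def algebra_simps sum.distrib sum_distrib_left)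
    finally have eq: "1 = \<pi> * (\<Sum>i\<le>n'. a' i * x ^ i)" using less.prems(1) by simp
    show False
    \<comment> \<open>If the shortened relation has become the shorter one, \<open>x\<close> and its
      inverse change roles.\<close>
    proof (cases "m \<le> n'")
      case True
      show False
        by (rule less.hyps[of n' m a' x b]) (use True eq a'V less.prems n in auto)
    next
      case False
      show False
        by (rule less.hyps[of m n' b "inverse x" a']) (use False eq a'V less.prems n in auto)
    qed
  qed
  have val: "x \<in> V \<or> inverse x \<in> V" for x
  proof (rule ccontr)
    assume *: "\<not> ?thesis"
    then have x0: "x \<noteq> 0" using VI by auto
    obtain f g where fg: "\<And>i. coeff f i \<in> V" "1 = \<pi> * poly f x" "\<And>i. coeff g i \<in> V" "1 = \<pi> * poly g (inverse x)"
      using adj[of x] adj[of "inverse x"] * by blast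
    show False
    proof (cases "degree g \<le> degree f")
      case True
      show False by (rule no2[of "coeff f" x "degree f" "coeff g" "degree g"]) (use fg True x0 in \<open>simp_all add: poly_altdef\<close>)
    next
      case False
      show False by (rule no2[of "coeff g" "inverse x" "degree g" "coeff f" "degree f"]) (use fg False x0 in \<open>simp_all add: poly_altdef\<close>)
    qed
  qed
  show ?thesis by (rule that[OF V val])
qed

section \<open>Haar measure and linear maps\<close>

lemma pp_power_dvd_diff_iff:
  fixes x y :: "'p::prime_card padic_int"
  shows "pp ^ n dvd y - x \<longleftrightarrow> (\<exists>e. y = x + pp ^ n * e)"
  by (metis add_diff_cancel_left' diff_add_cancel add.commute dvd_def)

lemma open_padic_vec_iff:
  fixes U :: "('p::prime_card padic_int ^ 'n) set"
  shows "open U \<longleftrightarrow> (\<forall>x\<in>U. \<exists>n. \<forall>e. x + pp ^ n *s e \<in> U)"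
proof
  assume U: "open U"
  show "\<forall>x\<in>U. \<exists>n. \<forall>e. x + pp ^ n *s e \<in> U"
  proof
    fix x assume "x \<in> U"
    then obtain n where n: "padic_cyl n (\<lambda>i. padic_residue (x $ i) n) \<subseteq> U"
      using padic_cyl_base[OF U] by blast
    have "x + pp ^ n *s e \<in> U" for e
      by (rule subsetD[OF n]) (simp add: padic_cyl_def padic_residue_eq_iff)
    then show "\<exists>n. \<forall>e. x + pp ^ n *s e \<in> U" by blast
  qed
next
  assume *: "\<forall>x\<in>U. \<exists>n. \<forall>e. x + pp ^ n *s e \<in> U"
  have "\<exists>T. open T \<and> x \<in> T \<and> T \<subseteq> U" if x: "x \<in> U" for x
  proof -
    obtain n where n: "\<And>e. x + pp ^ n *s e \<in> U" using * x by blast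
    have "y \<in> U" if "y \<in> padic_cyl n (\<lambda>i. padic_residue (x $ i) n)" for y
    proof -
      have "\<forall>i. \<exists>e. y $ i = x $ i + pp ^ n * e"
        using that by (simp add: padic_cyl_def padic_residue_eq_iff pp_power_dvd_diff_iff)
      then obtain e where "\<And>i. y $ i = x $ i + pp ^ n * e i" by metis
      then have "y = x + pp ^ n *s (\<chi> i. e i)" by (simp add: Finite_Cartesian_Product.vec_eq_iff)
      then show ?thesis using n by metis
    qed
    then show ?thesis
      by (intro exI[of _ "padic_cyl n (\<lambda>i. padic_residue (x $ i) n)"] conjI open_padic_cyl subsetI)
        (simp_all add: padic_cyl_def)
  qed
  then show "open U" by (subst open_subopen) blast
qed

lemma open_padic_dvd: "open {c :: 'p::prime_card padic_int ^ 'n. pp ^ k dvd c $ i}"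
  by (rule open_padic_vec_iff[THEN iffD2]) (auto intro!: exI[of _ k])

lemma sets_padic_dvd [measurable]: "{c :: 'p::prime_card padic_int ^ 'n. pp ^ k dvd c $ i} \<in> sets borel"
  by (intro borel_open open_padic_dvd)

lemma sets_padic_dvd' [measurable]: "{c :: 'p::prime_card padic_int ^ 'n. pp dvd c $ i} \<in> sets borel"
  using sets_padic_dvd[of 1 i] by simp

subsection \<open>Translation invariant measures\<close>

text \<open>The total mass is left free: the measure that gives a set the mass of its image under an
  additive map need not be a probability measure.\<close>

definition translation_invariant :: "('p::prime_card padic_int ^ 'n) measure \<Rightarrow> bool" where
  "translation_invariant \<nu> \<longleftrightarrow> finite_measure \<nu> \<and> sets \<nu> = sets borel \<and>
     (\<forall>a. \<forall>A\<in>sets borel. measure \<nu> ((+) a ` A) = measure \<nu> A)"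

lemma normalized_haar_translation_invariant:
  assumes "normalized_haar \<mu>"
  shows "translation_invariant \<mu>" "measure \<mu> UNIV = 1" "sets \<mu> = sets borel" "space \<mu> = UNIV"
    "finite_measure \<mu>"
proof -
  interpret prob_space \<mu> using assms by (simp add: normalized_haar_def)
  show sets: "sets \<mu> = sets borel" using assms by (simp add: normalized_haar_def)
  then show sp: "space \<mu> = UNIV" using sets_eq_imp_space_eq[OF sets] by simp
  show "finite_measure \<mu>" by (rule finite_measure_axioms)
  then show "translation_invariant \<mu>"
    using assms by (simp add: translation_invariant_def normalized_haar_def measure_def)
  show "measure \<mu> UNIV = 1" using prob_space by (simp add: sp)
qed

text \<open>Unlike in \<open>padic_cyl\<close>, the precision may depend on the coordinate, as it
  does for the range of a diagonal scaling.\<close>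

definition padic_box :: "('n \<Rightarrow> nat) \<Rightarrow> ('n \<Rightarrow> int) \<Rightarrow> ('p::prime_card padic_int ^ 'n) set" where
  "padic_box l r = {y. \<forall>i. padic_residue (y $ i) (l i) = r i}"

lemma open_padic_box: "open (padic_box l r :: ('p::prime_card padic_int ^ 'n) set)"
proof -
  have "open {x :: 'p padic_int ^ 'n. \<forall>i. x $ i \<in> {y. padic_residue y (l i) = r i}}"
    by (rule open_vector_box) (simp add: open_padic_residue)
  then show ?thesis by (simp add: padic_box_def)
qed

lemma disjoint_family_padic_box: "disjoint_family_on (padic_box l) R"
  by (auto simp: disjoint_family_on_def padic_box_def fun_eq_iff)

text \<open>The boxes of a given shape are translates of each other and partition the space.\<close>

lemma measure_padic_box:
  fixes \<nu> :: "('p::prime_card padic_int ^ 'n) measure"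
  assumes \<nu>: "translation_invariant \<nu>" and r: "\<And>i. r i \<in> {0..<int CARD('p) ^ l i}"
  shows "measure \<nu> (padic_box l r) = measure \<nu> UNIV / (\<Prod>i\<in>UNIV. real CARD('p) ^ l i)"
proof -
  interpret finite_measure \<nu> using \<nu> by (simp add: translation_invariant_def)
  have sets: "sets \<nu> = sets borel" using \<nu> by (simp add: translation_invariant_def)
  let ?R = "\<Pi>\<^sub>E i\<in>UNIV. {0..<int CARD('p) ^ l i}"
  let ?B = "padic_box l :: _ \<Rightarrow> ('p padic_int ^ 'n) set"
  have shift: "measure \<nu> (?B s) = measure \<nu> (?B (\<lambda>_. 0))" if s: "s \<in> ?R" for s
  proof -
    define a :: "'p padic_int ^ 'n" where "a = (\<chi> i. of_int (s i))"
    have a: "padic_residue (a $ i) (l i) = s i" for i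
      using s by (auto simp: a_def padic_residue_of_int PiE_iff mod_pos_pos_trivial)
    have "?B s = (+) a ` ?B (\<lambda>_. 0)"
    proof safe
      fix x assume x: "x \<in> ?B s"
      have "x - a \<in> ?B (\<lambda>_. 0)"
        using x by (simp add: padic_box_def padic_residue_diff a)
      then show "x \<in> (+) a ` ?B (\<lambda>_. 0)" by (rule rev_image_eqI) simp
    next
      fix x :: "'p padic_int ^ 'n" assume "x \<in> ?B (\<lambda>_. 0)"
      then show "a + x \<in> ?B s"
        using s by (auto simp: padic_box_def padic_residue_add a PiE_iff mod_pos_pos_trivial)
    qed
    moreover have "measure \<nu> ((+) a ` ?B (\<lambda>_. 0)) = measure \<nu> (?B (\<lambda>_. 0))"
      using \<nu> borel_open[OF open_padic_box] unfolding translation_invariant_def by blast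
    ultimately show ?thesis by simp
  qed
  have fin: "finite ?R" by (simp add: finite_PiE)
  have U: "UNIV = (\<Union>s\<in>?R. ?B s)"
  proof -
    have "y \<in> (\<Union>s\<in>?R. ?B s)" for y :: "'p padic_int ^ 'n"
      by (rule UN_I[of "\<lambda>i. padic_residue (y $ i) (l i)"])
        (simp_all only: padic_box_def PiE_iff padic_residue_bounds, simp_all)
    then show ?thesis by blast
  qed
  then have "measure \<nu> UNIV = measure \<nu> (\<Union>s\<in>?R. ?B s)" by (rule arg_cong)
  also have "\<dots> = (\<Sum>s\<in>?R. measure \<nu> (?B s))"
    by (rule finite_measure_finite_Union[OF fin _ disjoint_family_padic_box],
      simp add: sets borel_open open_padic_box image_subset_iff)
  also have "\<dots> = real (card ?R) * measure \<nu> (?B (\<lambda>_. 0))"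
    using shift by simp
  also have "real (card ?R) = (\<Prod>i\<in>UNIV. real CARD('p) ^ l i)"
    by (simp add: card_PiE flip: of_nat_power)
  finally show ?thesis
    using shift[of r] r prime_gt_0_nat[OF prime_card[where 'a='p]] by (simp add: PiE_iff field_simps)
qed

lemma measure_padic_residues:
  fixes \<mu> :: "('p::prime_card padic_int ^ 'n) measure"
  assumes \<mu>: "normalized_haar \<mu>" and R: "\<And>i. R i \<subseteq> {0..<int CARD('p) ^ l i}"
  shows "measure \<mu> {y. \<forall>i. padic_residue (y $ i) (l i) \<in> R i} =
    (\<Prod>i\<in>UNIV. real (card (R i)) / real CARD('p) ^ l i)"
proof -
  note \<mu>' = normalized_haar_translation_invariant[OF \<mu>]
  interpret finite_measure \<mu> by (rule \<mu>')
  let ?B = "padic_box l :: _ \<Rightarrow> ('p padic_int ^ 'n) set"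
  have "finite (R i)" for i using R finite_subset by blast
  then have fin: "finite (\<Pi>\<^sub>E i\<in>UNIV. R i)" by (simp add: finite_PiE)
  have "{y. \<forall>i. padic_residue (y $ i) (l i) \<in> R i} = (\<Union>s\<in>(\<Pi>\<^sub>E i\<in>UNIV. R i). ?B s)"
    by (auto simp: padic_box_def PiE_iff)
  then have "measure \<mu> {y. \<forall>i. padic_residue (y $ i) (l i) \<in> R i} =
      (\<Sum>s\<in>(\<Pi>\<^sub>E i\<in>UNIV. R i). measure \<mu> (?B s))"
    by (simp only:) (rule finite_measure_finite_Union[OF fin _ disjoint_family_padic_box],
      simp add: \<mu>' borel_open open_padic_box image_subset_iff)
  also have "\<dots> = (\<Sum>s\<in>(\<Pi>\<^sub>E i\<in>UNIV. R i). 1 / (\<Prod>i\<in>UNIV. real CARD('p) ^ l i))"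
    by (rule sum.cong[OF refl], subst measure_padic_box[OF \<mu>'(1)])
      (use R in \<open>auto simp: PiE_iff \<mu>' subset_eq\<close>)
  also have "\<dots> = (\<Prod>i\<in>UNIV. real (card (R i)) / real CARD('p) ^ l i)"
    by (simp add: card_PiE prod_dividef)
  finally show ?thesis .
qed

text \<open>Uniqueness of Haar measure: invariance determines the values on cylinders, which are
  stable under intersection and generate the Borel sets.\<close>

lemma translation_invariant_unique:
  fixes \<mu> \<nu> :: "('p::prime_card padic_int ^ 'n) measure"
  assumes \<nu>: "translation_invariant \<nu>" and \<mu>: "normalized_haar \<mu>" and A: "A \<in> sets borel"
  shows "measure \<nu> A = measure \<nu> UNIV * measure \<mu> A"
proof -
  note \<mu>' = normalized_haar_translation_invariant[OF \<mu>]
  interpret \<mu>: finite_measure \<mu> by (rule \<mu>')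
  interpret \<nu>: finite_measure \<nu> using \<nu> by (simp add: translation_invariant_def)
  have sets: "sets \<nu> = sets borel" using \<nu> by (simp add: translation_invariant_def)
  let ?c = "measure \<nu> UNIV"
  have "\<nu> = scale_measure (ennreal ?c) \<mu>"
  proof (rule measure_eqI_generator_eq[where E = padic_cyls and \<Omega> = UNIV and A = "\<lambda>_. UNIV"])
    show "Int_stable (padic_cyls :: ('p padic_int ^ 'n) set set)"
    proof (rule Int_stableI)
      fix A B :: "('p padic_int ^ 'n) set"
      assume "A \<in> padic_cyls" "B \<in> padic_cyls"
      then obtain n r m s where "A = padic_cyl n r" "B = padic_cyl m s" by auto
      moreover obtain k t where "padic_cyl n r \<inter> padic_cyl m s = (padic_cyl k t :: ('p padic_int ^ 'n) set)"
        using padic_cyl_Int by blast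
      ultimately show "A \<inter> B \<in> padic_cyls" by auto
    qed
    show "padic_cyls \<subseteq> Pow (UNIV :: ('p padic_int ^ 'n) set)" by simp
    show "sets \<nu> = sigma_sets UNIV padic_cyls" "sets (scale_measure (ennreal ?c) \<mu>) = sigma_sets UNIV padic_cyls"
      by (simp_all add: sets_borel_padic_vec sets \<mu>')
    have "padic_residue (x :: 'p padic_int) 0 = 0" for x
      using padic_residue_bounds[of x 0] by simp
    then have "UNIV = (padic_cyl 0 (\<lambda>_. 0) :: ('p padic_int ^ 'n) set)"
      by (auto simp: padic_cyl_def)
    then show "range (\<lambda>_ :: nat. UNIV) \<subseteq> (padic_cyls :: ('p padic_int ^ 'n) set set)" by auto
    show "(\<Union>i :: nat. UNIV) = (UNIV :: ('p padic_int ^ 'n) set)" by simp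
    show "emeasure \<nu> UNIV \<noteq> \<infinity>" for i :: nat by simp
    fix C :: "('p padic_int ^ 'n) set"
    assume "C \<in> padic_cyls"
    then obtain n r where C: "C = padic_cyl n r" by auto
    have "measure \<nu> C = ?c * measure \<mu> C"
    proof (cases "\<forall>i. r i \<in> {0..<int CARD('p) ^ n}")
      case True
      have "C = padic_box (\<lambda>_. n) r" by (simp add: C padic_cyl_def padic_box_def)
      then show ?thesis
        using True by (simp add: measure_padic_box[OF \<nu>] measure_padic_box[OF \<mu>'(1)] \<mu>')
    next
      case False
      then obtain i where i: "r i \<notin> {0..<int CARD('p) ^ n}" by blast
      have "padic_residue (y $ i) n \<noteq> r i" for y :: "'p padic_int ^ 'n"
        using padic_residue_bounds[of "y $ i" n] i by metis
      then have "C = {}" unfolding C padic_cyl_def by blast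
      then show ?thesis by simp
    qed
    then show "emeasure \<nu> C = emeasure (scale_measure (ennreal ?c) \<mu>) C"
      by (simp add: \<nu>.emeasure_eq_measure \<mu>.emeasure_eq_measure ennreal_mult)
  qed
  then have "emeasure \<nu> A = emeasure (scale_measure (ennreal ?c) \<mu>) A" by (rule arg_cong)
  then have "ennreal (measure \<nu> A) = ennreal (?c * measure \<mu> A)"
    by (simp add: \<nu>.emeasure_eq_measure \<mu>.emeasure_eq_measure ennreal_mult)
  then show ?thesis by simp
qed

text \<open>Uniqueness replaces a change of variables: the measure of the image of A, as a function
  of A, is again translation invariant, hence a constant multiple of \<open>\<mu>\<close>, and the
  constant is its value on the whole space.\<close>

lemma measure_image_additive:
  fixes \<mu> :: "('p::prime_card padic_int ^ 'n) measure"
    and \<phi> :: "'p padic_int ^ 'n \<Rightarrow> 'p padic_int ^ 'n"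
  assumes \<mu>: "normalized_haar \<mu>" and add: "\<And>x y. \<phi> (x + y) = \<phi> x + \<phi> y" and inj: "inj \<phi>"
    and op: "\<And>U. open U \<Longrightarrow> open (\<phi> ` U)" and A: "A \<in> sets borel"
  shows "\<phi> ` A \<in> sets borel" "measure \<mu> (\<phi> ` A) = measure \<mu> (range \<phi>) * measure \<mu> A"
proof -
  note \<mu>' = normalized_haar_translation_invariant[OF \<mu>]
  interpret \<mu>: finite_measure \<mu> by (rule \<mu>')
  have im: "\<phi> ` A \<in> sets borel" if "A \<in> sets borel" for A
  proof -
    have "A \<in> sigma_sets UNIV {S. open S}"
      using that by (simp add: borel_def)
    then show ?thesis
    proof induction
      case (Basic a)
      then show ?case using op by (auto intro: borel_open)
    next
      case Empty
      show ?case by simp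
    next
      case (Compl a)
      have "\<phi> ` (UNIV - a) = range \<phi> - \<phi> ` a" using inj by (rule image_set_diff)
      moreover have "range \<phi> \<in> sets borel" by (intro borel_open op) simp
      ultimately show ?case using Compl.IH by (simp only:) (rule sets.Diff)
    next
      case (Union a)
      then show ?case by (simp add: image_UN sets.countable_UN)
    qed
  qed
  show "\<phi> ` A \<in> sets borel" using A by (rule im)
  let ?M = "restrict_space \<mu> (range \<phi>)"
  have rng: "range \<phi> \<in> sets \<mu>" using im[of UNIV] by (simp add: \<mu>')
  have vim: "inv_into UNIV \<phi> -` A \<inter> range \<phi> = \<phi> ` A" for A
    using inj by (auto simp: inv_into_f_f)
  have meas: "inv_into UNIV \<phi> \<in> ?M \<rightarrow>\<^sub>M borel"
  proof (rule measurableI)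
    fix A :: "('p padic_int ^ 'n) set" assume "A \<in> sets borel"
    then have "\<phi> ` A \<in> sets ?M"
      using im[of A] rng by (subst sets_restrict_space_iff) (auto simp: \<mu>')
    then show "inv_into UNIV \<phi> -` A \<inter> space ?M \<in> sets ?M"
      by (simp add: space_restrict_space \<mu>' vim)
  qed simp
  \<comment> \<open>That function of A is realised as the push-forward, along the inverse of
    \<open>\<phi>\<close>, of \<open>\<mu>\<close> restricted to the range.\<close>
  define \<nu> where "\<nu> = distr ?M borel (inv_into UNIV \<phi>)"
  have \<nu>: "measure \<nu> A = measure \<mu> (\<phi> ` A)" if "A \<in> sets borel" for A
  proof -
    have "measure \<nu> A = measure ?M (inv_into UNIV \<phi> -` A \<inter> space ?M)"
      unfolding \<nu>_def by (rule measure_distr[OF meas that])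
    also have "\<dots> = measure ?M (\<phi> ` A)" by (simp add: space_restrict_space \<mu>' vim)
    also have "\<dots> = measure \<mu> (\<phi> ` A)"
      by (rule measure_restrict_space) (use rng in \<open>auto simp: \<mu>'\<close>)
    finally show ?thesis .
  qed
  have "finite_measure \<nu>"
    unfolding \<nu>_def
    by (rule finite_measure.finite_measure_distr[OF _ meas], rule finite_measure_restrict_space)
      (use rng \<mu>' in auto)
  moreover have "measure \<nu> ((+) a ` A) = measure \<nu> A" if A: "A \<in> sets borel" for a A
  proof -
    have "\<phi> ` (+) a ` A = (+) (\<phi> a) ` \<phi> ` A" by (simp add: image_image add)
    moreover have "(+) a ` A \<in> sets borel"
    proof -
      have *: "open ((+) b ` U)" if "open U" for b :: "'p padic_int ^ 'n" and U
        unfolding open_padic_vec_iff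
      proof safe
        fix x assume "x \<in> U"
        with open_padic_vec_iff[THEN iffD1, OF \<open>open U\<close>]
        obtain n where n: "\<And>e. x + pp ^ n *s e \<in> U" by blast
        show "\<exists>n. \<forall>e. b + x + pp ^ n *s e \<in> (+) b ` U"
          using n by (auto intro!: exI[of _ n] simp: add.assoc)
      qed
      have "(+) a ` A \<in> sigma_sets UNIV {S. open S}" if "A \<in> sigma_sets UNIV {S. open S}"
        using that
      proof induction
        case (Compl A)
        have "(+) a ` (UNIV - A) = UNIV - (+) a ` A" by (rule bij_image_Compl_eq[unfolded Compl_eq_Diff_UNIV]) simp
        then show ?case using Compl.IH by (simp add: sigma_sets.Compl)
      next
        case (Union A)
        then show ?case by (simp add: image_UN sigma_sets.Union)
      next
        case (Basic U)
        then show ?case using * by (intro sigma_sets.Basic) blast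
      next
        case Empty
        show ?case by (simp add: sigma_sets.Empty)
      qed
      then show ?thesis using A by (simp add: borel_def)
    qed
    moreover have "measure \<mu> ((+) (\<phi> a) ` \<phi> ` A) = measure \<mu> (\<phi> ` A)"
      using \<mu>'(1) im[OF A] unfolding translation_invariant_def by blast
    ultimately show ?thesis using A by (simp only: \<nu>)
  qed
  ultimately have "translation_invariant \<nu>" by (simp add: translation_invariant_def \<nu>_def)
  from translation_invariant_unique[OF this \<mu> A] show "measure \<mu> (\<phi> ` A) = measure \<mu> (range \<phi>) * measure \<mu> A"
    using A by (simp add: \<nu>)
qed

text \<open>Since the range contains all multiples of p^N, the image of a ball of radius p^n
  contains a ball of radius p^(n+N).\<close>

lemma open_image_additive:
  fixes \<phi> :: "'p::prime_card padic_int ^ 'n \<Rightarrow> 'p padic_int ^ 'n"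
  assumes add: "\<And>x y. \<phi> (x + y) = \<phi> x + \<phi> y" and scale: "\<And>n x. \<phi> (pp ^ n *s x) = pp ^ n *s \<phi> x"
    and range: "\<And>e. pp ^ N *s e \<in> range \<phi>" and U: "open U"
  shows "open (\<phi> ` U)"
  unfolding open_padic_vec_iff
proof safe
  fix x assume "x \<in> U"
  then obtain n where n: "\<And>e. x + pp ^ n *s e \<in> U" using U unfolding open_padic_vec_iff by blast
  have "\<phi> x + pp ^ (n + N) *s e \<in> \<phi> ` U" for e
  proof -
    obtain e' where "pp ^ N *s e = \<phi> e'" using range by blast
    then have "\<phi> x + pp ^ (n + N) *s e = \<phi> (x + pp ^ n *s e')"
      by (simp add: add scale power_add vector_smult_assoc flip: vector_smult_assoc)
    then show ?thesis using n by simp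
  qed
  then show "\<exists>n. \<forall>e. \<phi> x + pp ^ n *s e \<in> \<phi> ` U" by blast
qed

text \<open>Meant for shears and swaps: surjectivity makes the constant 1, so no determinant on the
  coefficient space has to be computed.\<close>

lemma measure_image_bij:
  fixes \<mu> :: "('p::prime_card padic_int ^ 'n) measure"
  assumes \<mu>: "normalized_haar \<mu>" and add: "\<And>x y. \<phi> (x + y) = \<phi> x + \<phi> y"
    and scale: "\<And>n x. \<phi> (pp ^ n *s x) = pp ^ n *s \<phi> x"
    and inv: "\<And>x. \<psi> (\<phi> x) = x" "\<And>x. \<phi> (\<psi> x) = x" and A: "A \<in> sets borel"
  shows "\<phi> ` A \<in> sets borel" "measure \<mu> (\<phi> ` A) = measure \<mu> A"
proof -
  have rng: "range \<phi> = UNIV" using inv(2) by (metis surj_def)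
  have inj: "inj \<phi>" using inv(1) by (metis injI)
  have op: "open (\<phi> ` U)" if "open U" for U
    by (rule open_image_additive[OF add scale _ that, of 0]) (simp add: rng)
  show "\<phi> ` A \<in> sets borel" by (rule measure_image_additive[OF \<mu> add inj op A])
  show "measure \<mu> (\<phi> ` A) = measure \<mu> A"
    using measure_image_additive(2)[OF \<mu> add inj op A] by (simp add: rng normalized_haar_translation_invariant[OF \<mu>])
qed

definition vscale :: "('n \<Rightarrow> nat) \<Rightarrow> 'p::prime_card padic_int ^ 'n \<Rightarrow> 'p padic_int ^ 'n" where
  "vscale v c = (\<chi> i. pp ^ v i * c $ i)"

lemma vscale_nth [simp]: "vscale v c $ i = pp ^ v i * c $ i"
  by (simp add: vscale_def)

lemma range_vscale: "range (vscale v) = {c :: 'p::prime_card padic_int ^ 'n. \<forall>i. pp ^ v i dvd c $ i}"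
proof safe
  fix c :: "'p padic_int ^ 'n" assume "\<forall>i. pp ^ v i dvd c $ i"
  then have "\<forall>i. \<exists>d. c $ i = pp ^ v i * d" by (simp add: dvd_def)
  then obtain d where "\<And>i. c $ i = pp ^ v i * d i" by metis
  then show "c \<in> range (vscale v)" by (intro image_eqI[of _ _ "\<chi> i. d i"]) (simp_all add: Finite_Cartesian_Product.vec_eq_iff)
qed simp

lemma measure_vscale:
  fixes \<mu> :: "('p::prime_card padic_int ^ 'n) measure"
  assumes \<mu>: "normalized_haar \<mu>" and A: "A \<in> sets borel"
  shows "vscale v ` A \<in> sets borel"
    "measure \<mu> (vscale v ` A) = measure \<mu> A / real CARD('p) ^ (\<Sum>i\<in>UNIV. v i)"
proof -
  have add: "vscale v (x + y) = vscale v x + vscale v y" for x y :: "'p padic_int ^ 'n"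
    by (simp add: Finite_Cartesian_Product.vec_eq_iff distrib_left)
  have scale: "vscale v (pp ^ n *s x) = pp ^ n *s vscale v x" for n and x :: "'p padic_int ^ 'n"
    by (simp add: Finite_Cartesian_Product.vec_eq_iff mult_ac)
  have inj: "inj (vscale v :: 'p padic_int ^ 'n \<Rightarrow> _)"
    by (rule injI) (simp add: Finite_Cartesian_Product.vec_eq_iff pp_nonzero)
  have rng: "pp ^ Max (range v) *s e \<in> range (vscale v)" for e :: "'p padic_int ^ 'n"
    by (simp add: range_vscale dvd_mult2 le_imp_power_dvd)
  have op: "open (vscale v ` U)" if "open U" for U :: "('p padic_int ^ 'n) set"
    by (rule open_image_additive[OF add scale rng that])
  show "vscale v ` A \<in> sets borel" by (rule measure_image_additive[OF \<mu> add inj op A])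
  have "range (vscale v) = {y :: 'p padic_int ^ 'n. \<forall>i. padic_residue (y $ i) (v i) \<in> {0}}"
    by (simp add: range_vscale pp_power_dvd_iff)
  then have "measure \<mu> (range (vscale v)) = (\<Prod>i\<in>UNIV. real (card {0 :: int}) / real CARD('p) ^ v i)"
    using measure_padic_residues[OF \<mu>, of "\<lambda>_. {0}" v] card_pow_pos[where 'p='p] by simp
  also have "\<dots> = 1 / real CARD('p) ^ (\<Sum>i\<in>UNIV. v i)"
    by (simp add: power_sum prod_dividef)
  finally show "measure \<mu> (vscale v ` A) = measure \<mu> A / real CARD('p) ^ (\<Sum>i\<in>UNIV. v i)"
    using measure_image_additive(2)[OF \<mu> add inj op A] by simp
qed

lemma measure_units:
  fixes \<mu> :: "('p::prime_card padic_int ^ 'n) measure"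
  assumes \<mu>: "normalized_haar \<mu>"
  shows "measure \<mu> {c. \<forall>i\<in>J. \<not> pp dvd c $ i} = (1 - 1 / real CARD('p)) ^ card J"
proof -
  let ?R = "\<lambda>i. if i \<in> J then {0..<int CARD('p)} - {0} else {0..<int CARD('p)}"
  have p: "CARD('p) > 0" using prime_gt_0_nat[OF prime_card[where 'a='p]] by simp
  have "{c :: 'p padic_int ^ 'n. \<forall>i\<in>J. \<not> pp dvd c $ i} = {y. \<forall>i. padic_residue (y $ i) 1 \<in> ?R i}"
    using padic_residue_bounds[where 'p='p and n=1] by (auto simp: pp_dvd_iff)
  then have "measure \<mu> {c. \<forall>i\<in>J. \<not> pp dvd c $ i} = (\<Prod>i\<in>UNIV. real (card (?R i)) / real CARD('p) ^ 1)"
    using measure_padic_residues[OF \<mu>, of ?R "\<lambda>_. 1"] by auto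
  also have "\<dots> = (\<Prod>i\<in>UNIV. if i \<in> J then 1 - 1 / real CARD('p) else 1)"
    by (rule prod.cong[OF refl]) (use p in \<open>auto simp: card_Diff_subset of_nat_diff field_simps\<close>)
  also have "\<dots> = (1 - 1 / real CARD('p)) ^ card J"
    by (simp add: prod.If_cases)
  finally show ?thesis .
qed

section \<open>Substitutions in ternary cubic forms\<close>

lemma of_padic_int_0 [simp]: "of_padic_int 0 = 0"
  by (simp add: of_padic_int_def Zero_fract_def[symmetric])

lemma of_padic_int_1 [simp]: "of_padic_int 1 = 1"
  by (simp add: of_padic_int_def One_fract_def[symmetric])

lemma of_padic_int_add [simp]: "of_padic_int (a + b) = of_padic_int a + of_padic_int b"
  by (simp add: of_padic_int_def flip: to_ac_add)

lemma of_padic_int_mult [simp]: "of_padic_int (a * b) = of_padic_int a * of_padic_int b"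
  by (simp add: of_padic_int_def flip: to_ac_mult)

lemma of_padic_int_uminus [simp]: "of_padic_int (- a) = - of_padic_int a"
  by (simp add: of_padic_int_def flip: to_ac_minus)

lemma of_padic_int_diff [simp]: "of_padic_int (a - b) = of_padic_int a - of_padic_int b"
  by (simp add: of_padic_int_def flip: to_ac_diff)

lemma of_padic_int_power [simp]: "of_padic_int (a ^ n) = of_padic_int a ^ n"
  by (induction n) simp_all

lemma of_padic_int_of_nat [simp]: "of_padic_int (of_nat n) = of_nat n"
  by (induction n) simp_all

lemma of_padic_int_numeral [simp]: "of_padic_int (numeral n) = numeral n"
  using of_padic_int_of_nat[of "numeral n"] by (simp del: of_padic_int_of_nat)

lemma of_padic_int_eq_iff [simp]: "of_padic_int a = of_padic_int b \<longleftrightarrow> a = b"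
  by (simp add: of_padic_int_def eq_fract)

lemma of_padic_int_eq_0_iff [simp]: "of_padic_int a = 0 \<longleftrightarrow> a = 0"
  using of_padic_int_eq_iff[of a 0] by (simp del: of_padic_int_eq_iff)

lemma of_nat_closure_nonzero: "(of_nat CARD('p) :: 'p::prime_card padic_closure) \<noteq> 0"
  using of_padic_int_eq_0_iff[of "pp :: 'p padic_int"] pp_nonzero[where 'p='p] by simp

lemma forall_10: "(\<forall>i::10. P i) \<longleftrightarrow> P 0 \<and> P 1 \<and> P 2 \<and> P 3 \<and> P 4 \<and> P 5 \<and> P 6 \<and> P 7 \<and> P 8 \<and> P 9"
proof
  assume *: "P 0 \<and> P 1 \<and> P 2 \<and> P 3 \<and> P 4 \<and> P 5 \<and> P 6 \<and> P 7 \<and> P 8 \<and> P 9"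
  show "\<forall>i::10. P i"
  proof
    fix i :: 10
    obtain z :: int where z: "i = of_int z" "0 \<le> z" "z < 10" by (cases i) auto
    then have "z = 0 \<or> z = 1 \<or> z = 2 \<or> z = 3 \<or> z = 4 \<or> z = 5 \<or> z = 6 \<or> z = 7 \<or> z = 8 \<or> z = 9"
      by presburger
    then show "P i" using * z(1) by auto
  qed
qed simp

lemma UNIV_10: "(UNIV :: 10 set) = {0, 1, 2, 3, 4, 5, 6, 7, 8, 9}"
proof -
  have "\<forall>i::10. i \<in> {0, 1, 2, 3, 4, 5, 6, 7, 8, 9}"
    by (subst forall_10) (intro conjI insertI1 insertI2)
  then show ?thesis by (intro UNIV_eq_I) (rule spec)
qed

lemma sum_10: "(\<Sum>i\<in>UNIV. f (i :: 10)) = f 0 + (f 1 + (f 2 + (f 3 + (f 4 + (f 5 + (f 6 + (f 7 + (f 8 + f 9))))))))"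
  unfolding UNIV_10 by simp

text \<open>The order of the arguments is that of \<open>ternary_cubic\<close>: X^3, Y^3, Z^3, X^2
  Y, X^2 Z, Y^2 X, Y^2 Z, Z^2 X, Z^2 Y, XYZ.\<close>

definition vec10 :: "'a \<Rightarrow> 'a \<Rightarrow> 'a \<Rightarrow> 'a \<Rightarrow> 'a \<Rightarrow> 'a \<Rightarrow> 'a \<Rightarrow> 'a \<Rightarrow> 'a \<Rightarrow> 'a \<Rightarrow> 'a ^ 10" where
  "vec10 a0 a1 a2 a3 a4 a5 a6 a7 a8 a9 = (\<chi> i. if i = 0 then a0 else if i = 1 then a1
     else if i = 2 then a2 else if i = 3 then a3 else if i = 4 then a4 else if i = 5 then a5
     else if i = 6 then a6 else if i = 7 then a7 else if i = 8 then a8 else a9)"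

lemma vec10_nth [simp]:
  "vec10 a0 a1 a2 a3 a4 a5 a6 a7 a8 a9 $ 0 = a0" "vec10 a0 a1 a2 a3 a4 a5 a6 a7 a8 a9 $ 1 = a1"
  "vec10 a0 a1 a2 a3 a4 a5 a6 a7 a8 a9 $ 2 = a2" "vec10 a0 a1 a2 a3 a4 a5 a6 a7 a8 a9 $ 3 = a3"
  "vec10 a0 a1 a2 a3 a4 a5 a6 a7 a8 a9 $ 4 = a4" "vec10 a0 a1 a2 a3 a4 a5 a6 a7 a8 a9 $ 5 = a5"
  "vec10 a0 a1 a2 a3 a4 a5 a6 a7 a8 a9 $ 6 = a6" "vec10 a0 a1 a2 a3 a4 a5 a6 a7 a8 a9 $ 7 = a7"
  "vec10 a0 a1 a2 a3 a4 a5 a6 a7 a8 a9 $ 8 = a8" "vec10 a0 a1 a2 a3 a4 a5 a6 a7 a8 a9 $ 9 = a9"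
  by (simp_all add: vec10_def)

lemma vec10_eq_iff: "c = (d :: 'a ^ 10) \<longleftrightarrow> c $ 0 = d $ 0 \<and> c $ 1 = d $ 1 \<and> c $ 2 = d $ 2 \<and>
  c $ 3 = d $ 3 \<and> c $ 4 = d $ 4 \<and> c $ 5 = d $ 5 \<and> c $ 6 = d $ 6 \<and> c $ 7 = d $ 7 \<and> c $ 8 = d $ 8 \<and> c $ 9 = d $ 9"
  by (simp add: Finite_Cartesian_Product.vec_eq_iff forall_10)

text \<open>The coefficients of \<open>C(X + sY + tZ, Y, Z)\<close>.\<close>

definition shear :: "'a::comm_ring_1 \<Rightarrow> 'a \<Rightarrow> 'a ^ 10 \<Rightarrow> 'a ^ 10" where
  "shear s t c = vec10
     (c $ 0)
     (c $ 1 + s ^ 3 * c $ 0 + s ^ 2 * c $ 3 + s * c $ 5)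
     (c $ 2 + t ^ 3 * c $ 0 + t ^ 2 * c $ 4 + t * c $ 7)
     (c $ 3 + 3 * s * c $ 0)
     (c $ 4 + 3 * t * c $ 0)
     (c $ 5 + 3 * s ^ 2 * c $ 0 + 2 * s * c $ 3)
     (c $ 6 + 3 * s ^ 2 * t * c $ 0 + 2 * s * t * c $ 3 + s ^ 2 * c $ 4 + t * c $ 5 + s * c $ 9)
     (c $ 7 + 3 * t ^ 2 * c $ 0 + 2 * t * c $ 4)
     (c $ 8 + 3 * s * t ^ 2 * c $ 0 + t ^ 2 * c $ 3 + 2 * s * t * c $ 4 + s * c $ 7 + t * c $ 9)
     (c $ 9 + 6 * s * t * c $ 0 + 2 * t * c $ 3 + 2 * s * c $ 4)"

definition swap_xy :: "'a ^ 10 \<Rightarrow> 'a ^ 10" where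
  "swap_xy c = vec10 (c $ 1) (c $ 0) (c $ 2) (c $ 5) (c $ 6) (c $ 3) (c $ 4) (c $ 8) (c $ 7) (c $ 9)"

definition swap_xz :: "'a ^ 10 \<Rightarrow> 'a ^ 10" where
  "swap_xz c = vec10 (c $ 2) (c $ 1) (c $ 0) (c $ 8) (c $ 7) (c $ 6) (c $ 5) (c $ 4) (c $ 3) (c $ 9)"

definition swap_yz :: "'a ^ 10 \<Rightarrow> 'a ^ 10" where
  "swap_yz c = vec10 (c $ 0) (c $ 2) (c $ 1) (c $ 4) (c $ 3) (c $ 7) (c $ 8) (c $ 5) (c $ 6) (c $ 9)"

text \<open>This is C(X, Y + tZ, Z). The conjugation by \<open>swap_xy\<close> lets it inherit
  linearity, inverse and measure from \<open>shear\<close>.\<close>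

definition shear_yz :: "'a::comm_ring_1 \<Rightarrow> 'a ^ 10 \<Rightarrow> 'a ^ 10" where
  "shear_yz t c = swap_xy (shear 0 t (swap_xy c))"

text \<open>The coefficients of \<open>C(aX, bY, Z)\<close>.\<close>

definition dilate :: "'a::comm_ring_1 \<Rightarrow> 'a \<Rightarrow> 'a ^ 10 \<Rightarrow> 'a ^ 10" where
  "dilate a b c = vec10 (a ^ 3 * c $ 0) (b ^ 3 * c $ 1) (c $ 2) (a ^ 2 * b * c $ 3) (a ^ 2 * c $ 4)
     (a * b ^ 2 * c $ 5) (b ^ 2 * c $ 6) (a * c $ 7) (b * c $ 8) (a * b * c $ 9)"

lemma ternary_cubic_swap:
  "ternary_cubic (swap_xy c) x y z = ternary_cubic c y x z"
  "ternary_cubic (swap_xz c) x y z = ternary_cubic c z y x"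
  "ternary_cubic (swap_yz c) x y z = ternary_cubic c x z y"
  unfolding ternary_cubic_def swap_xy_def swap_xz_def swap_yz_def vec10_nth
  by (simp_all only: power2_eq_square power3_eq_cube mult_ac add_ac)

lemma ternary_cubic_shear: "ternary_cubic (shear s t c) x y z = ternary_cubic c (x + s * y + t * z) y z"
proof -
  have e2: "(x + u) ^ 2 = x ^ 2 + 2 * x * u + u ^ 2" for x u :: 'a
    by (simp add: power2_eq_square algebra_simps)
  have e3: "(x + u) ^ 3 = x ^ 3 + 3 * x ^ 2 * u + 3 * x * u ^ 2 + u ^ 3" for x u :: 'a
    by (simp add: power3_eq_cube power2_eq_square algebra_simps)
  have *: "ternary_cubic (shear s 0 c) x y z = ternary_cubic c (x + s * y) y z" for s c x y z
    unfolding ternary_cubic_def shear_def vec10_nth e2 e3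
    by (simp add: power2_eq_square power3_eq_cube distrib_left distrib_right mult_ac add_ac)
  \<comment> \<open>A shear with two parameters is a product of two shears with one, which keeps the
    polynomial identity small.\<close>
  have "shear s t c = shear s 0 (swap_yz (shear t 0 (swap_yz c)))"
    by (simp add: vec10_eq_iff shear_def swap_yz_def algebra_simps power2_eq_square power3_eq_cube)
  then show ?thesis by (simp add: * ternary_cubic_swap add_ac)
qed

lemma ternary_cubic_dilate: "ternary_cubic (dilate a b c) x y z = ternary_cubic c (a * x) (b * y) z"
  unfolding ternary_cubic_def dilate_def vec10_nth
  by (simp only: power2_eq_square power3_eq_cube mult_ac add_ac)

lemma ternary_cubic_scale: "ternary_cubic (a *s c) x y z = a * ternary_cubic c x y z"
  unfolding ternary_cubic_def vector_smult_component by (simp only: distrib_left mult_ac)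

lemma ternary_cubic_homogeneous: "ternary_cubic c (a * x) (a * y) (a * z) = a ^ 3 * ternary_cubic c x y z"
  unfolding ternary_cubic_def
  by (simp only: power2_eq_square power3_eq_cube distrib_left mult_ac add_ac)

lemma shear_inverse: "shear (- s) (- t) (shear s t c) = c" "shear s t (shear (- s) (- t) c) = c"
  unfolding vec10_eq_iff shear_def vec10_nth
  by (simp_all add: algebra_simps power2_eq_square power3_eq_cube)

lemma swap_inverse [simp]: "swap_xy (swap_xy c) = c" "swap_xz (swap_xz c) = c" "swap_yz (swap_yz c) = c"
  by (simp_all add: vec10_eq_iff swap_xy_def swap_xz_def swap_yz_def)

lemma shear_linear: "shear s t (c + d) = shear s t c + shear s t d" "shear s t (a *s c) = a *s shear s t c"
  by (simp_all add: vec10_eq_iff shear_def algebra_simps)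

lemma swap_linear:
  "swap_xy (c + d :: 'a::comm_ring_1 ^ 10) = swap_xy c + swap_xy d" "swap_xy (a *s c) = a *s swap_xy c"
  "swap_xz (c + d) = swap_xz c + swap_xz d" "swap_xz (a *s c) = a *s swap_xz c"
  "swap_yz (c + d) = swap_yz c + swap_yz d" "swap_yz (a *s c) = a *s swap_yz c"
  by (simp_all add: vec10_eq_iff swap_xy_def swap_xz_def swap_yz_def)

lemma dilate_linear: "dilate a b (c + d) = dilate a b c + dilate a b d" "dilate a b (r *s c) = r *s dilate a b c"
  by (simp_all add: vec10_eq_iff dilate_def algebra_simps)

subsection \<open>Zeros in a subring of the algebraic closure\<close>

definition closure_form :: "'p::prime_card padic_int ^ 10 \<Rightarrow> 'p padic_closure \<Rightarrow> 'p padic_closure \<Rightarrow> 'p padic_closure \<Rightarrow> 'p padic_closure" where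
  "closure_form c x y z = ternary_cubic (\<chi> i. of_padic_int (c $ i)) x y z"

text \<open>\<open>K\<close> is an arbitrary set, so that single extensions, \<open>nr_field\<close>
  and also \<open>padic_nr\<close>, which is never shown to be a ring, are treated alike.\<close>

definition has_zero :: "'p::prime_card padic_closure set \<Rightarrow> 'p padic_int ^ 10 \<Rightarrow> bool" where
  "has_zero K c \<longleftrightarrow> (\<exists>x\<in>K. \<exists>y\<in>K. \<exists>z\<in>K. (x, y, z) \<noteq> (0, 0, 0) \<and> closure_form c x y z = 0)"

lemma has_zeroI:
  "x \<in> K \<Longrightarrow> y \<in> K \<Longrightarrow> z \<in> K \<Longrightarrow> (x, y, z) \<noteq> (0, 0, 0) \<Longrightarrow> closure_form c x y z = 0 \<Longrightarrow> has_zero K c"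
  unfolding has_zero_def by blast

lemma closure_form_shear:
  "closure_form (shear s t c) x y z = closure_form c (x + of_padic_int s * y + of_padic_int t * z) y z"
proof -
  have "(\<chi> i. of_padic_int (shear s t c $ i)) = shear (of_padic_int s) (of_padic_int t) (\<chi> i. of_padic_int (c $ i))"
    by (simp add: vec10_eq_iff shear_def)
  then show ?thesis by (simp add: closure_form_def ternary_cubic_shear)
qed

lemma closure_form_swap:
  "closure_form (swap_xy c) x y z = closure_form c y x z"
  "closure_form (swap_xz c) x y z = closure_form c z y x"
  "closure_form (swap_yz c) x y z = closure_form c x z y"
proof -
  have "(\<chi> i. of_padic_int (swap_xy c $ i)) = swap_xy (\<chi> i. of_padic_int (c $ i))"
    "(\<chi> i. of_padic_int (swap_xz c $ i)) = swap_xz (\<chi> i. of_padic_int (c $ i))"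
    "(\<chi> i. of_padic_int (swap_yz c $ i)) = swap_yz (\<chi> i. of_padic_int (c $ i))"
    by (simp_all add: vec10_eq_iff swap_xy_def swap_xz_def swap_yz_def)
  then show "closure_form (swap_xy c) x y z = closure_form c y x z"
    "closure_form (swap_xz c) x y z = closure_form c z y x"
    "closure_form (swap_yz c) x y z = closure_form c x z y"
    by (simp_all add: closure_form_def ternary_cubic_swap)
qed

lemma closure_form_dilate:
  "closure_form (dilate a b c) x y z = closure_form c (of_padic_int a * x) (of_padic_int b * y) z"
proof -
  have "(\<chi> i. of_padic_int (dilate a b c $ i)) = dilate (of_padic_int a) (of_padic_int b) (\<chi> i. of_padic_int (c $ i))"
    by (simp add: vec10_eq_iff dilate_def)
  then show ?thesis by (simp add: closure_form_def ternary_cubic_dilate)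
qed

lemma closure_form_scale: "closure_form (a *s c) x y z = of_padic_int a * closure_form c x y z"
proof -
  have "(\<chi> i. of_padic_int ((a *s c) $ i)) = of_padic_int a *s (\<chi> i. of_padic_int (c $ i))"
    by (simp add: Finite_Cartesian_Product.vec_eq_iff)
  then show ?thesis by (simp add: closure_form_def ternary_cubic_scale)
qed

lemma closure_form_of_padic_int:
  "closure_form c (of_padic_int x) (of_padic_int y) (of_padic_int z) = of_padic_int (ternary_cubic c x y z)"
  by (simp add: closure_form_def ternary_cubic_def)

definition coeff_extension :: "'p::prime_card padic_closure set \<Rightarrow> bool" where
  "coeff_extension K \<longleftrightarrow> is_subring K \<and> range of_padic_int \<subseteq> K"

lemma coeff_extensionD:
  assumes "coeff_extension K"
  shows "of_padic_int a \<in> K" "x \<in> K \<Longrightarrow> y \<in> K \<Longrightarrow> x + y \<in> K" "x \<in> K \<Longrightarrow> y \<in> K \<Longrightarrow> x * y \<in> K"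
  using assms subring_add[of K x y] subring_mult[of K x y] by (auto simp: coeff_extension_def)

lemma has_zero_shear:
  assumes K: "coeff_extension K"
  shows "has_zero K (shear s t c) \<longleftrightarrow> has_zero K c"
proof -
  have *: "has_zero K c" if zero: "has_zero K (shear s t c)" for s t c
  proof -
    obtain x y z where xyz: "x \<in> K" "y \<in> K" "z \<in> K" "(x, y, z) \<noteq> (0, 0, 0)"
      "closure_form (shear s t c) x y z = 0" using zero unfolding has_zero_def by blast
    have "x + of_padic_int s * y + of_padic_int t * z \<in> K"
      using xyz by (intro coeff_extensionD[OF K])
    moreover have "(x + of_padic_int s * y + of_padic_int t * z, y, z) \<noteq> (0, 0, 0)" using xyz by auto
    moreover have "closure_form c (x + of_padic_int s * y + of_padic_int t * z) y z = 0"
      using xyz(5) by (simp only: closure_form_shear)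
    ultimately show ?thesis using xyz(2,3) by (intro has_zeroI)
  qed
  show ?thesis using *[of s t c] *[of "- s" "- t" "shear s t c"] by (auto simp: shear_inverse)
qed

lemma has_zero_swap:
  "has_zero K (swap_xy c) \<longleftrightarrow> has_zero K c"
  "has_zero K (swap_xz c) \<longleftrightarrow> has_zero K c"
  "has_zero K (swap_yz c) \<longleftrightarrow> has_zero K c"
  unfolding has_zero_def closure_form_swap prod.inject de_Morgan_conj by blast+

lemma has_zero_dilate:
  assumes K: "coeff_extension K" and c': "r *s c' = dilate a b c" and nz: "r \<noteq> 0" "a \<noteq> 0" "b \<noteq> 0"
  shows "has_zero K c' \<longleftrightarrow> has_zero K c"
proof
  assume "has_zero K c'"
  then obtain x y z where xyz: "x \<in> K" "y \<in> K" "z \<in> K" "(x, y, z) \<noteq> (0, 0, 0)" "closure_form c' x y z = 0"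
    unfolding has_zero_def by blast
  have "closure_form c (of_padic_int a * x) (of_padic_int b * y) z = 0"
    using xyz(5) by (simp flip: closure_form_dilate c' add: closure_form_scale)
  moreover have "(of_padic_int a * x, of_padic_int b * y, z) \<noteq> (0, 0, 0)" using xyz(4) nz by auto
  moreover have "of_padic_int a * x \<in> K" "of_padic_int b * y \<in> K"
    using xyz(1,2) by (simp_all add: coeff_extensionD[OF K])
  ultimately show "has_zero K c" using xyz(3) by (intro has_zeroI)
next
  assume "has_zero K c"
  then obtain x y z where xyz: "x \<in> K" "y \<in> K" "z \<in> K" "(x, y, z) \<noteq> (0, 0, 0)" "closure_form c x y z = 0"
    unfolding has_zero_def by blast
  let ?a = "of_padic_int a" and ?b = "of_padic_int b"
  \<comment> \<open>The inverse substitution multiplied by \<open>a * b\<close>: it avoids division,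
    so it stays in the ring \<open>K\<close>, and homogeneity absorbs the common factor.\<close>
  have "of_padic_int r * closure_form c' (?b * x) (?a * y) (?a * ?b * z) =
      closure_form c ((?a * ?b) * x) ((?a * ?b) * y) ((?a * ?b) * z)"
    unfolding closure_form_scale[symmetric] c' closure_form_dilate by (simp add: mult_ac)
  also have "\<dots> = 0" using xyz(5) unfolding closure_form_def ternary_cubic_homogeneous by simp
  finally have "closure_form c' (?b * x) (?a * y) (?a * ?b * z) = 0" using nz by simp
  moreover have "(?b * x, ?a * y, ?a * ?b * z) \<noteq> (0, 0, 0)" using xyz(4) nz by auto
  moreover have "?b * x \<in> K" "?a * y \<in> K" "?a * ?b * z \<in> K"
    using xyz(1-3) by (simp_all add: coeff_extensionD[OF K])
  ultimately show "has_zero K c'" by (intro has_zeroI)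
qed

text \<open>Insolubility on a whole p-adic ball. Carrying the ball through the reduction yields
  openness together with insolubility.\<close>

definition stably_insoluble :: "'p::prime_card padic_closure set \<Rightarrow> 'p padic_int ^ 10 \<Rightarrow> bool" where
  "stably_insoluble K c \<longleftrightarrow> (\<exists>n. \<forall>e. \<not> has_zero K (c + pp ^ n *s e))"

lemma stably_insolubleD: "stably_insoluble K c \<Longrightarrow> \<not> has_zero K c"
proof -
  assume "stably_insoluble K c"
  then obtain n where "\<And>e. \<not> has_zero K (c + pp ^ n *s e)" unfolding stably_insoluble_def by blast
  from this[of 0] show ?thesis by simp
qed

lemma stably_insoluble_shear:
  assumes K: "coeff_extension K" and "stably_insoluble K (shear s t c)"
  shows "stably_insoluble K c"
proof -
  obtain n where n: "\<And>e. \<not> has_zero K (shear s t c + pp ^ n *s e)"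
    using assms unfolding stably_insoluble_def by blast
  have "\<not> has_zero K (c + pp ^ n *s e)" for e
    using n[of "shear s t e"] has_zero_shear[OF K, of s t "c + pp ^ n *s e"] by (simp add: shear_linear)
  then show ?thesis unfolding stably_insoluble_def by blast
qed

lemma stably_insoluble_swap:
  "stably_insoluble K (swap_xy c) \<Longrightarrow> stably_insoluble K c"
  "stably_insoluble K (swap_xz c) \<Longrightarrow> stably_insoluble K c"
  "stably_insoluble K (swap_yz c) \<Longrightarrow> stably_insoluble K c"
proof -
  assume "stably_insoluble K (swap_xy c)"
  then obtain n where n: "\<And>e. \<not> has_zero K (swap_xy c + pp ^ n *s e)" unfolding stably_insoluble_def by blast
  have "\<not> has_zero K (c + pp ^ n *s e)" for e
    using n[of "swap_xy e"] has_zero_swap(1)[of K "c + pp ^ n *s e"] by (simp add: swap_linear)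
  then show "stably_insoluble K c" unfolding stably_insoluble_def by blast
next
  assume "stably_insoluble K (swap_xz c)"
  then obtain n where n: "\<And>e. \<not> has_zero K (swap_xz c + pp ^ n *s e)" unfolding stably_insoluble_def by blast
  have "\<not> has_zero K (c + pp ^ n *s e)" for e
    using n[of "swap_xz e"] has_zero_swap(2)[of K "c + pp ^ n *s e"] by (simp add: swap_linear)
  then show "stably_insoluble K c" unfolding stably_insoluble_def by blast
next
  assume "stably_insoluble K (swap_yz c)"
  then obtain n where n: "\<And>e. \<not> has_zero K (swap_yz c + pp ^ n *s e)" unfolding stably_insoluble_def by blast
  have "\<not> has_zero K (c + pp ^ n *s e)" for e
    using n[of "swap_yz e"] has_zero_swap(3)[of K "c + pp ^ n *s e"] by (simp add: swap_linear)
  then show "stably_insoluble K c" unfolding stably_insoluble_def by blast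
qed

lemma stably_insoluble_dilate:
  assumes K: "coeff_extension K" and c': "pp ^ k *s c' = dilate (pp ^ i) (pp ^ j) c"
    and "stably_insoluble K c'"
  shows "stably_insoluble K c"
proof -
  obtain n where n: "\<And>e. \<not> has_zero K (c' + pp ^ n *s e)"
    using assms unfolding stably_insoluble_def by blast
  \<comment> \<open>The division by p^k costs k digits of precision, hence the radius
    p^(k+n).\<close>
  have "\<not> has_zero K (c + pp ^ (k + n) *s e)" for e
  proof -
    have "pp ^ k *s (c' + pp ^ n *s dilate (pp ^ i) (pp ^ j) e) = dilate (pp ^ i) (pp ^ j) (c + pp ^ (k + n) *s e)"
      by (simp add: dilate_linear vector_add_ldistrib vector_smult_assoc power_add c')
    from has_zero_dilate[OF K this] n show ?thesis by (simp add: pp_nonzero)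
  qed
  then show ?thesis unfolding stably_insoluble_def by blast
qed

section \<open>Integral elements and unramified extensions\<close>

definition padic_integral :: "'p::prime_card padic_closure \<Rightarrow> bool" where
  "padic_integral x \<longleftrightarrow> (\<exists>f :: 'p padic_int poly. lead_coeff f = 1 \<and> poly (map_poly of_padic_int f) x = 0)"

interpretation of_padic_int: comm_ring_hom "of_padic_int :: 'p::prime_card padic_int \<Rightarrow> _"
  by unfold_locales simp_all

interpretation of_padic_int_poly: map_poly_comm_ring_hom "of_padic_int :: 'p::prime_card padic_int \<Rightarrow> _"
  ..

interpretation red: comm_ring_hom "red :: 'p::prime_card padic_int \<Rightarrow> _"
  by unfold_locales simp_all

interpretation red_poly: map_poly_comm_ring_hom "red :: 'p::prime_card padic_int \<Rightarrow> _"
  ..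

text \<open>Determinant trick: \<open>w\<close> is an eigenvalue of a matrix over Z_p, hence a root
  of its characteristic polynomial, which is monic over Z_p.\<close>

lemma padic_integral_eigenvalue:
  fixes v :: "nat \<Rightarrow> 'p::prime_card padic_closure"
  assumes eq: "\<And>i. i < n \<Longrightarrow> w * v i = (\<Sum>j<n. of_padic_int (A i j) * v j)" and nz: "i0 < n" "v i0 \<noteq> 0"
  shows "padic_integral w"
proof -
  define M where "M = Matrix.mat n n (\<lambda>(i, j). A i j)"
  have M: "M \<in> carrier_mat n n" by (simp add: M_def)
  let ?M = "map_mat of_padic_int M"
  have M': "?M \<in> carrier_mat n n" using M by simp
  define u where "u = Matrix.vec n v"
  have "?M *\<^sub>v u = w \<cdot>\<^sub>v u"
  proof (rule eq_vecI)
    fix i assume "i < dim_vec (w \<cdot>\<^sub>v u)"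
    then have i: "i < n" by (simp add: u_def)
    have "vec_index (?M *\<^sub>v u) i = (\<Sum>j<n. of_padic_int (A i j) * v j)"
      using i M by (simp add: M_def u_def scalar_prod_def atLeast0LessThan)
    also have "\<dots> = vec_index (w \<cdot>\<^sub>v u) i" using i eq[OF i] by (simp add: u_def)
    finally show "vec_index (?M *\<^sub>v u) i = vec_index (w \<cdot>\<^sub>v u) i" .
  qed (simp add: u_def M_def)
  moreover have "u \<noteq> 0\<^sub>v n"
  proof
    assume "u = 0\<^sub>v n"
    then have "vec_index u i0 = 0" using nz(1) by simp
    then show False using nz by (simp add: u_def)
  qed
  ultimately have "eigenvalue ?M w"
    unfolding eigenvalue_def eigenvector_def using M' by (intro exI[of _ u]) (simp add: u_def)
  then have "poly (char_poly ?M) w = 0" using eigenvalue_root_char_poly[OF M'] by simp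
  then have "poly (map_poly of_padic_int (char_poly M)) w = 0" by (simp only: of_padic_int.char_poly_hom[OF M])
  then show ?thesis
    unfolding padic_integral_def using degree_monic_char_poly[OF M] by blast
qed

definition peval :: "'p::prime_card padic_int poly \<Rightarrow> 'p padic_closure \<Rightarrow> 'p padic_closure" where
  "peval h x = poly (map_poly of_padic_int h) x"

lemma peval_simps [simp]:
  "peval 0 x = 0" "peval 1 x = 1" "peval (f + g) x = peval f x + peval g x" "peval (f - g) x = peval f x - peval g x"
  "peval (f * g) x = peval f x * peval g x" "peval (pCons a f) x = of_padic_int a + x * peval f x"
  "peval (- f) x = - peval f x" "peval (smult a f) x = of_padic_int a * peval f x" "peval (f ^ n) x = peval f x ^ n"
  by (simp_all add: peval_def of_padic_int_poly.hom_add of_padic_int_poly.hom_minus of_padic_int_poly.hom_mult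
      of_padic_int_poly.hom_uminus of_padic_int_poly.hom_power of_padic_int.map_poly_pCons_hom of_padic_int.map_poly_hom_smult)

lemma peval_sum: "peval (sum f A) x = (\<Sum>i\<in>A. peval (f i) x)"
  by (induction A rule: infinite_finite_induct) simp_all

lemma peval_monom: "peval (monom a n) x = of_padic_int a * x ^ n"
  by (simp add: monom_altdef)

lemma peval_altdef: "peval f x = (\<Sum>i\<le>degree f. of_padic_int (coeff f i) * x ^ i)"
proof -
  have "peval f x = peval (\<Sum>i\<le>degree f. monom (coeff f i) i) x" by (simp add: poly_as_sum_of_monoms)
  then show ?thesis by (simp only: peval_sum peval_monom)
qed

lemma peval_pcompose: "peval (pcompose f g) x = peval f (peval g x)"
  by (induction f) (simp_all add: pcompose_pCons)

lemma padic_integralE: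
  assumes "padic_integral x"
  obtains f n where "degree f = Suc n" "coeff f (Suc n) = 1" "peval f x = 0"
    "x ^ Suc n = - (\<Sum>i\<le>n. of_padic_int (coeff f i) * x ^ i)"
proof -
  obtain f where f: "lead_coeff f = 1" "peval f x = 0" using assms unfolding padic_integral_def peval_def by blast
  have "degree f \<noteq> 0"
  proof
    assume "degree f = 0"
    then have "peval f x = 1" using f(1) by (simp add: peval_altdef)
    then show False using f(2) by simp
  qed
  then obtain n where n: "degree f = Suc n" using not0_implies_Suc by blast
  have "x ^ Suc n = - (\<Sum>i\<le>n. of_padic_int (coeff f i) * x ^ i)"
    using f n by (simp add: peval_altdef eq_neg_iff_add_eq_0 add.commute)
  then show ?thesis using that[of f n] f n by simp
qed

text \<open>The relation is monic, so rewriting high powers of \<open>x\<close> introduces no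
  denominators.\<close>

lemma peval_reduce:
  assumes x: "x ^ Suc n = - (\<Sum>i\<le>n. of_padic_int (c i) * x ^ i)"
  shows "\<exists>a. peval h x = (\<Sum>i\<le>n. of_padic_int (a i) * x ^ i)"
proof (induction h)
  case 0
  show ?case by (rule exI[of _ "\<lambda>_. 0"]) simp
next
  case (pCons b h)
  then obtain a where a: "peval h x = (\<Sum>i\<le>n. of_padic_int (a i) * x ^ i)" by blast
  define a' where "a' = (\<lambda>i. (case i of 0 \<Rightarrow> b | Suc j \<Rightarrow> a j) - a n * c i)"
  have "x * (\<Sum>i\<le>n. of_padic_int (a i) * x ^ i) = (\<Sum>i<n. of_padic_int (a i) * x ^ Suc i) + of_padic_int (a n) * x ^ Suc n"
    by (simp add: sum_distrib_left distrib_left mult_ac lessThan_Suc_atMost[symmetric])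
  note eq = this
  have "peval (pCons b h) x = of_padic_int b + x * (\<Sum>i\<le>n. of_padic_int (a i) * x ^ i)" by (simp add: a)
  also have "\<dots> = of_padic_int b + (\<Sum>i<n. of_padic_int (a i) * x ^ Suc i)
      - (\<Sum>i\<le>n. of_padic_int (a n * c i) * x ^ i)"
    unfolding eq x by (simp add: sum_distrib_left mult.assoc)
  also have "of_padic_int b + (\<Sum>i<n. of_padic_int (a i) * x ^ Suc i) =
      (\<Sum>i\<le>n. of_padic_int (case i of 0 \<Rightarrow> b | Suc j \<Rightarrow> a j) * x ^ i)"
    by (simp add: lessThan_Suc_atMost[symmetric] sum.lessThan_Suc_shift del: sum.lessThan_Suc power_Suc)
  finally have "peval (pCons b h) x = (\<Sum>i\<le>n. of_padic_int (a' i) * x ^ i)"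
    by (simp only: a'_def of_padic_int_diff left_diff_distrib sum_subtractf)
  then show ?case by blast
qed

text \<open>Multiplication by \<open>peval h x\<close> preserves the Z_p-span of 1, x, ..., x^n,
  with (1, x, ..., x^n) as eigenvector of the resulting matrix; its first entry 1 is not
  zero.\<close>

lemma padic_integral_peval:
  assumes "padic_integral x"
  shows "padic_integral (peval h x)"
proof -
  obtain f n where x: "x ^ Suc n = - (\<Sum>i\<le>n. of_padic_int (coeff f i) * x ^ i)"
    using padic_integralE[OF assms] by metis
  have "\<forall>i. \<exists>a. peval (h * monom 1 i) x = (\<Sum>j\<le>n. of_padic_int (a j) * x ^ j)"
    by (intro allI peval_reduce[OF x])
  then obtain A where A: "\<And>i. peval (h * monom 1 i) x = (\<Sum>j\<le>n. of_padic_int (A i j) * x ^ j)" by metis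
  show ?thesis
    by (rule padic_integral_eigenvalue[of "Suc n" _ "\<lambda>i. x ^ i" A 0])
      (use A in \<open>simp_all add: peval_monom lessThan_Suc_atMost\<close>)
qed

lemma padic_integral_of_padic_int: "padic_integral (of_padic_int a)"
  unfolding padic_integral_def by (rule exI[of _ "[:- a, 1:]"]) (simp flip: peval_def)

section \<open>Valuation rings of the algebraic closure above Z_p\<close>

abbreviation pc :: "'p::prime_card padic_closure" where
  "pc \<equiv> of_nat CARD('p)"

lemma of_padic_int_pp: "of_padic_int pp = pc"
  by simp

declare of_nat_closure_nonzero [simp]

text \<open>A stand-in for the ring of integers of the algebraic closure. Any such ring will do, so
  the p-adic valuation itself is never extended.\<close>

definition dominating_ring :: "'p::prime_card padic_closure set \<Rightarrow> bool" where
  "dominating_ring V \<longleftrightarrow> is_subring V \<and> range of_padic_int \<subseteq> V \<and> inverse pc \<notin> V \<and> (\<forall>x. x \<in> V \<or> inverse x \<in> V)"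

lemma exists_dominating_ring: "\<exists>V :: 'p::prime_card padic_closure set. dominating_ring V"
proof -
  let ?A = "range (of_padic_int :: 'p padic_int \<Rightarrow> _)"
  have "is_subring ?A"
  proof (rule is_subringI)
    show "1 \<in> ?A" by (rule range_eqI[of _ _ 1]) simp
    fix x y assume "x \<in> ?A" "y \<in> ?A"
    then obtain a b where ab: "x = of_padic_int a" "y = of_padic_int b" by blast
    show "x - y \<in> ?A" by (rule range_eqI[of _ _ "a - b"]) (simp add: ab)
    show "x * y \<in> ?A" by (rule range_eqI[of _ _ "a * b"]) (simp add: ab)
  qed
  moreover have "pc \<in> ?A" using of_padic_int_pp by (metis rangeI)
  moreover have "inverse pc \<notin> ?A"
  proof
    assume "inverse pc \<in> ?A"
    then obtain a :: "'p padic_int" where "inverse pc = of_padic_int a" by blast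
    then have "of_padic_int (pp * a) = of_padic_int 1" by (metis of_nat_closure_nonzero of_padic_int_1
        of_padic_int_mult of_padic_int_pp right_inverse)
    then have "pp * a = 1" by (simp only: of_padic_int_eq_iff)
    then show False using pp_not_unit[where 'p='p] by (metis dvd_triv_left)
  qed
  ultimately have "\<exists>V. is_subring V \<and> ?A \<subseteq> V \<and> inverse pc \<notin> V \<and> (\<forall>x. x \<in> V \<or> inverse x \<in> V)"
    by (rule exists_valuation_ring) blast
  then show ?thesis unfolding dominating_ring_def .
qed

context
  fixes V :: "'p::prime_card padic_closure set"
  assumes V: "dominating_ring V"
begin

lemma dominating_subring: "is_subring V"
  using V by (simp add: dominating_ring_def)

lemmas dominating_intros = subring_intros[OF dominating_subring]

lemma dominating_of_padic_int: "of_padic_int a \<in> V"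
  using V by (auto simp: dominating_ring_def)

lemma dominating_pc: "pc \<in> V"
  unfolding of_padic_int_pp[symmetric] by (rule dominating_of_padic_int)

lemma dominating_cases: "x \<in> V \<or> inverse x \<in> V"
  using V by (simp add: dominating_ring_def)

lemma pc_not_unit: "v \<in> V \<Longrightarrow> pc * v \<noteq> 1"
  using V inverse_unique[of pc v] by (auto simp: dominating_ring_def)

text \<open>Valuation rings are integrally closed: if 1/x lies in \<open>V\<close>, dividing the
  monic equation by x^n expresses \<open>x\<close> as a polynomial in 1/x.\<close>

lemma dominating_integral:
  assumes "padic_integral x"
  shows "x \<in> V"
proof (rule ccontr)
  assume *: "x \<notin> V"
  then have y: "inverse x \<in> V" using dominating_cases by blast
  have x0: "x \<noteq> 0" using * dominating_intros(2) by auto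
  obtain f n where eq: "x ^ Suc n = - (\<Sum>i\<le>n. of_padic_int (coeff f i) * x ^ i)"
    using padic_integralE[OF assms] by metis
  have "x = x ^ Suc n * inverse x ^ n"
    using x0 by (simp add: field_simps)
  also have "\<dots> = - (\<Sum>i\<le>n. of_padic_int (coeff f i) * (x ^ i * inverse x ^ n))"
    unfolding eq by (simp add: sum_distrib_right mult.assoc)
  also have "(\<Sum>i\<le>n. of_padic_int (coeff f i) * (x ^ i * inverse x ^ n)) =
      (\<Sum>i\<le>n. of_padic_int (coeff f i) * inverse x ^ (n - i))"
    by (rule sum.cong) (use x0 in \<open>auto simp: power_diff field_simps\<close>)
  also have "- \<dots> \<in> V"
    by (intro dominating_intros y dominating_of_padic_int)
  finally show False using * by simp
qed

end

text \<open>Inverses exist modulo every p^n, and a cluster point of them is an exact inverse.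
  Vectors of length 1 appear because the limit lemma is about vectors.\<close>

lemma padic_unit_inverse:
  fixes a :: "'p::prime_card padic_int"
  assumes "\<not> pp dvd a"
  obtains b where "a * b = 1"
proof -
  have "\<exists>b. pp ^ n dvd a * b - 1" for n
  proof -
    have "coprime (padic_residue a n) (int CARD('p) ^ n)"
    proof (cases n)
      case (Suc m)
      have "\<not> int CARD('p) dvd padic_residue a n"
      proof
        assume "int CARD('p) dvd padic_residue a n"
        then have "padic_residue a n mod int CARD('p) ^ 1 = 0" by simp
        then have "padic_residue a 1 = 0" by (subst (asm) padic_residue_mod) (simp_all add: Suc)
        then show False using assms by (simp add: pp_dvd_iff)
      qed
      then show ?thesis
        using prime_imp_coprime[of "int CARD('p)"] prime_card_int[where 'a='p]
        by (auto simp: coprime_commute)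
    qed simp
    then obtain c where "[padic_residue a n * c = 1] (mod (int CARD('p) ^ n))"
      using cong_solve_coprime_int by blast
    then have "padic_residue (a * of_int c) n = padic_residue (1 :: 'p padic_int) n"
      by (simp add: padic_residue_mult padic_residue_of_int padic_residue_1 cong_def mod_simps)
    then show ?thesis by (metis padic_residue_eq_iff)
  qed
  then obtain b where b: "\<And>n. pp ^ n dvd a * b n - 1" by metis
  obtain w :: "'p padic_int ^ 1" where w: "\<And>n. \<exists>m\<ge>n. \<forall>i. pp ^ n dvd (\<chi> i. b m) $ i - w $ i"
    using padic_limit_point[of "\<lambda>m. \<chi> i. b m"] by blast
  have "pp ^ n dvd a * w $ 1 - 1" for n
  proof -
    obtain m where m: "m \<ge> n" "pp ^ n dvd b m - w $ 1" using w[of n] by auto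
    have "pp ^ n dvd a * b m - 1" using b[of m] m(1) by (meson dvd_trans le_imp_power_dvd)
    moreover have "a * w $ 1 - 1 = (a * b m - 1) - a * (b m - w $ 1)" by (simp add: algebra_simps)
    ultimately show ?thesis using dvd_diff[OF _ dvd_mult[OF m(2)]] by (simp only:)
  qed
  then have "a * w $ 1 - 1 = 0" using padic_eq_0_iff by blast
  then show ?thesis using that[of "w $ 1"] by simp
qed

lemma padic_fract_decomp:
  fixes q :: "'p::prime_card padic"
  shows "\<exists>k a. pc ^ k * to_ac q = of_padic_int a"
proof (cases q)
  case (Fract a b)
  obtain k u where b: "b = pp ^ k * u" "\<not> pp dvd u" using padic_decomp[of b] Fract by blast
  obtain v where v: "u * v = 1" using padic_unit_inverse[OF b(2)] by blast
  have "of_padic_int b * to_ac q = of_padic_int a"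
    using Fract by (simp add: of_padic_int_def eq_fract flip: to_ac_mult)
  then have "of_padic_int v * (of_padic_int b * to_ac q) = of_padic_int (v * a)" by simp
  moreover have "of_padic_int v * of_padic_int b = pc ^ k"
  proof -
    have "of_padic_int v * of_padic_int b = of_padic_int (pp ^ k * (u * v))"
      by (simp add: b mult_ac)
    then show ?thesis by (simp add: v)
  qed
  ultimately show ?thesis by (metis mult.assoc)
qed

section \<open>Extensions generated by one integral element\<close>

lemma range_of_padic_int_subset: "range of_padic_int \<subseteq> range to_ac"
  by (auto simp: of_padic_int_def)

lemma ac_simps:
  "x \<otimes>\<^bsub>ring_of_type_algebra\<^esub> y = x * (y :: 'p::prime_card padic_closure)"
  "x \<oplus>\<^bsub>ring_of_type_algebra\<^esub> y = x + y" "\<one>\<^bsub>ring_of_type_algebra\<^esub> = (1 :: 'p padic_closure)"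
  "\<zero>\<^bsub>ring_of_type_algebra\<^esub> = (0 :: 'p padic_closure)"
  "carrier (ring_of_type_algebra :: 'p padic_closure ring) = UNIV"
  by (simp_all add: ring_of_type_algebra_def)

lemma ac_power: "x [^]\<^bsub>ring_of_type_algebra\<^esub> (n::nat) = (x :: 'p::prime_card padic_closure) ^ n"
  by (induction n) (simp_all add: ac_simps)

lemma ac_uminus: "\<ominus>\<^bsub>ring_of_type_algebra\<^esub> (x :: 'p::prime_card padic_closure) = - x"
proof -
  interpret ac: field "ring_of_type_algebra :: 'p padic_closure ring" by (rule field_from_type_algebra)
  show ?thesis by (rule ac.minus_equality) (simp_all add: ac_simps)
qed

lemma subfield_to_ac: "subfield (range (to_ac :: 'p::prime_card padic \<Rightarrow> _)) ring_of_type_algebra"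
proof -
  interpret ac: field "ring_of_type_algebra :: 'p padic_closure ring" by (rule field_from_type_algebra)
  show ?thesis
  proof (rule ac.subfieldI')
    show "subring (range (to_ac :: 'p padic \<Rightarrow> _)) ring_of_type_algebra"
    proof (rule ac.subringI)
      fix x y :: "'p padic_closure" assume "x \<in> range to_ac" "y \<in> range to_ac"
      then obtain a b where ab: "x = to_ac a" "y = to_ac b" by blast
      show "\<ominus>\<^bsub>ring_of_type_algebra\<^esub> x \<in> range to_ac" by (rule range_eqI[of _ _ "- a"]) (simp add: ab ac_uminus)
      show "x \<otimes>\<^bsub>ring_of_type_algebra\<^esub> y \<in> range to_ac" by (rule range_eqI[of _ _ "a * b"]) (simp add: ab ac_simps)
      show "x \<oplus>\<^bsub>ring_of_type_algebra\<^esub> y \<in> range to_ac" by (rule range_eqI[of _ _ "a + b"]) (simp add: ab ac_simps)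
    qed (auto simp: ac_simps intro: range_eqI[of _ _ 1])
  next
    fix x :: "'p padic_closure" assume x: "x \<in> range to_ac - {\<zero>\<^bsub>ring_of_type_algebra\<^esub>}"
    then obtain a where a: "x = to_ac a" by blast
    have "inv\<^bsub>ring_of_type_algebra\<^esub> x = to_ac (inverse a)"
      by (rule ac.comm_inv_char) (use x in \<open>simp_all add: a ac_simps flip: to_ac_inverse to_ac_mult\<close>)
    then show "inv\<^bsub>ring_of_type_algebra\<^esub> x \<in> range to_ac" by (simp only: rangeI)
  qed
qed

abbreviation adjoin :: "'p::prime_card padic_closure \<Rightarrow> 'p padic_closure set" where
  "adjoin \<theta> \<equiv> ring.simple_extension ring_of_type_algebra (range to_ac) \<theta>"

text \<open>HOL-Algebra lists coefficients from the leading one downwards, hence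
  \<open>rev\<close>.\<close>

lemma eval_eq_poly:
  "ring.eval ring_of_type_algebra (rev (coeffs f)) x = poly f (x :: 'p::prime_card padic_closure)"
proof (induction f)
  case 0
  interpret ac: field "ring_of_type_algebra :: 'p padic_closure ring" by (rule field_from_type_algebra)
  show ?case by (simp add: ac_simps)
next
  case (pCons a f)
  interpret ac: field "ring_of_type_algebra :: 'p padic_closure ring" by (rule field_from_type_algebra)
  have "ac.eval (xs @ [b]) x = x * ac.eval xs x + b" for xs b
  proof (induction xs)
    case (Cons y ys)
    then show ?case by (simp add: ac_simps ac_power algebra_simps)
  qed (simp add: ac_simps)
  then show ?case using pCons by (cases "f = 0 \<and> a = 0") (auto simp: cCons_def ac_simps)
qed

lemma adjoin_finite_extension:
  fixes \<theta> :: "'p::prime_card padic_closure"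
  assumes "padic_integral \<theta>"
  shows "finite_extension (adjoin \<theta>)"
proof -
  interpret ac: field "ring_of_type_algebra :: 'p padic_closure ring" by (rule field_from_type_algebra)
  obtain f where f: "lead_coeff f = 1" "poly (map_poly of_padic_int f) \<theta> = 0"
    using assms unfolding padic_integral_def by blast
  let ?K = "range (to_ac :: 'p padic \<Rightarrow> _)" and ?f = "map_poly of_padic_int f"
  have f0: "?f \<noteq> 0"
  proof
    assume "?f = 0"
    then have "coeff ?f (degree f) = 0" by simp
    then show False using f(1) by (simp add: coeff_map_poly)
  qed
  have "rev (coeffs ?f) \<in> carrier (?K[X]\<^bsub>ring_of_type_algebra\<^esub>)"
  proof -
    have "set (coeffs ?f) \<subseteq> ?K"
      using range_of_padic_int_subset by (auto simp: set_coeffs_map_poly coeffs_def coeff_map_poly)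
    moreover have "hd (rev (coeffs ?f)) = lead_coeff ?f"
      using last_coeffs_eq_coeff_degree[OF f0] by (simp only: hd_rev)
    then have "hd (rev (coeffs ?f)) \<noteq> 0" using f0 by (simp only: leading_coeff_0_iff not_False_eq_True)
    ultimately show ?thesis by (simp add: univ_poly_def polynomial_def ac_simps)
  qed
  then have alg: "(ac.algebraic over ?K) \<theta>"
    using f0 f(2) by (intro ac.algebraicI[of "rev (coeffs ?f)"]) (simp_all add: eval_eq_poly ac_simps)
  have "subfield (adjoin \<theta>) ring_of_type_algebra"
    using ac.simple_extension_is_subfield[OF subfield_to_ac, of \<theta>] alg by (simp add: ac_simps)
  moreover have "?K \<subseteq> adjoin \<theta>" by (rule ac.simple_extension_incl) (simp_all add: ac_simps)
  moreover have "ac.finite_dimension ?K (adjoin \<theta>)"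
    using ac.finite_dimension_simple_extension[OF subfield_to_ac, of \<theta>] alg by (simp add: ac_simps)
  ultimately show ?thesis by (simp add: finite_extension_def)
qed

lemma finite_extension_coeff_extension:
  fixes L :: "'p::prime_card padic_closure set"
  assumes "finite_extension L"
  shows "coeff_extension L"
proof -
  interpret ac: field "ring_of_type_algebra :: 'p padic_closure ring" by (rule field_from_type_algebra)
  have L: "subfield L ring_of_type_algebra" "range to_ac \<subseteq> L" using assms by (auto simp: finite_extension_def)
  have m: "x * y \<in> L" "x + y \<in> L" if "x \<in> L" "y \<in> L" for x y
    using subringE(6,7)[OF subfieldE(1)[OF L(1)] that] by (simp_all add: ac_simps)
  have u: "- x \<in> L" if "x \<in> L" for x
    using subringE(5)[OF subfieldE(1)[OF L(1)] that] by (simp add: ac_uminus)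
  have one: "1 \<in> L" using subringE(3)[OF subfieldE(1)[OF L(1)]] by (simp add: ac_simps)
  have "is_subring L"
    by (rule is_subringI) (use m u one m(2)[OF _ u] in simp_all)
  then show ?thesis
    using L(2) range_of_padic_int_subset unfolding coeff_extension_def by blast
qed

lemma adjoin_elem:
  fixes x :: "'p::prime_card padic_closure"
  assumes "x \<in> adjoin \<theta>"
  shows "\<exists>k h. pc ^ k * x = peval h \<theta>"
proof -
  interpret ac: field "ring_of_type_algebra :: 'p padic_closure ring" by (rule field_from_type_algebra)
  from assms show ?thesis
  proof (induction rule: ac.simple_extension.induct)
    case zero
    show ?case by (intro exI[of _ 0]) (simp add: ac_simps)
  next
    case (lin x q)
    obtain k h where kh: "pc ^ k * x = peval h \<theta>" using lin.IH by blast
    obtain l a where la: "pc ^ l * q = of_padic_int a" using padic_fract_decomp lin.hyps by blast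
    have "pc ^ (k + l) * (x * \<theta> + q) = pc ^ l * (pc ^ k * x) * \<theta> + pc ^ k * (pc ^ l * q)"
      by (simp add: algebra_simps power_add)
    also have "\<dots> = peval (smult (pp ^ l) (h * [:0, 1:]) + [:pp ^ k * a:]) \<theta>"
      by (simp add: kh la)
    finally show ?case unfolding ac_simps by blast
  qed
qed

lemma peval_in_coeff_extension:
  assumes "coeff_extension K" "\<theta> \<in> K"
  shows "peval h \<theta> \<in> K"
proof (induction h)
  case 0
  show ?case using coeff_extensionD(1)[OF assms(1), of 0] by simp
next
  case (pCons a h)
  then show ?case using assms by (simp add: coeff_extensionD)
qed

lemma adjoin_self: "(\<theta> :: 'p::prime_card padic_closure) \<in> adjoin \<theta>"
proof -
  interpret ac: field "ring_of_type_algebra :: 'p padic_closure ring" by (rule field_from_type_algebra)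
  show ?thesis by (rule ac.simple_extension_mem[OF subfieldE(1)[OF subfield_to_ac]]) (simp add: ac_simps)
qed

text \<open>
  If \<open>\<epsilon>\<close> is integral then so is the inverse of \<open>1 + p\<epsilon>\<close>, since the constant coefficient of the
  monic equation of \<open>1 + p\<epsilon>\<close> is congruent to \<open>\<plusminus>1\<close> modulo \<open>p\<close>.
\<close>

lemma one_plus_pc_unit:
  fixes \<epsilon> :: "'p::prime_card padic_closure"
  assumes "padic_integral \<epsilon>"
  shows "\<exists>q. (1 + pc * \<epsilon>) * peval q (1 + pc * \<epsilon>) = 1"
proof -
  obtain f n where f: "degree f = Suc n" "coeff f (Suc n) = 1" "peval f \<epsilon> = 0"
    using padic_integralE[OF assms] by metis
  let ?\<eta> = "1 + pc * \<epsilon>"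
  \<comment> \<open>\<open>G\<close> is p^(n+1) f((T - 1)/p), which has the root
    \<open>?\<eta>\<close>; in its constant coefficient every term but the last is divisible by
    p.\<close>
  define G where "G = (\<Sum>i\<le>Suc n. smult (coeff f i * pp ^ (Suc n - i)) ([:- 1, 1:] ^ i))"
  have "peval G ?\<eta> = (\<Sum>i\<le>Suc n. of_padic_int (coeff f i) * (pc ^ (Suc n - i) * pc ^ i) * \<epsilon> ^ i)"
    unfolding G_def peval_sum
    by (intro sum.cong refl) (simp add: power_mult_distrib mult_ac)
  also have "\<dots> = (\<Sum>i\<le>Suc n. of_padic_int (coeff f i) * pc ^ Suc n * \<epsilon> ^ i)"
    by (intro sum.cong refl) (simp only: power_add[symmetric] atMost_iff le_add_diff_inverse2)
  also have "\<dots> = pc ^ Suc n * peval f \<epsilon>"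
    unfolding peval_altdef f(1) sum_distrib_left by (intro sum.cong refl) (simp only: mult_ac)
  finally have G0: "peval G ?\<eta> = 0" using f(3) by simp
  have "coeff G 0 = (\<Sum>i\<le>Suc n. coeff f i * pp ^ (Suc n - i) * (- 1) ^ i)"
    by (simp add: G_def coeff_sum coeff_0_power)
  also have "\<dots> = (\<Sum>i\<le>n. coeff f i * pp ^ (Suc n - i) * (- 1) ^ i) + (- 1) ^ Suc n"
    using f(2) by simp
  finally have c0: "coeff G 0 = (\<Sum>i\<le>n. coeff f i * pp ^ (Suc n - i) * (- 1) ^ i) + (- 1) ^ Suc n" .
  have "pp dvd (\<Sum>i\<le>n. coeff f i * pp ^ (Suc n - i) * (- 1) ^ i)"
    by (intro dvd_sum dvd_mult2 dvd_mult dvd_power) auto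
  moreover have "\<not> pp dvd ((- 1) ^ Suc n :: 'p padic_int)"
    by (simp add: pp_dvd_power_iff pp_not_unit del: power_Suc)
  ultimately have "\<not> pp dvd coeff G 0" unfolding c0 by (metis dvd_add_right_iff)
  then obtain u where u: "coeff G 0 * u = 1" by (rule padic_unit_inverse)
  obtain G' where G: "G = pCons (coeff G 0) G'" by (cases G) auto
  have "of_padic_int (coeff G 0) + ?\<eta> * peval G' ?\<eta> = 0"
    using G0 by (subst (asm) G) simp
  then have "?\<eta> * peval G' ?\<eta> = - of_padic_int (coeff G 0)" by (simp add: eq_neg_iff_add_eq_0 add.commute)
  then have "?\<eta> * peval (smult (- u) G') ?\<eta> = of_padic_int (coeff G 0 * u)" by (simp add: mult_ac)
  then show ?thesis using u by (metis of_padic_int_1)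
qed

lemma red_poly_surj: "\<exists>g. map_poly red g = (f :: 'p::prime_card mod_ring poly)"
proof -
  obtain r :: "'p mod_ring \<Rightarrow> 'p padic_int" where r: "\<And>a. red (r a) = a"
    by (meson red_surj)
  have "map_poly red (map_poly (\<lambda>a. if a = 0 then 0 else r a) f) = f"
    by (rule poly_eqI) (simp add: coeff_map_poly r)
  then show ?thesis by blast
qed

lemma red_poly_eq_0: "map_poly red h = 0 \<Longrightarrow> \<exists>g. h = smult pp g"
proof -
  assume h: "map_poly red h = 0"
  have "pp dvd coeff h i" for i
    using h by (metis coeff_0 coeff_map_poly red_0 red_eq_0_iff)
  then have "\<forall>i. \<exists>a. coeff h i = pp * a" by (simp add: dvd_def)
  then obtain a where a: "\<And>i. coeff h i = pp * a i" by metis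
  have "a i = 0" if "i > degree h" for i using a[of i] that by (simp add: coeff_eq_0 pp_nonzero)
  then have "h = smult pp (Abs_poly a)"
    by (intro poly_eqI) (simp add: a coeff_Abs_poly[of "degree h"])
  then show ?thesis by blast
qed

text \<open>Irreducibility modulo p makes every element of Z_p[\<theta>] whose reduced expression
  has a unit coefficient invertible there. So a nonzero element of the extension is a power of p
  times such a unit, and the power is nonnegative for an integral element. Thus Z_p[\<theta>] is the
  full ring of integers and p generates its maximal ideal.\<close>

theorem adjoin_unramified:
  fixes f :: "'p::prime_card padic_int poly"
  assumes f: "lead_coeff f = 1" "irreducible (map_poly red f)" "peval f \<theta> = 0"
  shows "finite_extension (adjoin \<theta>)" "unramified (adjoin \<theta>)"
proof -
  have int: "padic_integral \<theta>" using f unfolding padic_integral_def peval_def by blast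
  show fin: "finite_extension (adjoin \<theta>)" by (rule adjoin_finite_extension[OF int])
  note ce = finite_extension_coeff_extension[OF fin]
  obtain V :: "'p padic_closure set" where V: "dominating_ring V" using exists_dominating_ring by blast
  obtain n where n: "degree f = Suc n"
  proof -
    have "degree f \<noteq> 0"
    proof
      assume "degree f = 0"
      then have "peval f \<theta> = 1" using f(1) by (simp add: peval_altdef)
      then show False using f(3) by simp
    qed
    then show ?thesis using that by (cases "degree f") auto
  qed
  have pow: "\<theta> ^ Suc n = - (\<Sum>i\<le>n. of_padic_int (coeff f i) * \<theta> ^ i)"
    using f n by (simp add: peval_altdef eq_neg_iff_add_eq_0 add.commute)
  have degf: "degree (map_poly red f) = Suc n"
  proof (rule antisym)
    show "degree (map_poly red f) \<le> Suc n" using degree_map_poly_le[of red f] n by simp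
    have "coeff (map_poly red f) (Suc n) \<noteq> 0" using f(1) n by (simp add: coeff_map_poly)
    then show "Suc n \<le> degree (map_poly red f)" by (rule le_degree)
  qed
  \<comment> \<open>A Bezout relation modulo p between \<open>f\<close> and \<open>h\<close> lifts
    to t' h = 1 + p e at the root, and the right side is invertible by
    \<open>one_plus_pc_unit\<close>.\<close>
  have unit: "\<exists>g. peval h \<theta> * peval g \<theta> = 1" if h: "degree h \<le> n" "\<not> pp dvd coeff h i" for h i
  proof -
    let ?h = "map_poly red h" and ?f = "map_poly red f"
    have "coeff ?h i \<noteq> 0" using h(2) by (simp add: coeff_map_poly red_eq_0_iff)
    then have h0: "?h \<noteq> 0" by (metis coeff_0)
    have "degree ?h \<le> n" using h(1) degree_map_poly_le[of red h] by simp
    then have "\<not> ?f dvd ?h" using h0 degf by (auto dest: dvd_imp_degree_le)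
    then have "coprime ?f ?h" using f(2) by (simp add: prime_elem_imp_coprime irreducible_imp_prime_elem)
    then have "gcd ?f ?h = 1" by (rule coprime_imp_gcd_eq_1)
    then obtain s t where st: "s * ?f + t * ?h = 1" using bezout_coefficients_fst_snd[of ?f ?h] by auto
    obtain s' where s': "map_poly red s' = s" using red_poly_surj[of s] by blast
    obtain t' where t': "map_poly red t' = t" using red_poly_surj[of t] by blast
    have "map_poly red (t' * h - 1 + s' * f) = 0"
      using st by (simp add: red_poly.hom_add red_poly.hom_minus red_poly.hom_mult s' t' algebra_simps)
    then obtain e where e: "t' * h - 1 + s' * f = smult pp e" using red_poly_eq_0 by blast
    have "peval (t' * h - 1 + s' * f) \<theta> = peval (smult pp e) \<theta>" by (simp only: e)
    then have eq: "peval t' \<theta> * peval h \<theta> = 1 + pc * peval e \<theta>" using f(3) by (simp add: algebra_simps)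
    obtain q where q: "(1 + pc * peval e \<theta>) * peval q (1 + pc * peval e \<theta>) = 1"
      using one_plus_pc_unit[OF padic_integral_peval[OF int]] by blast
    have "peval ([:1:] + smult pp e) \<theta> = 1 + pc * peval e \<theta>" by simp
    then have "peval h \<theta> * peval (t' * pcompose q ([:1:] + smult pp e)) \<theta>
        = (peval t' \<theta> * peval h \<theta>) * peval q (1 + pc * peval e \<theta>)"
      by (simp only: peval_simps(5) peval_pcompose mult_ac)
    also have "\<dots> = 1" using q by (simp only: eq)
    finally show ?thesis by blast
  qed
  have elem: "\<exists>k m w w'. pc ^ k * x = pc ^ m * peval w \<theta> \<and> peval w \<theta> * peval w' \<theta> = 1"
    if x: "x \<in> adjoin \<theta>" "x \<noteq> 0" for x
  proof -
    obtain k h where kh: "pc ^ k * x = peval h \<theta>" using adjoin_elem[OF x(1)] by blast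
    obtain a where a: "peval h \<theta> = (\<Sum>i\<le>n. of_padic_int (a i) * \<theta> ^ i)" using peval_reduce[OF pow] by blast
    have "\<exists>i\<le>n. a i \<noteq> 0"
    proof (rule ccontr)
      assume "\<not> ?thesis"
      then have "peval h \<theta> = 0" unfolding a by (intro sum.neutral) auto
      then show False using kh x(2) by simp
    qed
    then obtain i0 where i0: "i0 \<le> n" "a i0 \<noteq> 0" by blast
    obtain N where N: "\<not> pp ^ N dvd a i0" using i0(2) padic_eq_0_iff by blast
    define P where "P = (\<lambda>m. \<forall>i\<le>n. pp ^ m dvd a i)"
    have Pbound: "m \<le> N" if "P m" for m
    proof (rule ccontr)
      assume "\<not> m \<le> N"
      then have "pp ^ N dvd (pp ^ m :: 'p padic_int)" by (intro le_imp_power_dvd) simp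
      also have "\<dots> dvd a i0" using that i0(1) by (simp add: P_def)
      finally show False using N by simp
    qed
    have P0: "P 0" by (simp add: P_def)
    \<comment> \<open>The exact power of p common to all coefficients; one nonzero coefficient
      provides the bound \<open>N\<close> that makes \<open>Greatest\<close> meaningful.\<close>
    define m where "m = Greatest P"
    have m: "P m" unfolding m_def by (rule GreatestI_nat[where P = P and k = 0 and b = N]) (use P0 Pbound in auto)
    have m1: "\<not> P (Suc m)"
    proof
      assume "P (Suc m)"
      then have "Suc m \<le> m" unfolding m_def by (rule Greatest_le_nat[where P = P and b = N]) (use Pbound in auto)
      then show False by simp
    qed
    have "\<forall>i. \<exists>b. i \<le> n \<longrightarrow> a i = pp ^ m * b" using m by (auto simp: P_def dvd_def)
    then obtain b where b: "\<And>i. i \<le> n \<Longrightarrow> a i = pp ^ m * b i" by metis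
    obtain j where j: "j \<le> n" "\<not> pp ^ Suc m dvd a j" using m1 by (auto simp: P_def)
    define w where "w = (\<Sum>i\<le>n. monom (b i) i)"
    have cw: "coeff w i = (if i \<le> n then b i else 0)" for i by (simp add: w_def coeff_sum)
    have "degree w \<le> n" by (rule degree_le) (simp add: cw)
    moreover have "\<not> pp dvd coeff w j"
      using j b[OF j(1)] by (auto simp: cw mult_ac intro: mult_dvd_mono)
    ultimately obtain w' where w': "peval w \<theta> * peval w' \<theta> = 1" using unit by blast
    have "peval h \<theta> = pc ^ m * peval w \<theta>"
      unfolding a w_def peval_sum peval_monom sum_distrib_left by (intro sum.cong refl) (simp add: b mult_ac)
    then have "pc ^ k * x = pc ^ m * peval w \<theta>" by (simp only: kh)
    then show ?thesis using w' by blast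
  qed
  have pint: "peval h \<theta> \<in> integer_ring (adjoin \<theta>)" for h
    using peval_in_coeff_extension[OF ce(1) adjoin_self] padic_integral_peval[OF int]
    by (simp add: integer_ring_def padic_integral_def)
  have intV: "x \<in> V" if "x \<in> integer_ring (adjoin \<theta>)" for x
    using that dominating_integral[OF V] by (auto simp: integer_ring_def padic_integral_def)
  have elem': "\<exists>m w w'. x = pc ^ m * peval w \<theta> \<and> peval w \<theta> * peval w' \<theta> = 1"
    if x: "x \<in> integer_ring (adjoin \<theta>)" "x \<noteq> 0" for x
  proof -
    obtain k m w w' where w: "pc ^ k * x = pc ^ m * peval w \<theta>" "peval w \<theta> * peval w' \<theta> = 1"
      using elem[of x] x by (auto simp: integer_ring_def)
    \<comment> \<open>A negative net power of p would put 1/p into \<open>V\<close>, since integral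
      elements lie in \<open>V\<close>.\<close>
    have "k \<le> m"
    proof (rule ccontr)
      assume "\<not> k \<le> m"
      then have "m < k" by simp
      then obtain d where d: "k = m + Suc d" using less_imp_Suc_add by auto
      have "pc ^ m * (pc * (pc ^ d * x)) = pc ^ m * peval w \<theta>" using w(1) by (simp add: d power_add mult_ac)
      then have "pc * (pc ^ d * x) = peval w \<theta>" by simp
      then have "pc * (pc ^ d * x * peval w' \<theta>) = 1" using w(2) by (simp flip: mult.assoc)
      moreover have "pc ^ d * x * peval w' \<theta> \<in> V"
        using intV[OF x(1)] intV[OF pint] dominating_pc[OF V] by (intro dominating_intros[OF V])
      ultimately show False using pc_not_unit[OF V] by blast
    qed
    then obtain d where d: "m = k + d" using le_Suc_ex by blast
    have "pc ^ k * x = pc ^ k * (pc ^ d * peval w \<theta>)" using w(1) by (simp add: d power_add mult_ac)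
    then have "x = pc ^ d * peval w \<theta>" by simp
    then show ?thesis using w(2) by blast
  qed
  show "unramified (adjoin \<theta>)"
    unfolding unramified_def
  proof (intro equalityI subsetI)
    fix x assume x: "x \<in> maximal_ideal (adjoin \<theta>)"
    show "x \<in> (*) pc ` integer_ring (adjoin \<theta>)"
    proof (cases "x = 0")
      case True
      then show ?thesis using pint[of 0] by auto
    next
      case False
      obtain m w w' where w: "x = pc ^ m * peval w \<theta>" "peval w \<theta> * peval w' \<theta> = 1"
        using elem'[of x] x False by (auto simp: maximal_ideal_def)
      have "m \<noteq> 0"
      proof
        assume "m = 0"
        then have "x * peval w' \<theta> = 1" using w by simp
        then show False using x pint by (auto simp: maximal_ideal_def)
      qed
      then obtain d where "m = Suc d" using not0_implies_Suc by blast
      then have "x = pc * peval (smult (pp ^ d) w) \<theta>" using w(1) by simp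
      then show ?thesis using pint by blast
    qed
  next
    fix x assume "x \<in> (*) pc ` integer_ring (adjoin \<theta>)"
    then obtain y where y: "x = pc * y" "y \<in> integer_ring (adjoin \<theta>)" by blast
    have "\<exists>h. y = peval h \<theta>"
    proof (cases "y = 0")
      case True
      then show ?thesis by (intro exI[of _ 0]) simp
    next
      case False
      obtain m w where "y = pc ^ m * peval w \<theta>" using elem'[OF y(2) False] by blast
      then have "y = peval (smult (pp ^ m) w) \<theta>" by simp
      then show ?thesis by blast
    qed
    then obtain h where "y = peval h \<theta>" by blast
    then have "x = peval (smult pp h) \<theta>" using y(1) by simp
    then have "x \<in> integer_ring (adjoin \<theta>)" using pint by blast
    moreover have "x * z \<noteq> 1" if "z \<in> integer_ring (adjoin \<theta>)" for z
      using pc_not_unit[OF V subring_mult[OF dominating_subring[OF V] intV[OF y(2)] intV[OF that]]]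
      by (simp add: y(1) mult_ac)
    ultimately show "x \<in> maximal_ideal (adjoin \<theta>)" unfolding maximal_ideal_def by blast
  qed
qed

section \<open>Zeros of binary cubic forms\<close>

lemma pp_power_dvd_mono: "(pp :: 'p::prime_card padic_int) ^ n dvd x \<Longrightarrow> m \<le> n \<Longrightarrow> pp ^ m dvd x"
  by (rule dvd_trans[OF le_imp_power_dvd])

text \<open>Newton iteration, along which the derivative stays a unit. The zero is taken as a
  cluster point of the approximations, so their convergence is not examined.\<close>

lemma hensel_cubic:
  fixes a b0 b1 b2 b3 :: "'p::prime_card padic_int"
  assumes root: "pp dvd b0 + b1 * a + b2 * a ^ 2 + b3 * a ^ 3"
    and simple: "\<not> pp dvd b1 + 2 * b2 * a + 3 * b3 * a ^ 2"
  shows "\<exists>r. b0 + b1 * r + b2 * r ^ 2 + b3 * r ^ 3 = 0"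
proof -
  define F where "F = (\<lambda>a. b0 + b1 * a + b2 * a ^ 2 + b3 * a ^ 3)"
  define F' where "F' = (\<lambda>a. b1 + 2 * b2 * a + 3 * b3 * a ^ 2)"
  have ex: "\<exists>a. pp ^ Suc n dvd F a \<and> \<not> pp dvd F' a" for n
  proof (induction n)
    case 0
    show ?case using root simple by (intro exI[of _ a]) (simp add: F_def F'_def)
  next
    case (Suc n)
    then obtain a where a: "pp ^ Suc n dvd F a" "\<not> pp dvd F' a" by blast
    obtain v where v: "F' a * v = 1" using padic_unit_inverse[OF a(2)] by blast
    define h where "h = - (F a * v)"
    have h: "pp ^ Suc n dvd h" using a(1) by (simp add: h_def del: power_Suc)
    have hF: "F' a * h = - F a" using v by (simp add: h_def mult.left_commute[of "F' a"])
    have "F (a + h) = F a + F' a * h + h * h * (b2 + 3 * b3 * a + b3 * h)"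
      by (simp add: F_def F'_def power2_eq_square power3_eq_cube algebra_simps)
    then have eq: "F (a + h) = h * h * (b2 + 3 * b3 * a + b3 * h)" by (simp add: hF)
    have "pp ^ (Suc n + Suc n) dvd h * h" unfolding power_add by (intro mult_dvd_mono h)
    then have "pp ^ Suc (Suc n) dvd h * h" by (rule pp_power_dvd_mono) simp
    then have 1: "pp ^ Suc (Suc n) dvd F (a + h)" unfolding eq by (rule dvd_mult2)
    have "F' (a + h) = F' a + h * (2 * b2 + 6 * b3 * a + 3 * b3 * h)"
      by (simp add: F'_def power2_eq_square algebra_simps)
    moreover have "pp dvd h" using pp_power_dvd_mono[OF h, of 1] by simp
    ultimately have 2: "\<not> pp dvd F' (a + h)" using a(2) by (simp add: dvd_add_left_iff)
    show ?case using 1 2 by blast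
  qed
  have "\<exists>x. pp ^ n dvd F x" for n
  proof -
    obtain x where "pp ^ Suc n dvd F x" using ex[of n] by blast
    then have "pp ^ n dvd F x" by (rule pp_power_dvd_mono) simp
    then show ?thesis by blast
  qed
  then obtain x where x: "\<And>n. pp ^ n dvd F (x n)" by metis
  obtain w :: "'p padic_int ^ 1" where w: "\<And>n. \<exists>m\<ge>n. \<forall>i. pp ^ n dvd (\<chi> i. x m) $ i - w $ i"
    using padic_limit_point[of "\<lambda>m. \<chi> i. x m"] by blast
  have "pp ^ n dvd F (w $ 1)" for n
  proof -
    obtain m where m: "m \<ge> n" "pp ^ n dvd x m - w $ 1" using w[of n] by auto
    have "pp ^ n dvd F (x m)" using pp_power_dvd_mono[OF x m(1)] .
    moreover have "F (w $ 1) = F (x m) - (x m - w $ 1) *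
        (b1 + b2 * (x m + w $ 1) + b3 * (x m * x m + x m * w $ 1 + w $ 1 * w $ 1))"
      by (simp add: F_def power2_eq_square power3_eq_cube algebra_simps)
    ultimately show ?thesis using dvd_diff[OF _ dvd_mult2[OF m(2)]] by (simp only:)
  qed
  then have "F (w $ 1) = 0" using padic_eq_0_iff by blast
  then show ?thesis unfolding F_def by blast
qed

lemma irreducible_cubic_if_no_root:
  fixes f :: "'a::field poly"
  assumes deg: "degree f = 3" and no_root: "\<And>x. poly f x \<noteq> 0"
  shows "irreducible f"
proof (rule Factorial_Ring.irreducibleI)
  show "f \<noteq> 0" using deg by auto
  then show "\<not> f dvd 1" using deg by (simp add: is_unit_iff_degree)
  fix a b assume ab: "f = a * b"
  then have ab0: "a \<noteq> 0" "b \<noteq> 0" using \<open>f \<noteq> 0\<close> by auto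
  then have sum: "degree a + degree b = 3" using deg ab by (simp add: degree_mult_eq)
  have lin: False if "degree g = 1" "g dvd f" for g
  proof -
    from degree1_coeffs[OF that(1)] obtain c d where g: "g = [:c, d:]" "d \<noteq> 0" by blast
    have "poly g (- c / d) = 0" using g by simp
    then have "poly f (- c / d) = 0" using that(2) by (auto elim: dvdE)
    then show False using no_root by blast
  qed
  have "degree a \<noteq> 1" "degree b \<noteq> 1" using lin[of a] lin[of b] by (auto simp: ab)
  then have "degree a = 0 \<or> degree b = 0" using sum by linarith
  then show "a dvd 1 \<or> b dvd 1" using ab0 by (simp add: is_unit_iff_degree)
qed

text \<open>
  Whether a binary cubic with coefficients \<open>b\<^sub>0, \<dots>, b\<^sub>3\<close> is congruent to zero or to a constant times
  the cube of a linear form, that is \<open>b\<^sub>0 (S + kT)\<^sup>3\<close> or \<open>b\<^sub>3 T\<^sup>3\<close>.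
\<close>

definition cube_mod :: "'p::prime_card padic_int \<Rightarrow> 'p padic_int \<Rightarrow> 'p padic_int \<Rightarrow> 'p padic_int \<Rightarrow> bool" where
  "cube_mod b0 b1 b2 b3 \<longleftrightarrow> (if pp dvd b0 then pp dvd b1 \<and> pp dvd b2
     else \<exists>k<CARD('p). pp dvd b1 - 3 * b0 * of_nat k \<and> pp dvd b2 - 3 * b0 * of_nat k ^ 2 \<and> pp dvd b3 - b0 * of_nat k ^ 3)"

lemma cube_modI:
  fixes k b0 :: "'p::prime_card padic_int"
  assumes "\<not> pp dvd b0" "pp dvd b1 - 3 * b0 * k" "pp dvd b2 - 3 * b0 * k ^ 2" "pp dvd b3 - b0 * k ^ 3"
  shows "cube_mod b0 b1 b2 b3"
proof -
  obtain j where j: "j < CARD('p)" "red (of_nat j :: 'p padic_int) = red k" using red_surj[of "red k"] by blast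
  have "red b1 = 3 * red b0 * red k" "red b2 = 3 * red b0 * red k ^ 2" "red b3 = red b0 * red k ^ 3"
    using assms(2-4) by (simp_all add: red_eq_0_iff[symmetric])
  then have "pp dvd b1 - 3 * b0 * of_nat j" "pp dvd b2 - 3 * b0 * of_nat j ^ 2" "pp dvd b3 - b0 * of_nat j ^ 3"
    using j(2) by (simp_all add: red_eq_0_iff[symmetric] del: red_of_nat)
  then show ?thesis unfolding cube_mod_def using assms(1) j(1) by auto
qed

definition unramified_extension :: "'p::prime_card padic_closure set \<Rightarrow> bool" where
  "unramified_extension L \<longleftrightarrow> finite_extension L \<and> unramified L"

text \<open>The base field itself, written as \<open>adjoin 0\<close>: the polynomial T has an
  irreducible reduction. It is the home of rational zeros.\<close>

lemma unramified_extension_of_padic_int: "\<exists>L. unramified_extension (L :: 'p::prime_card padic_closure set)"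
proof -
  have "irreducible (map_poly red [:0, 1 :: 'p padic_int:])"
    by (simp add: irreducible_linear_field_poly map_poly_pCons)
  then have "unramified_extension (adjoin (0 :: 'p padic_closure))"
    using adjoin_unramified[of "[:0, 1:]" "0 :: 'p padic_closure"] by (simp add: unramified_extension_def)
  then show ?thesis by blast
qed

lemma unramified_extension_coeff_extension: "unramified_extension L \<Longrightarrow> coeff_extension L"
  unfolding unramified_extension_def by (intro finite_extension_coeff_extension) blast

definition binary_form :: "'p::prime_card padic_int \<Rightarrow> 'p padic_int \<Rightarrow> 'p padic_int \<Rightarrow> 'p padic_int \<Rightarrow>
    'p padic_closure \<Rightarrow> 'p padic_closure \<Rightarrow> 'p padic_closure" where
  "binary_form b0 b1 b2 b3 s t = of_padic_int b0 * s ^ 3 + of_padic_int b1 * s ^ 2 * t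
     + of_padic_int b2 * s * t ^ 2 + of_padic_int b3 * t ^ 3"

lemma binary_form_of_padic_int:
  "binary_form b0 b1 b2 b3 (of_padic_int s) (of_padic_int t) =
     of_padic_int (b0 * s ^ 3 + b1 * s ^ 2 * t + b2 * s * t ^ 2 + b3 * t ^ 3)"
  by (simp add: binary_form_def)

text \<open>The parameter is r = s/t. The point t = 0 is a zero modulo p when p divides
  \<open>b0\<close>, and a simple one when p does not divide \<open>b1\<close>. What remains is a
  multiple root with \<open>b0\<close> a unit, where the other root is simple, and the absence of
  roots, where the monic cubic is irreducible.\<close>

theorem binary_cubic_zero:
  fixes b0 b1 b2 b3 :: "'p::prime_card padic_int"
  assumes nc: "\<not> cube_mod b0 b1 b2 b3"
  shows "\<exists>L s t. unramified_extension L \<and> s \<in> L \<and> t \<in> L \<and> (s, t) \<noteq> (0, 0) \<and> binary_form b0 b1 b2 b3 s t = 0"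
proof -
  have rational: ?thesis if "b0 * s ^ 3 + b1 * s ^ 2 * t + b2 * s * t ^ 2 + b3 * t ^ 3 = 0" "s \<noteq> 0 \<or> t \<noteq> 0" for s t
  proof -
    obtain L :: "'p padic_closure set" where L: "unramified_extension L" using unramified_extension_of_padic_int by blast
    then have "of_padic_int s \<in> L" "of_padic_int t \<in> L"
      using coeff_extensionD(1)[OF unramified_extension_coeff_extension[OF L]] by blast+
    moreover have "binary_form b0 b1 b2 b3 (of_padic_int s) (of_padic_int t) = 0"
      using that(1) by (simp only: binary_form_of_padic_int of_padic_int_0)
    moreover have "(of_padic_int s, of_padic_int t) \<noteq> (0, 0)" using that(2) by auto
    ultimately show ?thesis using L by blast
  qed
  have simple_root: ?thesis if "pp dvd b3 + b2 * r + b1 * r ^ 2 + b0 * r ^ 3" "\<not> pp dvd b2 + 2 * b1 * r + 3 * b0 * r ^ 2" for r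
  proof -
    from hensel_cubic[OF that]
    obtain \<rho> where "b3 + b2 * \<rho> + b1 * \<rho> ^ 2 + b0 * \<rho> ^ 3 = 0" by blast
    then show ?thesis using rational[of \<rho> 1] by (simp add: algebra_simps)
  qed
  have simple_root_infinity: ?thesis if "pp dvd b0" "\<not> pp dvd b1"
  proof -
    have "\<exists>\<rho>. b0 + b1 * \<rho> + b2 * \<rho> ^ 2 + b3 * \<rho> ^ 3 = 0"
      by (rule hensel_cubic[of b0 b1 0 b2 b3]) (use that in simp_all)
    then obtain \<rho> where "b0 + b1 * \<rho> + b2 * \<rho> ^ 2 + b3 * \<rho> ^ 3 = 0" by blast
    then show ?thesis using rational[of 1 \<rho>] by simp
  qed
  show ?thesis
  proof (cases "\<exists>r. pp dvd b3 + b2 * r + b1 * r ^ 2 + b0 * r ^ 3")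
    case True
    then obtain r where r: "pp dvd b3 + b2 * r + b1 * r ^ 2 + b0 * r ^ 3" by blast
    show ?thesis
    proof (cases "pp dvd b2 + 2 * b1 * r + 3 * b0 * r ^ 2")
      case False
      then show ?thesis using simple_root r by blast
    next
      case dr: True
      show ?thesis
      proof (cases "pp dvd b0")
        case True
        have "\<not> pp dvd b1"
        proof
          assume "pp dvd b1"
          then have "red b2 = 0" using dr True by (simp add: red_eq_0_iff[symmetric])
          then show False using nc True \<open>pp dvd b1\<close> by (simp add: cube_mod_def red_eq_0_iff)
        qed
        then show ?thesis using simple_root_infinity True by blast
      next
        case False
        then obtain v where v: "b0 * v = 1" by (rule padic_unit_inverse)
        let ?b1 = "b1 + 3 * b0 * r"
        have rb2: "red b2 = - (2 * red b1 * red r + 3 * red b0 * red r ^ 2)"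
          using dr unfolding red_eq_0_iff[symmetric] eq_neg_iff_add_eq_0 by (simp add: add.assoc)
        have rb3: "red b3 = - (red b2 * red r + red b1 * red r ^ 2 + red b0 * red r ^ 3)"
          using r unfolding red_eq_0_iff[symmetric] eq_neg_iff_add_eq_0 by (simp add: add.assoc)
        have b1: "\<not> pp dvd ?b1"
        proof
          assume "pp dvd ?b1"
          then have "red b1 = - (3 * red b0 * red r)" by (simp add: red_eq_0_iff[symmetric] eq_neg_iff_add_eq_0)
          note rb = this rb2 rb3
          have "cube_mod b0 b1 b2 b3"
          proof (rule cube_modI[of _ _ "- r"])
            show "\<not> pp dvd b0" by (rule False)
            show "pp dvd b1 - 3 * b0 * - r" using rb(1) by (simp add: red_eq_0_iff[symmetric])
            show "pp dvd b2 - 3 * b0 * (- r) ^ 2"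
              unfolding red_eq_0_iff[symmetric] red_diff rb by (simp add: power2_eq_square algebra_simps)
            show "pp dvd b3 - b0 * (- r) ^ 3"
              unfolding red_eq_0_iff[symmetric] red_diff rb by (simp add: power2_eq_square power3_eq_cube algebra_simps)
          qed
          then show False using nc by blast
        qed
        \<comment> \<open>The third root: the roots modulo p add up to -b1/b0, so it is -b1/b0 - 2r.
          It differs from the double root \<open>r\<close> because \<open>?b1\<close> is a
          unit.\<close>
        define a where "a = r - ?b1 * v"
        define V where "V = red v"
        have V: "red b0 * V = 1" using arg_cong[OF v, of red] by (simp add: V_def)
        have "red b0 * red a = red b0 * red r - (red b0 * V) * (red b1 + 3 * red b0 * red r)"
          by (simp add: a_def V_def algebra_simps)
        then have b0a: "red b0 * red a = red b0 * red r - (red b1 + 3 * red b0 * red r)" by (simp only: V mult_1)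
        let ?x = "red a - red r"
        have x: "red b0 * ?x = - (red b1 + 3 * red b0 * red r)" using b0a by (simp add: right_diff_distrib)
        have "red b3 + red b2 * red a + red b1 * red a ^ 2 + red b0 * red a ^ 3 =
            (red b0 * ?x + (red b1 + 3 * red b0 * red r)) * ?x ^ 2"
          unfolding rb3 rb2 by (simp add: power2_eq_square power3_eq_cube algebra_simps)
        then have 1: "pp dvd b3 + b2 * a + b1 * a ^ 2 + b0 * a ^ 3"
          unfolding x by (simp add: red_eq_0_iff[symmetric])
        have "red b2 + 2 * red b1 * red a + 3 * red b0 * red a ^ 2 =
            (3 * (red b0 * ?x) + 2 * (red b1 + 3 * red b0 * red r)) * ?x"
          unfolding rb2 by (simp add: power2_eq_square power3_eq_cube algebra_simps)
        also have "\<dots> = - (red b1 + 3 * red b0 * red r) * ?x"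
          unfolding x by (simp add: algebra_simps)
        finally have d: "red b2 + 2 * red b1 * red a + 3 * red b0 * red a ^ 2 = - (red b1 + 3 * red b0 * red r) * ?x" .
        have n: "red b1 + 3 * red b0 * red r \<noteq> 0" using b1 by (simp add: red_eq_0_iff[symmetric])
        have "?x \<noteq> 0"
        proof
          assume "?x = 0"
          then have "red b0 * ?x = 0" by (simp only: mult_zero_right)
          then show False using n unfolding x by (simp only: neg_equal_0_iff_equal)
        qed
        then have "- (red b1 + 3 * red b0 * red r) * ?x \<noteq> 0"
          using n by (simp only: mult_eq_0_iff neg_equal_0_iff_equal de_Morgan_disj) blast
        then have 2: "\<not> pp dvd b2 + 2 * b1 * a + 3 * b0 * a ^ 2"
          using d by (simp add: red_eq_0_iff[symmetric])
        show ?thesis using simple_root[OF 1 2] .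
      qed
    qed
  next
    case no_root: False
    show ?thesis
    proof (cases "pp dvd b0")
      case b0: True
      have "\<not> pp dvd b1"
      proof
        assume b1: "pp dvd b1"
        \<comment> \<open>Modulo p the polynomial would be b2 r + b3 with \<open>b2\<close> a unit,
          and would have the root -b3/b2.\<close>
        then have "\<not> pp dvd b2" using nc b0 by (simp add: cube_mod_def)
        then obtain v where v: "b2 * v = 1" by (rule padic_unit_inverse)
        have "red b2 * red v = 1" using arg_cong[OF v, of red] by simp
        then have "red (b3 + b2 * (- b3 * v) + b1 * (- b3 * v) ^ 2 + b0 * (- b3 * v) ^ 3) = 0"
          using b0 b1 by (simp add: red_eq_0_iff[symmetric] mult.left_commute)
        then show False using no_root by (simp only: red_eq_0_iff) blast
      qed
      then show ?thesis using simple_root_infinity b0 by blast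
    next
      case False
      then obtain v where v: "b0 * v = 1" by (rule padic_unit_inverse)
      define f where "f = [:v * b3, v * b2, v * b1, 1:]"
      have rv: "red v * red b0 = 1" using arg_cong[OF v, of red] by (simp add: mult.commute)
      have f': "map_poly red f = [:red v * red b3, red v * red b2, red v * red b1, 1:]"
        by (simp add: f_def map_poly_pCons)
      have "poly (map_poly red f) x \<noteq> 0" for x
      proof
        assume x0: "poly (map_poly red f) x = 0"
        obtain r :: "'p padic_int" where r: "red r = x" using red_surj by meson
        have "red v * red (b3 + b2 * r + b1 * r ^ 2 + b0 * r ^ 3) =
            red v * red b3 + red v * red b2 * x + red v * red b1 * x ^ 2 + (red v * red b0) * x ^ 3"
          by (simp add: r algebra_simps)
        also have "\<dots> = poly (map_poly red f) x"
          unfolding rv by (simp add: f' power2_eq_square power3_eq_cube algebra_simps)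
        finally have "red v * red (b3 + b2 * r + b1 * r ^ 2 + b0 * r ^ 3) = 0" using x0 by simp
        moreover have "red v \<noteq> 0" using rv by auto
        ultimately have "red (b3 + b2 * r + b1 * r ^ 2 + b0 * r ^ 3) = 0" by (simp only: mult_eq_0_iff) simp
        then show False using no_root by (simp only: red_eq_0_iff) blast
      qed
      then have irr: "irreducible (map_poly red f)"
        by (intro irreducible_cubic_if_no_root) (simp_all add: f')
      have lead: "lead_coeff f = 1" by (simp add: f_def)
      have F: "map_poly of_padic_int f = [:of_padic_int (v * b3), of_padic_int (v * b2), of_padic_int (v * b1), 1:]"
        by (simp add: f_def map_poly_pCons)
      have "\<exists>\<theta>. poly (map_poly of_padic_int f) \<theta> = 0"
        by (rule alg_closed_imp_poly_has_root) (simp add: F)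
      then obtain \<theta> where \<theta>: "peval f \<theta> = 0" unfolding peval_def by blast
      have L: "unramified_extension (adjoin \<theta>)"
        using adjoin_unramified[OF lead irr \<theta>] by (simp add: unramified_extension_def)
      have "of_padic_int b0 * peval f \<theta> = of_padic_int (b0 * v) * (of_padic_int b3 + of_padic_int b2 * \<theta> + of_padic_int b1 * \<theta> ^ 2)
          + of_padic_int b0 * \<theta> ^ 3"
        by (simp add: f_def power2_eq_square power3_eq_cube algebra_simps)
      then have "binary_form b0 b1 b2 b3 \<theta> 1 = 0"
        using \<theta> by (simp add: v binary_form_def algebra_simps)
      moreover have "1 \<in> adjoin \<theta>"
        using coeff_extensionD(1)[OF unramified_extension_coeff_extension[OF L], of 1] by simp
      ultimately show ?thesis
        using L adjoin_self[of \<theta>] by (intro exI[of _ "adjoin \<theta>"] exI[of _ \<theta>] exI[of _ 1] conjI) simp_all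
    qed
  qed
qed

section \<open>A common overring of the unramified rings of integers\<close>

text \<open>After scaling, the equation of \<open>x\<close> has coefficients in Z_p and leading
  coefficient p^e; then p^e x satisfies a monic equation.\<close>

lemma padic_clear_denominators:
  fixes x :: "'p::prime_card padic_closure"
  shows "\<exists>k. padic_integral (pc ^ k * x)"
proof -
  obtain f :: "'p padic poly" where f: "f \<noteq> 0" "poly (map_poly to_ac f) x = 0"
    using alg_closure_algebraic by blast
  define n where "n = degree f"
  have "\<forall>i. \<exists>k a. pc ^ k * to_ac (coeff f i) = of_padic_int a"
    using padic_fract_decomp by blast
  then obtain k a where ka: "\<And>i. pc ^ k i * to_ac (coeff f i) = of_padic_int (a i)" by metis
  define K where "K = (\<Sum>i\<le>n. k i)"
  have kK: "k i \<le> K" if "i \<le> n" for i unfolding K_def using that by (intro member_le_sum) auto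
  define b where "b = (\<lambda>i. pp ^ (K - k i) * a i)"
  have b: "pc ^ K * to_ac (coeff f i) = of_padic_int (b i)" if "i \<le> n" for i
  proof -
    have "pc ^ K * to_ac (coeff f i) = pc ^ (K - k i) * (pc ^ k i * to_ac (coeff f i))"
      using kK[OF that] by (simp flip: mult.assoc power_add)
    then show ?thesis by (simp add: ka b_def)
  qed
  have "lead_coeff f \<noteq> 0" using f(1) by simp
  then have "of_padic_int (b n) \<noteq> 0" using b[of n] unfolding n_def[symmetric] by (metis le_refl mult_eq_0_iff
        of_nat_closure_nonzero power_not_zero to_ac_eq_0_iff)
  then have "b n \<noteq> 0" by simp
  then obtain e u where e: "b n = pp ^ e * u" "\<not> pp dvd u" by (rule padic_decomp)
  obtain v where v: "u * v = 1" using padic_unit_inverse[OF e(2)] by blast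
  have deg: "degree (map_poly to_ac f) = n" unfolding n_def by (rule degree_map_poly) simp
  have "(\<Sum>i\<le>n. to_ac (coeff f i) * x ^ i) = 0"
    using f(2) unfolding poly_altdef deg by (simp add: coeff_map_poly)
  then have "of_padic_int v * pc ^ K * (\<Sum>i\<le>n. to_ac (coeff f i) * x ^ i) = 0" by simp
  also have "of_padic_int v * pc ^ K * (\<Sum>i\<le>n. to_ac (coeff f i) * x ^ i) = (\<Sum>i\<le>n. of_padic_int (v * b i) * x ^ i)"
    unfolding sum_distrib_left
  proof (rule sum.cong[OF refl])
    fix i assume "i \<in> {..n}"
    then have "of_padic_int v * (pc ^ K * to_ac (coeff f i)) * x ^ i = of_padic_int (v * b i) * x ^ i" by (simp add: b)
    then show "of_padic_int v * pc ^ K * (to_ac (coeff f i) * x ^ i) = of_padic_int (v * b i) * x ^ i" by (simp only: mult.assoc)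
  qed
  finally have sum0: "(\<Sum>i\<le>n. of_padic_int (v * b i) * x ^ i) = 0" .
  have vb: "v * b n = pp ^ e" using v e(1) by (simp add: mult.left_commute mult.commute)
  have "n \<noteq> 0"
  proof
    assume "n = 0"
    then have "of_padic_int (v * b n) = 0" using sum0 by simp
    then show False unfolding vb by (simp add: pp_nonzero)
  qed
  then obtain n' where n': "n = Suc n'" by (cases n) auto
  \<comment> \<open>Here g(p^e T) is p^(e n') times the scaled equation evaluated at T, and
    \<open>n'\<close> is n - 1.\<close>
  define g where "g = monom 1 n + (\<Sum>i\<le>n'. monom (v * b i * pp ^ (e * (n' - i))) i)"
  have cg: "coeff g i = (if i = n then 1 else if i \<le> n' then v * b i * pp ^ (e * (n' - i)) else 0)" for i
    by (auto simp: g_def coeff_sum n')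
  have "degree g = n"
  proof (rule antisym)
    show "degree g \<le> n" by (rule degree_le) (auto simp: cg n')
    show "n \<le> degree g" by (rule le_degree) (simp add: cg)
  qed
  then have lead: "lead_coeff g = 1" by (simp add: cg)
  have "peval g (pc ^ e * x) = pc ^ (e * n) * x ^ n + (\<Sum>i\<le>n'. pc ^ (e * n') * (of_padic_int (v * b i) * x ^ i))"
  proof -
    have "of_padic_int (v * b i * pp ^ (e * (n' - i))) * (pc ^ e * x) ^ i = pc ^ (e * n') * (of_padic_int (v * b i) * x ^ i)"
      if "i \<le> n'" for i
    proof -
      have "e * (n' - i) + e * i = e * n'" using that by (simp flip: distrib_left)
      then have "pc ^ (e * (n' - i)) * pc ^ (e * i) = (pc ^ (e * n') :: 'p padic_closure)" by (simp only: flip: power_add)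
      then show ?thesis by (simp add: power_mult_distrib mult_ac flip: power_mult)
    qed
    then have "(\<Sum>i\<le>n'. of_padic_int (v * b i * pp ^ (e * (n' - i))) * (pc ^ e * x) ^ i) =
        (\<Sum>i\<le>n'. pc ^ (e * n') * (of_padic_int (v * b i) * x ^ i))" by (intro sum.cong refl) simp
    then show ?thesis
      by (simp only: g_def peval_simps peval_sum peval_monom of_padic_int_1 mult_1 power_mult_distrib flip: power_mult)
  qed
  also have "pc ^ (e * n) * x ^ n = pc ^ (e * n') * (of_padic_int (v * b n) * x ^ n)"
    unfolding vb by (simp add: n' power_add mult_ac)
  also have "\<dots> + (\<Sum>i\<le>n'. pc ^ (e * n') * (of_padic_int (v * b i) * x ^ i)) =
      pc ^ (e * n') * (\<Sum>i\<le>n. of_padic_int (v * b i) * x ^ i)"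
    unfolding n' sum.atMost_Suc distrib_left sum_distrib_left by (rule add.commute)
  finally have "peval g (pc ^ e * x) = 0" unfolding sum0 by simp
  then have "padic_integral (pc ^ e * x)" using lead unfolding padic_integral_def peval_def by blast
  then show ?thesis by blast
qed

section \<open>Frobenius congruences and approximate Teichmueller representatives\<close>

lemma prime_dvd_of_nat_binomial:
  assumes "0 < k" "k < CARD('p::prime_card)"
  shows "\<exists>j. CARD('p) choose k = CARD('p) * j"
proof -
  have "CARD('p) dvd (CARD('p) choose k)"
    by (rule Primes.dvd_choose_prime) (use assms prime_card[where 'a='p] in auto)
  then show ?thesis by (simp add: dvd_def)
qed

text \<open>
  We fix a valuation ring \<open>V\<close> that dominates \<open>\<int>\<^sub>p\<close>. The elements \<open>t\<close> with \<open>t\<^bsup>q\<^esup> \<equiv> t\<close> modulo \<open>p\<^sup>m\<close> for some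
  \<open>q = p\<^sup>n\<close> are approximate Teichmueller representatives. The ring that they generate
  plays the role of the ring of integers of the compositum of all unramified extensions: each of its elements
  \<open>S\<close> is congruent to the representative \<open>S\<^bsup>q\<^esup>\<close> for large \<open>q\<close> modulo \<open>p\<close> times the ring, and hence, up to
  high powers of \<open>p\<close>, is either a unit of \<open>V\<close> or divisible by \<open>p\<close> in the ring.
\<close>

context
  fixes V :: "'p::prime_card padic_closure set"
  assumes V: "dominating_ring V"
begin

text \<open>The modulus is p A + p^m V. The multiple of p has to stay in the subring
  \<open>A\<close>, because it is decomposed further, whereas the error of an approximate
  representative is only known to lie in \<open>V\<close>.\<close>

definition cong_mod :: "'p padic_closure set \<Rightarrow> nat \<Rightarrow> 'p padic_closure \<Rightarrow> 'p padic_closure \<Rightarrow> bool" where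
  "cong_mod A m x y \<longleftrightarrow> (\<exists>a\<in>A. \<exists>v\<in>V. x - y = pc * a + pc ^ m * v)"

lemma cong_modI: "a \<in> A \<Longrightarrow> v \<in> V \<Longrightarrow> x - y = pc * a + pc ^ m * v \<Longrightarrow> cong_mod A m x y"
  unfolding cong_mod_def by blast

context
  fixes A :: "'p padic_closure set" and m :: nat
  assumes A: "is_subring A" "A \<subseteq> V"
begin

lemma cong_mod_refl: "cong_mod A m x x"
  by (rule cong_modI[of 0 _ 0]) (simp_all add: subring_0[OF A(1)] dominating_intros[OF V])

lemma cong_mod_trans:
  assumes "cong_mod A m x y" "cong_mod A m y z"
  shows "cong_mod A m x z"
proof -
  obtain a v b w where *: "a \<in> A" "v \<in> V" "x - y = pc * a + pc ^ m * v" "b \<in> A" "w \<in> V" "y - z = pc * b + pc ^ m * w"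
    using assms unfolding cong_mod_def by blast
  have "x - z = (x - y) + (y - z)" by simp
  also have "\<dots> = pc * (a + b) + pc ^ m * (v + w)" unfolding *(3) *(6) by (simp add: algebra_simps)
  finally show ?thesis
    using * by (intro cong_modI[of "a + b" _ "v + w"] subring_add[OF A(1)] dominating_intros[OF V])
qed

lemma cong_mod_add:
  assumes "cong_mod A m x y" "cong_mod A m x' y'"
  shows "cong_mod A m (x + x') (y + y')"
proof -
  obtain a v b w where *: "a \<in> A" "v \<in> V" "x - y = pc * a + pc ^ m * v" "b \<in> A" "w \<in> V" "x' - y' = pc * b + pc ^ m * w"
    using assms unfolding cong_mod_def by blast
  have "x + x' - (y + y') = (x - y) + (x' - y')" by simp
  also have "\<dots> = pc * (a + b) + pc ^ m * (v + w)" unfolding *(3) *(6) by (simp add: algebra_simps)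
  finally show ?thesis
    using * by (intro cong_modI[of "a + b" _ "v + w"] subring_add[OF A(1)] dominating_intros[OF V])
qed

lemma cong_mod_mult_left:
  assumes "cong_mod A m x y" "z \<in> A"
  shows "cong_mod A m (z * x) (z * y)"
proof -
  obtain a v where *: "a \<in> A" "v \<in> V" "x - y = pc * a + pc ^ m * v" using assms unfolding cong_mod_def by blast
  have "z * x - z * y = z * (x - y)" by (simp add: right_diff_distrib)
  also have "\<dots> = pc * (z * a) + pc ^ m * (z * v)" unfolding *(3) by (simp add: algebra_simps)
  finally show ?thesis
    using * assms(2) A(2) by (intro cong_modI[of "z * a" _ "z * v"] subring_mult[OF A(1)] subring_mult[OF dominating_subring[OF V]]) auto
qed

lemma cong_mod_sym:
  assumes "cong_mod A m x y"
  shows "cong_mod A m y x"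
proof -
  obtain a v where *: "a \<in> A" "v \<in> V" "x - y = pc * a + pc ^ m * v" using assms unfolding cong_mod_def by blast
  have "y - x = - (x - y)" by simp
  also have "\<dots> = pc * (- a) + pc ^ m * (- v)" unfolding *(3) by simp
  finally show ?thesis
    using * by (intro cong_modI[of "- a" _ "- v"] subring_uminus[OF A(1)] dominating_intros[OF V])
qed

lemma cong_mod_mult:
  assumes "cong_mod A m x y" "cong_mod A m x' y'" "x' \<in> A" "y \<in> A"
  shows "cong_mod A m (x * x') (y * y')"
proof (rule cong_mod_trans)
  show "cong_mod A m (x * x') (y * x')" using cong_mod_mult_left[OF assms(1,3)] by (simp only: mult.commute)
  show "cong_mod A m (y * x') (y * y')" by (rule cong_mod_mult_left[OF assms(2,4)])
qed

lemma cong_mod_power: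
  assumes "cong_mod A m x y" "x \<in> A" "y \<in> A"
  shows "cong_mod A m (x ^ k) (y ^ k)"
proof (induction k)
  case 0
  show ?case by (simp add: cong_mod_refl)
next
  case (Suc k)
  show ?case unfolding power_Suc
    by (rule cong_mod_mult[OF assms(1) Suc subring_power[OF A(1) assms(2)] assms(3)])
qed

lemma cong_mod_frobenius:
  assumes a: "a \<in> A" and b: "b \<in> A"
  shows "cong_mod A m ((a + b) ^ CARD('p)) (a ^ CARD('p) + b ^ CARD('p))"
proof -
  let ?q = "CARD('p)"
  have q: "?q > 0" using prime_gt_0_nat[OF prime_card[where 'a='p]] by simp
  define g where "g = (\<lambda>k. of_nat (?q choose k) * a ^ k * b ^ (?q - k))"
  have "\<forall>k. \<exists>j. k \<in> {1..<?q} \<longrightarrow> ?q choose k = ?q * j"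
    using prime_dvd_of_nat_binomial[where 'p='p] by auto
  then obtain j where j: "\<And>k. k \<in> {1..<?q} \<Longrightarrow> ?q choose k = ?q * j k" by metis
  have "(a + b) ^ ?q = (\<Sum>k\<le>?q. g k)" unfolding g_def by (rule binomial_ring)
  also have "{..?q} = insert 0 (insert ?q {1..<?q})" using q by auto
  also have "(\<Sum>k\<in>\<dots>. g k) = b ^ ?q + (a ^ ?q + (\<Sum>k\<in>{1..<?q}. g k))"
    using q by (simp add: g_def)
  also have "(\<Sum>k\<in>{1..<?q}. g k) = pc * (\<Sum>k\<in>{1..<?q}. of_nat (j k) * a ^ k * b ^ (?q - k))"
    unfolding sum_distrib_left by (rule sum.cong[OF refl]) (simp add: g_def j mult_ac)
  finally have eq: "(a + b) ^ ?q - (a ^ ?q + b ^ ?q) = pc * (\<Sum>k\<in>{1..<?q}. of_nat (j k) * a ^ k * b ^ (?q - k)) + pc ^ m * 0"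
    by simp
  show ?thesis
    by (rule cong_modI[OF subring_sum[OF A(1)] dominating_intros(2)[OF V] eq])
      (intro subring_intros[OF A(1)] a b)
qed

lemma cong_mod_frobenius_power:
  assumes a: "a \<in> A" and b: "b \<in> A"
  shows "cong_mod A m ((a + b) ^ (CARD('p) ^ n)) (a ^ (CARD('p) ^ n) + b ^ (CARD('p) ^ n))"
proof (induction n)
  case 0
  show ?case by (simp add: cong_mod_refl)
next
  case (Suc n)
  let ?q = "CARD('p)"
  note AI = subring_intros[OF A(1)]
  have 1: "cong_mod A m (((a + b) ^ (?q ^ n)) ^ ?q) ((a ^ (?q ^ n) + b ^ (?q ^ n)) ^ ?q)"
    by (rule cong_mod_power[OF Suc]) (intro AI a b)+
  have 2: "cong_mod A m ((a ^ (?q ^ n) + b ^ (?q ^ n)) ^ ?q) ((a ^ (?q ^ n)) ^ ?q + (b ^ (?q ^ n)) ^ ?q)"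
    by (rule cong_mod_frobenius) (intro AI a b)+
  show ?case using cong_mod_trans[OF 1 2] by (simp only: power_Suc2 flip: power_mult)
qed

text \<open>Gives two elements with exponents n1 and n2 the common exponent n1 n2.\<close>

lemma cong_mod_iterate:
  assumes S: "S \<in> A" and n: "cong_mod A m (S ^ (CARD('p) ^ n)) S"
  shows "cong_mod A m (S ^ (CARD('p) ^ (n * N))) S"
proof (induction N)
  case 0
  show ?case by (simp add: cong_mod_refl)
next
  case (Suc N)
  have "cong_mod A m ((S ^ (CARD('p) ^ (n * N))) ^ (CARD('p) ^ n)) (S ^ (CARD('p) ^ n))"
    by (rule cong_mod_power[OF Suc]) (intro subring_intros[OF A(1)] S)+
  from cong_mod_trans[OF this n] show ?case
    by (simp only: mult_Suc_right power_add mult.commute flip: power_mult)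
qed

end

text \<open>Each p-th power gains a factor p: x^p - y^p is x - y times a sum of p terms, all
  congruent to y^(p-1) modulo p.\<close>

lemma power_lift:
  assumes a: "a \<in> V" and b: "b \<in> V" and ab: "\<exists>v\<in>V. a - b = pc * v"
  shows "\<exists>v\<in>V. a ^ (CARD('p) ^ k) - b ^ (CARD('p) ^ k) = pc ^ Suc k * v"
proof (induction k)
  case 0
  show ?case using ab by simp
next
  case (Suc k)
  let ?q = "CARD('p)"
  note VI = dominating_intros[OF V] dominating_pc[OF V]
  define x y where "x = a ^ (?q ^ k)" and "y = b ^ (?q ^ k)"
  have xy: "x \<in> V" "y \<in> V" unfolding x_def y_def by (intro VI a b)+
  obtain v where v: "v \<in> V" "x - y = pc ^ Suc k * v" using Suc unfolding x_def y_def by blast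
  have "\<exists>w\<in>V. x ^ i - y ^ i = pc * w" for i
  proof -
    have "x ^ i - y ^ i = (x - y) * (\<Sum>l<i. y ^ (i - Suc l) * x ^ l)" by (rule power_diff_sumr2)
    also have "\<dots> = pc * (pc ^ k * v * (\<Sum>l<i. y ^ (i - Suc l) * x ^ l))" unfolding v(2) by (simp add: mult_ac)
    finally show ?thesis by (rule bexI) (intro VI xy v)
  qed
  then obtain w where w: "\<And>i. w i \<in> V" "\<And>i. x ^ i - y ^ i = pc * w i" by metis
  have "(\<Sum>l<?q. y ^ (?q - Suc l) * x ^ l) = (\<Sum>l<?q. y ^ (?q - 1) + pc * (y ^ (?q - Suc l) * w l))"
  proof (rule sum.cong[OF refl])
    fix l assume "l \<in> {..<?q}"
    then have "y ^ (?q - 1) = y ^ (?q - Suc l) * y ^ l" by (simp flip: power_add)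
    moreover have "x ^ l = y ^ l + pc * w l" using w(2)[of l] by (simp add: algebra_simps)
    ultimately show "y ^ (?q - Suc l) * x ^ l = y ^ (?q - 1) + pc * (y ^ (?q - Suc l) * w l)"
      by (simp only: distrib_left mult_ac)
  qed
  also have "\<dots> = pc * (y ^ (?q - 1) + (\<Sum>l<?q. y ^ (?q - Suc l) * w l))"
    by (simp add: sum.distrib distrib_left flip: sum_distrib_left)
  finally have s: "(\<Sum>l<?q. y ^ (?q - Suc l) * x ^ l) = pc * (y ^ (?q - 1) + (\<Sum>l<?q. y ^ (?q - Suc l) * w l))" .
  have "x ^ ?q - y ^ ?q = (x - y) * (\<Sum>l<?q. y ^ (?q - Suc l) * x ^ l)" by (rule power_diff_sumr2)
  also have "\<dots> = pc ^ Suc (Suc k) * (v * (y ^ (?q - 1) + (\<Sum>l<?q. y ^ (?q - Suc l) * w l)))"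
    unfolding v(2) s by (simp add: mult_ac)
  finally have "\<exists>v\<in>V. x ^ ?q - y ^ ?q = pc ^ Suc (Suc k) * v"
    by (rule bexI) (intro VI xy v w(1))
  then show ?case unfolding x_def y_def by (simp only: power_Suc2 flip: power_mult)
qed

text \<open>\<open>n\<ge>1\<close> excludes the vacuous exponent p^0. The equation is imposed only
  modulo p^m, so no limit has to be formed in \<open>V\<close>.\<close>

definition teichmueller :: "nat \<Rightarrow> 'p padic_closure set" where
  "teichmueller m = {t \<in> V. \<exists>n\<ge>1. \<exists>v\<in>V. t ^ (CARD('p) ^ n) - t = pc ^ m * v}"

text \<open>\<open>- 1\<close> is a separate generator because for p = 2 and m \<ge> 2 it is not in
  \<open>teichmueller m\<close>; together with sums and products it yields differences.\<close>

inductive_set witt :: "nat \<Rightarrow> 'p padic_closure set" for m where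
  gen: "t \<in> teichmueller m \<Longrightarrow> t \<in> witt m"
| neg1: "- 1 \<in> witt m"
| add: "x \<in> witt m \<Longrightarrow> y \<in> witt m \<Longrightarrow> x + y \<in> witt m"
| mult: "x \<in> witt m \<Longrightarrow> y \<in> witt m \<Longrightarrow> x * y \<in> witt m"

lemma witt_subring: "is_subring (witt m)"
proof (rule is_subringI)
  show "1 \<in> witt m" using witt.mult[OF witt.neg1 witt.neg1, of m] by simp
  show "x - y \<in> witt m" if "x \<in> witt m" "y \<in> witt m" for x y
    using witt.add[OF that(1) witt.mult[OF witt.neg1 that(2)]] by simp
qed (rule witt.mult)

lemma witt_subset: "witt m \<subseteq> V"
proof
  fix x assume "x \<in> witt m"
  then show "x \<in> V"
    by induction (auto simp: teichmueller_def intro: dominating_intros[OF V])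
qed

lemma teichmueller_Suc: "t \<in> teichmueller (Suc m) \<Longrightarrow> t \<in> teichmueller m"
  unfolding teichmueller_def
proof safe
  fix n v assume *: "n \<ge> 1" "v \<in> V" "t ^ (CARD('p) ^ n) - t = pc ^ Suc m * v"
  have "t ^ (CARD('p) ^ n) - t = pc ^ m * (pc * v)" using *(3) by (simp add: mult_ac)
  moreover have "pc * v \<in> V" using *(2) by (intro dominating_intros[OF V])
  ultimately show "\<exists>n\<ge>1. \<exists>v\<in>V. t ^ (CARD('p) ^ n) - t = pc ^ m * v" using *(1) by blast
qed

lemma witt_Suc: "x \<in> witt (Suc m) \<Longrightarrow> x \<in> witt m"
  by (induction rule: witt.induct) (auto intro: witt.intros teichmueller_Suc)

text \<open>Induction over the generation of the ring. Frobenius is additive modulo p times the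
  ring, and both exponents are iterated to a common one; for \<open>- 1\<close> and p = 2 the
  difference 1 - (-1) is p itself.\<close>

lemma witt_frobenius:
  assumes "S \<in> witt m"
  shows "\<exists>n\<ge>1. cong_mod (witt m) m (S ^ (CARD('p) ^ n)) S"
  using assms
proof induction
  case (gen t)
  then obtain n v where n: "n \<ge> 1" "v \<in> V" "t ^ (CARD('p) ^ n) - t = pc ^ m * v" unfolding teichmueller_def by blast
  have "cong_mod (witt m) m (t ^ (CARD('p) ^ n)) t"
    by (rule cong_modI[OF subring_0[OF witt_subring] n(2)]) (use n in simp)
  then show ?case using n(1) by blast
next
  case neg1
  have "cong_mod (witt m) m ((- 1) ^ CARD('p)) (- 1)"
  proof (cases "even CARD('p)")
    case True
    then have 2: "CARD('p) = 2"
      using prime_card[where 'a='p] primes_dvd_imp_eq[of 2 "CARD('p)"] two_is_prime_nat by auto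
    show ?thesis
      by (rule cong_modI[OF subring_1[OF witt_subring] dominating_intros(2)[OF V]]) (simp add: 2)
  next
    case False
    then show ?thesis by (simp add: cong_mod_refl[OF witt_subring witt_subset])
  qed
  then show ?case by (intro exI[of _ 1]) simp
next
  case (add x y)
  then obtain n1 n2 where n: "n1 \<ge> 1" "n2 \<ge> 1" "cong_mod (witt m) m (x ^ (CARD('p) ^ n1)) x"
    "cong_mod (witt m) m (y ^ (CARD('p) ^ n2)) y" by blast
  note W = witt_subring witt_subset
  have 1: "cong_mod (witt m) m (x ^ (CARD('p) ^ (n1 * n2))) x"
    by (rule cong_mod_iterate[OF W add.hyps(1) n(3)])
  have 2: "cong_mod (witt m) m (y ^ (CARD('p) ^ (n1 * n2))) y"
    using cong_mod_iterate[OF W add.hyps(2) n(4), of n1] by (simp only: mult.commute)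
  have "cong_mod (witt m) m ((x + y) ^ (CARD('p) ^ (n1 * n2))) (x + y)"
    by (rule cong_mod_trans[OF W cong_mod_frobenius_power[OF W add.hyps(1,2)] cong_mod_add[OF W 1 2]])
  then show ?case using n(1,2) by (intro exI[of _ "n1 * n2"]) simp
next
  case (mult x y)
  then obtain n1 n2 where n: "n1 \<ge> 1" "n2 \<ge> 1" "cong_mod (witt m) m (x ^ (CARD('p) ^ n1)) x"
    "cong_mod (witt m) m (y ^ (CARD('p) ^ n2)) y" by blast
  note W = witt_subring witt_subset
  have 1: "cong_mod (witt m) m (x ^ (CARD('p) ^ (n1 * n2))) x"
    by (rule cong_mod_iterate[OF W mult.hyps(1) n(3)])
  have 2: "cong_mod (witt m) m (y ^ (CARD('p) ^ (n1 * n2))) y"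
    using cong_mod_iterate[OF W mult.hyps(2) n(4), of n1] by (simp only: mult.commute)
  have "cong_mod (witt m) m ((x * y) ^ (CARD('p) ^ (n1 * n2))) (x * y)"
    unfolding power_mult_distrib
    by (rule cong_mod_mult[OF W 1 2 subring_power[OF witt_subring mult.hyps(2)] mult.hyps(1)])
  then show ?case using n(1,2) by (intro exI[of _ "n1 * n2"]) simp
qed

text \<open>By \<open>power_lift\<close>, n m Frobenius steps turn a congruence modulo p into one
  modulo p^(n m + 1), which is at least the precision m as \<open>n \<ge> 1\<close>.\<close>

lemma teichmueller_power:
  assumes x: "x \<in> V" and n: "n \<ge> 1" "\<exists>v\<in>V. x ^ (CARD('p) ^ n) - x = pc * v"
  shows "x ^ (CARD('p) ^ (n * m)) \<in> teichmueller m"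
proof -
  let ?q = "CARD('p)"
  have "\<exists>v\<in>V. (x ^ (?q ^ n)) ^ (?q ^ (n * m)) - x ^ (?q ^ (n * m)) = pc ^ Suc (n * m) * v"
    by (rule power_lift[OF _ x n(2)]) (intro dominating_intros[OF V] x)
  then obtain v where v: "v \<in> V" "(x ^ (?q ^ n)) ^ (?q ^ (n * m)) - x ^ (?q ^ (n * m)) = pc ^ Suc (n * m) * v" by blast
  have "m \<le> n * m" using n(1) by simp
  then have "m + (Suc (n * m) - m) = Suc (n * m)" by linarith
  then have e: "pc ^ Suc (n * m) = pc ^ m * (pc ^ (Suc (n * m) - m) :: 'p padic_closure)" by (simp only: flip: power_add)
  have "(x ^ (?q ^ (n * m))) ^ (?q ^ n) - x ^ (?q ^ (n * m)) = pc ^ m * (pc ^ (Suc (n * m) - m) * v)"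
    using v(2) unfolding e by (simp only: mult.assoc mult.commute[of "CARD('p) ^ n"] flip: power_mult)
  moreover have "pc ^ (Suc (n * m) - m) * v \<in> V" using v(1) by (intro dominating_intros[OF V])
  moreover have "x ^ (?q ^ (n * m)) \<in> V" using x by (intro dominating_intros[OF V])
  ultimately show ?thesis unfolding teichmueller_def using n(1) by blast
qed

lemma witt_decomp:
  assumes S: "S \<in> witt (Suc m)"
  shows "\<exists>\<rho>\<in>teichmueller (Suc m). \<exists>S'\<in>witt (Suc m). \<exists>v\<in>V. S = \<rho> + pc * S' + pc ^ Suc m * v"
proof -
  let ?q = "CARD('p)"
  note W = witt_subring witt_subset
  obtain n where n: "n \<ge> 1" "cong_mod (witt (Suc m)) (Suc m) (S ^ (?q ^ n)) S" using witt_frobenius[OF S] by blast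
  have SV: "S \<in> V" using S witt_subset by blast
  obtain a v where av: "a \<in> witt (Suc m)" "v \<in> V" "S ^ (?q ^ n) - S = pc * a + pc ^ Suc m * v"
    using n(2) unfolding cong_mod_def by blast
  have "S ^ (?q ^ n) - S = pc * (a + pc ^ m * v)" using av(3) by (simp add: algebra_simps)
  moreover have "a + pc ^ m * v \<in> V" using av witt_subset by (intro dominating_intros[OF V]) auto
  \<comment> \<open>The exponent is a multiple of \<open>n\<close>, so that the power is still
    congruent to \<open>S\<close>, and large enough for the precision p^(m+1).\<close>
  ultimately have "S ^ (?q ^ (n * Suc m)) \<in> teichmueller (Suc m)"
    using n(1) by (intro teichmueller_power[OF SV]) auto
  moreover have "cong_mod (witt (Suc m)) (Suc m) S (S ^ (?q ^ (n * Suc m)))"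
    by (rule cong_mod_sym[OF W cong_mod_iterate[OF W S n(2)]])
  then obtain b w where bw: "b \<in> witt (Suc m)" "w \<in> V" "S - S ^ (?q ^ (n * Suc m)) = pc * b + pc ^ Suc m * w"
    unfolding cong_mod_def by blast
  moreover have "S = S ^ (?q ^ (n * Suc m)) + pc * b + pc ^ Suc m * w"
    using bw(3) by (simp only: diff_eq_eq add.commute add.left_commute)
  ultimately show ?thesis by blast
qed

text \<open>The maximal ideal of \<open>V\<close>: elements outside \<open>V\<close> do not qualify,
  since their inverses lie in \<open>V\<close>.\<close>

definition nonunit :: "'p padic_closure \<Rightarrow> bool" where
  "nonunit x \<longleftrightarrow> x = 0 \<or> inverse x \<notin> V"

lemma nonunit_pc_mult:
  assumes "v \<in> V"
  shows "nonunit (pc * v)"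
proof (cases "pc * v = 0")
  case False
  have "inverse (pc * v) \<notin> V"
  proof
    assume "inverse (pc * v) \<in> V"
    then have "v * inverse (pc * v) \<in> V" using assms by (intro dominating_intros[OF V])
    moreover have "pc * (v * inverse (pc * v)) = 1" using False by (simp add: field_simps)
    ultimately show False using pc_not_unit[OF V] by blast
  qed
  then show ?thesis by (simp add: nonunit_def)
qed (simp add: nonunit_def)

lemma nonunit_mult:
  assumes "x \<in> V" "nonunit y"
  shows "nonunit (x * y)"
proof (cases "x * y = 0")
  case False
  have eq: "inverse y = x * inverse (x * y)" using False by (simp add: field_simps)
  have "inverse y \<notin> V" using assms(2) False by (auto simp: nonunit_def)
  then have "inverse (x * y) \<notin> V"
    using subring_mult[OF dominating_subring[OF V] assms(1), of "inverse (x * y)"] unfolding eq[symmetric] by blast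
  then show ?thesis unfolding nonunit_def by blast
qed (simp add: nonunit_def)

lemma nonunit_add:
  assumes "nonunit x" "nonunit y"
  shows "nonunit (x + y)"
proof -
  have *: "nonunit (x + y)" if "nonunit x" "nonunit y" "y \<noteq> 0" "x / y \<in> V" for x y
  proof -
    have "x + y = (x / y + 1) * y" using that(3) by (simp add: field_simps)
    moreover have "x / y + 1 \<in> V" using that(4) by (intro dominating_intros[OF V])
    ultimately show ?thesis using nonunit_mult that(2) by metis
  qed
  consider "x = 0" | "y = 0" | "x \<noteq> 0" "y \<noteq> 0" "x / y \<in> V" | "x \<noteq> 0" "y \<noteq> 0" "y / x \<in> V"
    using dominating_cases[OF V, of "x / y"] by fastforce
  then show ?thesis
    using assms *[of x y] *[of y x] by cases (simp_all add: add.commute)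
qed

lemma nonunit_1: "\<not> nonunit 1"
  by (simp add: nonunit_def dominating_intros[OF V])

text \<open>The intersection over m of \<open>witt m\<close> + p^m V, so that divisibility by p can
  be decided on approximations of every precision.\<close>

definition nr_integers :: "'p padic_closure set" where
  "nr_integers = {x \<in> V. \<forall>m. \<exists>S\<in>witt m. \<exists>v\<in>V. x - S = pc ^ m * v}"

lemma nr_integers_subset: "x \<in> nr_integers \<Longrightarrow> x \<in> V"
  by (simp add: nr_integers_def)

lemma nr_integers_subring: "is_subring nr_integers"
proof (rule is_subringI)
  note VI = dominating_intros[OF V]
  show "1 \<in> nr_integers"
    unfolding nr_integers_def
    by (intro CollectI conjI allI VI bexI[of _ "1 :: 'p padic_closure"] bexI[of _ "0 :: 'p padic_closure"]
        subring_1[OF witt_subring]) simp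
  fix x y assume xy: "x \<in> nr_integers" "y \<in> nr_integers"
  have V': "x \<in> V" "y \<in> V" using xy by (auto intro: nr_integers_subset)
  have 1: "\<exists>S\<in>witt m. \<exists>v\<in>V. x - y - S = pc ^ m * v" for m
  proof -
    obtain S v T w where *: "S \<in> witt m" "v \<in> V" "x - S = pc ^ m * v" "T \<in> witt m" "w \<in> V" "y - T = pc ^ m * w"
      using xy unfolding nr_integers_def by blast
    have "x - y - (S - T) = (x - S) - (y - T)" by simp
    also have "\<dots> = pc ^ m * (v - w)" unfolding *(3) *(6) by (simp add: right_diff_distrib)
    finally show ?thesis
      using * by (intro bexI[of _ "S - T"] bexI[of _ "v - w"] VI subring_diff[OF witt_subring])
  qed
  then show "x - y \<in> nr_integers" unfolding nr_integers_def using V' by (intro CollectI conjI VI allI)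
  have 2: "\<exists>S\<in>witt m. \<exists>v\<in>V. x * y - S = pc ^ m * v" for m
  proof -
    obtain S v T w where *: "S \<in> witt m" "v \<in> V" "x - S = pc ^ m * v" "T \<in> witt m" "w \<in> V" "y - T = pc ^ m * w"
      using xy unfolding nr_integers_def by blast
    have SV: "S \<in> V" using *(1) witt_subset by blast
    have "x * y - S * T = (x - S) * y + S * (y - T)" by (simp add: algebra_simps)
    also have "\<dots> = pc ^ m * (v * y + S * w)" unfolding *(3) *(6) by (simp add: algebra_simps)
    finally show ?thesis
      using * V' SV by (intro bexI[of _ "S * T"] bexI[of _ "v * y + S * w"] VI subring_mult[OF witt_subring])
  qed
  then show "x * y \<in> nr_integers" unfolding nr_integers_def using V' by (intro CollectI conjI VI allI)
qed

text \<open>Write \<open>x\<close> as \<rho> + p S' up to p^(m+1) V. As \<open>x\<close> is a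
  non-unit, so is \<rho>; and \<rho> (\<rho>^(Q-1) - 1) is divisible by p^(m+1) with the second
  factor a unit. So \<rho> is negligible and S' approximates x/p. One power of p is lost, hence the
  start at level m + 1.\<close>

lemma nr_integers_cases:
  assumes x: "x \<in> nr_integers" "nonunit x"
  shows "\<exists>y\<in>nr_integers. x = pc * y"
proof -
  note VI = dominating_intros[OF V]
  define y where "y = x / pc"
  have xy: "x = pc * y" by (simp add: y_def)
  have approx: "\<exists>S\<in>witt m. \<exists>v\<in>V. y - S = pc ^ m * v" for m
  proof -
    obtain S v where S: "S \<in> witt (Suc m)" "v \<in> V" "x - S = pc ^ Suc m * v"
      using x(1) unfolding nr_integers_def by blast
    obtain \<rho> S' w where \<rho>: "\<rho> \<in> teichmueller (Suc m)" "S' \<in> witt (Suc m)" "w \<in> V" "S = \<rho> + pc * S' + pc ^ Suc m * w"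
      using witt_decomp[OF S(1)] by blast
    have S'V: "S' \<in> V" using \<rho>(2) witt_subset by blast
    obtain n u where n: "\<rho> \<in> V" "n \<ge> 1" "u \<in> V" "\<rho> ^ (CARD('p) ^ n) - \<rho> = pc ^ Suc m * u"
      using \<rho>(1) unfolding teichmueller_def by blast
    have "x = S + pc ^ Suc m * v" using S(3) by (simp add: algebra_simps)
    then have x\<rho>: "x = \<rho> + pc * (S' + pc ^ m * (v + w))" unfolding \<rho>(4) by (simp add: algebra_simps)
    have "nonunit (x + pc * - (S' + pc ^ m * (v + w)))"
      by (rule nonunit_add[OF x(2) nonunit_pc_mult]) (use S \<rho> S'V in \<open>intro VI\<close>)
    moreover have "x + pc * - (S' + pc ^ m * (v + w)) = \<rho>" unfolding x\<rho> by (simp only: mult_minus_right add_diff_cancel_right' add_uminus_conv_diff)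
    ultimately have \<rho>n: "nonunit \<rho>" by (simp only:)
    define Q where "Q = CARD('p) ^ n"
    have "1 < CARD('p)" using prime_gt_1_nat[OF prime_card[where 'a='p]] by simp
    then have "1 < Q" unfolding Q_def using n(2) by (intro one_less_power) auto
    then have "Q = Suc (Suc (Q - 2))" by simp
    then obtain Q' where Q': "Q = Suc (Suc Q')" by (rule that)
    define g where "g = \<rho> ^ Suc Q' - 1"
    have gV: "g \<in> V" unfolding g_def by (intro VI n)
    have "\<not> nonunit g"
    proof
      assume "nonunit g"
      then have "nonunit (- 1 * g)" by (intro nonunit_mult VI)
      moreover have "nonunit (\<rho> ^ Suc Q')"
        unfolding power_Suc2 by (rule nonunit_mult[OF _ \<rho>n]) (intro VI n)
      ultimately have "nonunit (\<rho> ^ Suc Q' + - 1 * g)" by (rule nonunit_add[rotated])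
      then show False using nonunit_1 by (simp add: g_def)
    qed
    then have g: "g \<noteq> 0" "inverse g \<in> V" by (auto simp: nonunit_def)
    have "\<rho> * g = pc ^ Suc m * u" using n(4) unfolding Q_def[symmetric] Q' g_def by (simp add: algebra_simps)
    then have \<rho>u: "\<rho> = pc ^ Suc m * (u * inverse g)" using g(1) by (simp add: field_simps)
    have "x = pc * (S' + pc ^ m * (u * inverse g + v + w))"
      by (subst x\<rho>, subst \<rho>u) (simp add: algebra_simps)
    then have "y = S' + pc ^ m * (u * inverse g + v + w)" unfolding xy by (simp only: mult_cancel_left of_nat_closure_nonzero simp_thms)
    then have "y - S' = pc ^ m * (u * inverse g + v + w)" by simp
    moreover have "u * inverse g + v + w \<in> V" by (intro VI n g S \<rho>)
    ultimately show ?thesis using witt_Suc[OF \<rho>(2)] by blast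
  qed
  have "y \<in> V"
  proof -
    obtain S v where S: "S \<in> witt 0" "v \<in> V" "y - S = pc ^ 0 * v" using approx[of 0] by blast
    have "y = S + v" using S(3) by (simp add: algebra_simps)
    moreover have "S \<in> V" using S(1) witt_subset by blast
    ultimately show ?thesis using S(2) by (simp add: dominating_intros[OF V])
  qed
  then have "y \<in> nr_integers" unfolding nr_integers_def using approx by (intro CollectI conjI allI)
  then show ?thesis using xy by blast
qed

end

section \<open>Embedding of the unramified rings of integers into the common ring\<close>

lemma integer_ring_iff: "x \<in> integer_ring L \<longleftrightarrow> x \<in> L \<and> padic_integral x"
  by (simp add: integer_ring_def padic_integral_def)

text \<open>Z_p[x] is finitely generated over Z_p, so its quotient by p is finite and two of the
  powers x^(p^i) agree there.\<close>

lemma pigeonhole_powers: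
  fixes x :: "'p::prime_card padic_closure"
  assumes "padic_integral x"
  shows "\<exists>i n e. n \<ge> 1 \<and> x ^ (CARD('p) ^ i) - x ^ (CARD('p) ^ (i + n)) = pc * peval e x"
proof -
  let ?q = "CARD('p)"
  obtain f d where x: "x ^ Suc d = - (\<Sum>i\<le>d. of_padic_int (coeff f i) * x ^ i)"
    using padic_integralE[OF assms] by metis
  have "\<forall>i. \<exists>a. peval (monom 1 (?q ^ i)) x = (\<Sum>j\<le>d. of_padic_int (a j) * x ^ j)"
    by (intro allI peval_reduce[OF x])
  then obtain a where a: "\<And>i. peval (monom 1 (?q ^ i)) x = (\<Sum>j\<le>d. of_padic_int (a i j) * x ^ j)" by metis
  let ?r = "\<lambda>i. \<lambda>j\<in>{..d}. red (a i j)"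
  have "range ?r \<subseteq> (\<Pi>\<^sub>E j\<in>{..d}. (UNIV :: 'p mod_ring set))"
    by (intro image_subsetI restrict_PiE_iff[THEN iffD2]) simp
  then have "finite (range ?r)" by (rule finite_subset) (simp add: finite_PiE)
  then have "\<not> inj ?r" using finite_imageD[of ?r UNIV] by auto
  then obtain i' k' where ik': "?r i' = ?r k'" "i' \<noteq> k'" unfolding inj_def by blast
  define i k where "i = min i' k'" and "k = max i' k'"
  have ik: "i < k" "?r i = ?r k" using ik' by (auto simp: i_def k_def min_def max_def)
  have "\<forall>j. \<exists>b. j \<le> d \<longrightarrow> a i j - a k j = pp * b"
  proof (intro allI)
    fix j
    show "\<exists>b. j \<le> d \<longrightarrow> a i j - a k j = pp * b"
    proof (cases "j \<le> d")
      case True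
      then have "red (a i j) = red (a k j)" using fun_cong[OF ik(2), of j] by simp
      then show ?thesis by (simp add: red_eq_iff dvd_def)
    qed simp
  qed
  then obtain b where b: "\<And>j. j \<le> d \<Longrightarrow> a i j - a k j = pp * b j" by metis
  have "x ^ (?q ^ i) - x ^ (?q ^ k) = (\<Sum>j\<le>d. of_padic_int (a i j - a k j) * x ^ j)"
    using a[of i] a[of k] by (simp add: peval_monom left_diff_distrib sum_subtractf)
  also have "\<dots> = (\<Sum>j\<le>d. pc * (of_padic_int (b j) * x ^ j))"
    by (rule sum.cong[OF refl]) (simp only: b atMost_iff of_padic_int_mult of_padic_int_of_nat mult.assoc)
  also have "\<dots> = pc * peval (\<Sum>j\<le>d. monom (b j) j) x"
    by (simp only: peval_sum peval_monom sum_distrib_left)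
  finally have "x ^ (?q ^ i) - x ^ (?q ^ (i + (k - i))) = pc * peval (\<Sum>j\<le>d. monom (b j) j) x"
    using ik(1) by simp
  moreover have "k - i \<ge> 1" using ik(1) by simp
  ultimately show ?thesis by blast
qed

context
  fixes V :: "'p::prime_card padic_closure set"
  assumes V: "dominating_ring V"
begin

text \<open>Let q be p^(n N). By Frobenius, a p-power of x - x^q lies in p V, so x - x^q has no
  inverse in \<open>integer_ring L\<close>. Here unramifiedness enters: such an element is p times
  an integer of L, not merely a non-unit.\<close>

lemma unramified_frobenius:
  fixes x :: "'p padic_closure"
  assumes L: "unramified_extension L" and x: "x \<in> integer_ring L"
  shows "\<exists>n\<ge>1. \<forall>N. \<exists>y\<in>integer_ring L. x - x ^ (CARD('p) ^ (n * N)) = pc * y"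
proof -
  let ?q = "CARD('p)"
  note VI = dominating_intros[OF V]
  note VV = dominating_subring[OF V] subset_refl[of V]
  have int: "padic_integral x" and xL: "x \<in> L" using x by (simp_all add: integer_ring_iff)
  have xV: "x \<in> V" by (rule dominating_integral[OF V int])
  obtain i n e where n: "n \<ge> 1" "x ^ (?q ^ i) - x ^ (?q ^ (i + n)) = pc * peval e x"
    using pigeonhole_powers[OF int] by blast
  have eV: "peval e x \<in> V" by (rule dominating_integral[OF V padic_integral_peval[OF int]])
  have "\<exists>y\<in>integer_ring L. x - x ^ (?q ^ (n * N)) = pc * y" for N
  proof -
    define w y where "w = x ^ (?q ^ (n * N))" and "y = x - w"
    have wV: "w \<in> V" unfolding w_def by (intro VI xV)
    have yV: "y \<in> V" unfolding y_def by (intro VI xV wV)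
    have "y = peval ([:0, 1:] - [:0, 1:] ^ (?q ^ (n * N))) x" by (simp add: y_def w_def)
    then have yint: "y \<in> integer_ring L"
      using padic_integral_peval[OF int] peval_in_coeff_extension[OF unramified_extension_coeff_extension[OF L] xL]
      by (simp only: integer_ring_iff)
    define u where "u = x ^ (?q ^ i)"
    have uV: "u \<in> V" unfolding u_def by (intro VI xV)
    have "cong_mod V V 1 (u ^ (?q ^ n)) u"
    proof (rule cong_mod_sym[OF V VV])
      have "u - u ^ (?q ^ n) = pc * peval e x + pc ^ 1 * 0"
        using n(2) by (simp add: u_def power_add flip: power_mult)
      then show "cong_mod V V 1 u (u ^ (?q ^ n))" by (rule cong_modI[OF V eV VI(2)])
    qed
    then have u: "cong_mod V V 1 (u ^ (?q ^ (n * N))) u" by (rule cong_mod_iterate[OF V VV uV])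
    have uw: "u ^ (?q ^ (n * N)) = w ^ (?q ^ i)"
      by (simp add: u_def w_def mult.commute flip: power_mult)
    have "cong_mod V V 1 ((y + w) ^ (?q ^ i)) (y ^ (?q ^ i) + w ^ (?q ^ i))"
      by (rule cong_mod_frobenius_power[OF V VV yV wV])
    then have 1: "cong_mod V V 1 u (y ^ (?q ^ i) + w ^ (?q ^ i))" by (simp add: y_def u_def)
    have 2: "cong_mod V V 1 (w ^ (?q ^ i)) (y ^ (?q ^ i) + w ^ (?q ^ i))"
      using cong_mod_trans[OF V VV u 1] by (simp only: uw)
    then obtain a b where ab: "a \<in> V" "b \<in> V" "w ^ (?q ^ i) - (y ^ (?q ^ i) + w ^ (?q ^ i)) = pc * a + pc ^ 1 * b"
      unfolding cong_mod_def[OF V] by blast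
    have yq: "y ^ (?q ^ i) = pc * (- (a + b))"
    proof -
      have "- (y ^ (?q ^ i)) = pc * (a + b)" using ab(3) by (simp add: distrib_left)
      from arg_cong[OF this, of uminus] show ?thesis by (simp only: minus_minus mult_minus_right)
    qed
    have "y * z \<noteq> 1" if z: "z \<in> integer_ring L" for z
    proof
      assume "y * z = 1"
      have zV: "z \<in> V" by (rule dominating_integral[OF V]) (use z in \<open>simp add: integer_ring_iff\<close>)
      have "y ^ (?q ^ i) * z ^ (?q ^ i) = (y * z) ^ (?q ^ i)" by (rule power_mult_distrib[symmetric])
      then have "pc * (- (a + b) * z ^ (?q ^ i)) = 1" using \<open>y * z = 1\<close> unfolding yq by (simp only: mult.assoc power_one)
      moreover have "- (a + b) * z ^ (?q ^ i) \<in> V" by (intro VI ab zV)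
      ultimately show False using pc_not_unit[OF V] by blast
    qed
    then have "y \<in> maximal_ideal L" using yint unfolding maximal_ideal_def by blast
    then obtain y' where "y' \<in> integer_ring L" "y = pc * y'"
      using L unfolding unramified_extension_def unramified_def by blast
    then show ?thesis unfolding y_def w_def by blast
  qed
  then show ?thesis using n(1) by blast
qed

text \<open>Iterating x = x^q + p y, with y again in \<open>integer_ring L\<close>, gives a
  Teichmueller expansion to any depth \<open>j\<close>; the choice q = p^(n m) makes every digit a
  representative of precision m.\<close>

lemma integer_ring_subset_nr_integers:
  fixes x :: "'p padic_closure"
  assumes L: "unramified_extension L" and x: "x \<in> integer_ring L"
  shows "x \<in> nr_integers V"
proof -
  note VI = dominating_intros[OF V]
  note W = witt_subring[OF V]
  have intV: "z \<in> V" if "z \<in> integer_ring L" for z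
    using that dominating_integral[OF V] by (simp add: integer_ring_iff)
  have "\<forall>x\<in>integer_ring L. \<exists>S\<in>witt V m. \<exists>v\<in>V. x - S = pc ^ j * v" for m j
  proof (induction j)
    case 0
    show ?case
    proof
      fix x assume "x \<in> integer_ring L"
      then show "\<exists>S\<in>witt V m. \<exists>v\<in>V. x - S = pc ^ 0 * v"
        by (intro bexI[of _ 0] bexI[of _ x] intV subring_0[OF W]) simp_all
    qed
  next
    case (Suc j)
    show ?case
    proof
      fix x assume x: "x \<in> integer_ring L"
      obtain n where n: "n \<ge> 1" "\<And>N. \<exists>y\<in>integer_ring L. x - x ^ (CARD('p) ^ (n * N)) = pc * y"
        using unramified_frobenius[OF L x] by blast
      obtain y1 where y1: "y1 \<in> integer_ring L" "x - x ^ (CARD('p) ^ (n * 1)) = pc * y1" using n(2) by blast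
      have "x ^ (CARD('p) ^ n) - x = - (x - x ^ (CARD('p) ^ (n * 1)))" by simp
      also have "\<dots> = pc * - y1" unfolding y1(2) by simp
      finally have "x ^ (CARD('p) ^ n) - x = pc * - y1" .
      then have t: "x ^ (CARD('p) ^ (n * m)) \<in> teichmueller V m"
        by (intro teichmueller_power[OF V intV[OF x] n(1)]) (rule bexI, assumption, intro VI intV y1)
      obtain y where y: "y \<in> integer_ring L" "x - x ^ (CARD('p) ^ (n * m)) = pc * y" using n(2) by blast
      obtain S v where S: "S \<in> witt V m" "v \<in> V" "y - S = pc ^ j * v" using Suc y(1) by blast
      have "x - (x ^ (CARD('p) ^ (n * m)) + pc * S) = pc * y - pc * S" unfolding y(2)[symmetric] by simp
      also have "\<dots> = pc * (y - S)" by (simp only: right_diff_distrib)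
      also have "\<dots> = pc ^ Suc j * v" unfolding S(3) by simp
      finally show "\<exists>S\<in>witt V m. \<exists>v\<in>V. x - S = pc ^ Suc j * v"
        by (intro bexI[of _ "x ^ (CARD('p) ^ (n * m)) + pc * S"] bexI[of _ v] subring_intros[OF W] witt.gen[OF V t] S)
    qed
  qed
  then show ?thesis unfolding nr_integers_def[OF V] using x intV by blast
qed

text \<open>\<open>nr_integers V\<close> with p inverted: the common home for coordinates that come
  from different extensions.\<close>

definition nr_field :: "'p padic_closure set" where
  "nr_field = {x. \<exists>k. pc ^ k * x \<in> nr_integers V}"

lemma nr_integers_pc: "pc ^ k * x \<in> nr_integers V" if "x \<in> nr_integers V"
  using that by (intro subring_intros[OF nr_integers_subring[OF V]])

lemma padic_nr_subset: "padic_nr \<subseteq> nr_field"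
proof
  fix x :: "'p padic_closure" assume "x \<in> padic_nr"
  then obtain L where L: "unramified_extension L" "x \<in> L" unfolding padic_nr_def unramified_extension_def by blast
  obtain k where k: "padic_integral (pc ^ k * x)" using padic_clear_denominators by blast
  have "pc ^ k * x \<in> L"
    using coeff_extensionD(3)[OF unramified_extension_coeff_extension[OF L(1)] coeff_extensionD(1)[OF unramified_extension_coeff_extension[OF L(1)]] L(2), of "pp ^ k"]
    by simp
  then have "pc ^ k * x \<in> nr_integers V"
    using k by (intro integer_ring_subset_nr_integers[OF L(1)]) (simp add: integer_ring_iff)
  then show "x \<in> nr_field" unfolding nr_field_def by blast
qed

lemma nr_field_coeff_extension: "coeff_extension nr_field"
proof -
  note NI = subring_intros[OF nr_integers_subring[OF V]]
  have Zp: "of_padic_int a \<in> nr_integers V" for a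
  proof -
    obtain L :: "'p padic_closure set" where L: "unramified_extension L" using unramified_extension_of_padic_int by blast
    have "of_padic_int a \<in> integer_ring L"
      using coeff_extensionD(1)[OF unramified_extension_coeff_extension[OF L]] padic_integral_of_padic_int
      by (simp add: integer_ring_iff)
    then show ?thesis by (rule integer_ring_subset_nr_integers[OF L])
  qed
  have sub: "nr_integers V \<subseteq> nr_field"
    unfolding nr_field_def by (intro subsetI CollectI exI[of _ 0]) simp
  have "is_subring nr_field"
  proof (rule is_subringI)
    show "1 \<in> nr_field" using sub NI(1) by blast
    fix x y assume "x \<in> nr_field" "y \<in> nr_field"
    then obtain k l where kl: "pc ^ k * x \<in> nr_integers V" "pc ^ l * y \<in> nr_integers V" unfolding nr_field_def by blast
    have "pc ^ (k + l) * (x - y) = pc ^ l * (pc ^ k * x) - pc ^ k * (pc ^ l * y)"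
      by (simp add: power_add algebra_simps)
    also have "\<dots> \<in> nr_integers V" by (intro NI kl)
    finally show "x - y \<in> nr_field" unfolding nr_field_def by blast
    have "pc ^ (k + l) * (x * y) = (pc ^ k * x) * (pc ^ l * y)"
      by (simp add: power_add algebra_simps)
    also have "\<dots> \<in> nr_integers V" by (intro NI kl)
    finally show "x * y \<in> nr_field" unfolding nr_field_def by blast
  qed
  then show ?thesis unfolding coeff_extension_def using Zp sub by blast
qed

text \<open>Some p^k / x is integral, hence in \<open>V\<close>; if p^(k+1) divided \<open>x\<close>
  in \<open>V\<close>, then p would be a unit.\<close>

lemma dominating_separated:
  fixes x :: "'p padic_closure"
  assumes "x \<noteq> 0"
  shows "\<exists>N. \<forall>v\<in>V. x \<noteq> pc ^ N * v"
proof -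
  obtain k where k: "padic_integral (pc ^ k * inverse x)" using padic_clear_denominators by blast
  have kV: "pc ^ k * inverse x \<in> V" by (rule dominating_integral[OF V k])
  have "x \<noteq> pc ^ Suc k * v" if "v \<in> V" for v
  proof
    assume "x = pc ^ Suc k * v"
    then have "pc ^ k * (pc * (inverse x * pc ^ k * v)) = pc ^ k * (inverse x * x)" by (simp add: mult_ac)
    then have "pc * (inverse x * pc ^ k * v) = inverse x * x" by simp
    then have "pc * (pc ^ k * inverse x * v) = 1" using assms by (simp add: mult_ac)
    then show False using pc_not_unit[OF V subring_mult[OF dominating_subring[OF V] kV that]] by simp
  qed
  then show ?thesis by blast
qed

lemma nonunit_dominating: "nonunit V x \<longleftrightarrow> x = 0 \<or> inverse x \<notin> V"
  by (rule nonunit_def[OF V])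

lemma unit_cube_eq:
  fixes x :: "'p padic_closure"
  assumes "\<not> pp dvd d" "x \<in> V" "r \<in> V" "of_padic_int d * x ^ 3 + pc * r = 0"
  shows "nonunit V x"
proof (rule ccontr)
  assume "\<not> nonunit V x"
  then have x: "x \<noteq> 0" "inverse x \<in> V" by (auto simp: nonunit_dominating)
  obtain e where e: "d * e = 1" using padic_unit_inverse[OF assms(1)] by blast
  have "of_padic_int d * of_padic_int e = 1" using e by (metis of_padic_int_1 of_padic_int_mult)
  then have "1 = of_padic_int e * (of_padic_int d * x ^ 3) * inverse x ^ 3"
    using x(1) by (simp add: field_simps)
  also have "of_padic_int d * x ^ 3 = - (pc * r)" using assms(4) by (simp add: eq_neg_iff_add_eq_0)
  also have "of_padic_int e * (- (pc * r)) * inverse x ^ 3 = pc * (- of_padic_int e * r * inverse x ^ 3)" by (simp add: mult_ac)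
  finally have "pc * (- of_padic_int e * r * inverse x ^ 3) = 1" by simp
  moreover have "- of_padic_int e * r * inverse x ^ 3 \<in> V"
    by (intro dominating_intros[OF V] dominating_of_padic_int[OF V] assms x)
  ultimately show False using pc_not_unit[OF V] by blast
qed

end

section \<open>Reduction of insoluble forms\<close>

text \<open>
  The terminal states of the reduction algorithm: \<open>v(c\<^sub>0) = 0\<close>, \<open>v(c\<^sub>1) = 1\<close>, \<open>v(c\<^sub>2) = 2\<close>, and the other coefficients
  are so divisible that no two terms of minimal valuation can cancel at a point with integer valuations.
\<close>

definition terminal_cubic :: "'p::prime_card padic_int ^ 10 \<Rightarrow> bool" where
  "terminal_cubic c \<longleftrightarrow> \<not> pp dvd c $ 0 \<and> pp dvd c $ 1 \<and> \<not> pp ^ 2 dvd c $ 1 \<and> pp ^ 2 dvd c $ 2 \<and> \<not> pp ^ 3 dvd c $ 2 \<and>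
     pp dvd c $ 3 \<and> pp dvd c $ 4 \<and> pp dvd c $ 5 \<and> pp ^ 2 dvd c $ 6 \<and> pp ^ 2 dvd c $ 7 \<and> pp ^ 2 dvd c $ 8 \<and> pp dvd c $ 9"

text \<open>The three cubes take turns as leading term: the equation makes \<open>x\<close> a
  non-unit, after division by p it does the same for \<open>y\<close>, and after another division
  for \<open>z\<close>. It is \<open>nr_integers_cases\<close> that turns non-units into multiples
  of p.\<close>

lemma terminal_cubic_descent:
  fixes V :: "'p::prime_card padic_closure set"
  assumes V: "dominating_ring V" and c: "terminal_cubic c"
    and xyz: "x \<in> nr_integers V" "y \<in> nr_integers V" "z \<in> nr_integers V" "closure_form c x y z = 0"
  shows "\<exists>x'\<in>nr_integers V. \<exists>y'\<in>nr_integers V. \<exists>z'\<in>nr_integers V. x = pc * x' \<and> y = pc * y' \<and> z = pc * z' \<and> closure_form c x' y' z' = 0"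
proof -
  note VI = dominating_intros[OF V] dominating_of_padic_int[OF V] dominating_pc[OF V] nr_integers_subset[OF V]
  have dv: "pp dvd c $ 1" "pp ^ 2 dvd c $ 2" "pp dvd c $ 3" "pp dvd c $ 4" "pp dvd c $ 5" "pp ^ 2 dvd c $ 6"
    "pp ^ 2 dvd c $ 7" "pp ^ 2 dvd c $ 8" "pp dvd c $ 9"
    using c by (simp_all add: terminal_cubic_def)
  obtain d1 where d1: "c $ 1 = pp * d1" using dv(1) by (rule dvdE)
  obtain d2 where d2: "c $ 2 = pp ^ 2 * d2" using dv(2) by (rule dvdE)
  obtain d3 where d3: "c $ 3 = pp * d3" using dv(3) by (rule dvdE)
  obtain d4 where d4: "c $ 4 = pp * d4" using dv(4) by (rule dvdE)
  obtain d5 where d5: "c $ 5 = pp * d5" using dv(5) by (rule dvdE)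
  obtain d6 where d6: "c $ 6 = pp ^ 2 * d6" using dv(6) by (rule dvdE)
  obtain d7 where d7: "c $ 7 = pp ^ 2 * d7" using dv(7) by (rule dvdE)
  obtain d8 where d8: "c $ 8 = pp ^ 2 * d8" using dv(8) by (rule dvdE)
  obtain d9 where d9: "c $ 9 = pp * d9" using dv(9) by (rule dvdE)
  note d = d1 d2 d3 d4 d5 d6 d7 d8 d9
  have u1: "\<not> pp dvd d1" and u2: "\<not> pp dvd d2" and u0: "\<not> pp dvd c $ 0"
    using c unfolding terminal_cubic_def d by (auto simp: power2_eq_square power3_eq_cube pp_nonzero)
  let ?o = "of_padic_int :: 'p padic_int \<Rightarrow> _"
  have form: "closure_form c x y z = ?o (c $ 0) * x ^ 3 + pc * ?o d1 * y ^ 3 + pc ^ 2 * ?o d2 * z ^ 3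
     + pc * ?o d3 * x ^ 2 * y + pc * ?o d4 * x ^ 2 * z + pc * ?o d5 * y ^ 2 * x
     + pc ^ 2 * ?o d6 * y ^ 2 * z + pc ^ 2 * ?o d7 * z ^ 2 * x + pc ^ 2 * ?o d8 * z ^ 2 * y
     + pc * ?o d9 * x * y * z" for x y z
    unfolding closure_form_def ternary_cubic_def by (simp add: d)
  have "?o (c $ 0) * x ^ 3 + pc * (?o d1 * y ^ 3 + pc * ?o d2 * z ^ 3
     + ?o d3 * x ^ 2 * y + ?o d4 * x ^ 2 * z + ?o d5 * y ^ 2 * x
     + pc * ?o d6 * y ^ 2 * z + pc * ?o d7 * z ^ 2 * x + pc * ?o d8 * z ^ 2 * y
     + ?o d9 * x * y * z) = closure_form c x y z"
    unfolding form by (simp add: power2_eq_square algebra_simps)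
  then have "nonunit V x"
    unfolding xyz(4) by (rule unit_cube_eq[OF V u0, rotated 2]) (intro VI xyz)+
  then obtain x' where x': "x' \<in> nr_integers V" "x = pc * x'" using nr_integers_cases[OF V xyz(1)] by blast
  have "pc * (?o d1 * y ^ 3 + pc * (pc * ?o (c $ 0) * x' ^ 3 + ?o d2 * z ^ 3
     + pc * ?o d3 * x' ^ 2 * y + pc * ?o d4 * x' ^ 2 * z + ?o d5 * y ^ 2 * x'
     + ?o d6 * y ^ 2 * z + pc * ?o d7 * z ^ 2 * x' + ?o d8 * z ^ 2 * y
     + ?o d9 * x' * y * z)) = closure_form c x y z"
    unfolding form x'(2) by (simp add: power2_eq_square power3_eq_cube algebra_simps)
  then have "?o d1 * y ^ 3 + pc * (pc * ?o (c $ 0) * x' ^ 3 + ?o d2 * z ^ 3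
     + pc * ?o d3 * x' ^ 2 * y + pc * ?o d4 * x' ^ 2 * z + ?o d5 * y ^ 2 * x'
     + ?o d6 * y ^ 2 * z + pc * ?o d7 * z ^ 2 * x' + ?o d8 * z ^ 2 * y
     + ?o d9 * x' * y * z) = 0"
    unfolding xyz(4) by (simp only: mult_eq_0_iff of_nat_closure_nonzero simp_thms)
  then have "nonunit V y"
    by (rule unit_cube_eq[OF V u1, rotated 2]) (intro VI xyz x')+
  then obtain y' where y': "y' \<in> nr_integers V" "y = pc * y'" using nr_integers_cases[OF V xyz(2)] by blast
  have "pc ^ 2 * (?o d2 * z ^ 3 + pc * (?o (c $ 0) * x' ^ 3 + pc * ?o d1 * y' ^ 3
     + pc * ?o d3 * x' ^ 2 * y' + ?o d4 * x' ^ 2 * z + pc * ?o d5 * y' ^ 2 * x'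
     + pc * ?o d6 * y' ^ 2 * z + ?o d7 * z ^ 2 * x' + ?o d8 * z ^ 2 * y'
     + ?o d9 * x' * y' * z)) = closure_form c x y z"
    unfolding form x'(2) y'(2) by (simp add: power2_eq_square power3_eq_cube algebra_simps)
  then have "?o d2 * z ^ 3 + pc * (?o (c $ 0) * x' ^ 3 + pc * ?o d1 * y' ^ 3
     + pc * ?o d3 * x' ^ 2 * y' + ?o d4 * x' ^ 2 * z + pc * ?o d5 * y' ^ 2 * x'
     + pc * ?o d6 * y' ^ 2 * z + ?o d7 * z ^ 2 * x' + ?o d8 * z ^ 2 * y'
     + ?o d9 * x' * y' * z) = 0"
    unfolding xyz(4) by (simp only: mult_eq_0_iff of_nat_closure_nonzero power_eq_0_iff simp_thms)
  then have "nonunit V z"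
    by (rule unit_cube_eq[OF V u2, rotated 2]) (intro VI xyz x' y')+
  then obtain z' where z': "z' \<in> nr_integers V" "z = pc * z'" using nr_integers_cases[OF V xyz(3)] by blast
  have "pc ^ 3 * closure_form c x' y' z' = 0"
    using xyz(4) unfolding x'(2) y'(2) z'(2) closure_form_def ternary_cubic_homogeneous .
  then have "closure_form c x' y' z' = 0" by simp
  then show ?thesis using x' y' z' by blast
qed

text \<open>Infinite descent: the coordinates of a zero would be divisible by all powers of p,
  against \<open>dominating_separated\<close>.\<close>

lemma terminal_cubic_insoluble:
  fixes V :: "'p::prime_card padic_closure set"
  assumes V: "dominating_ring V" and c: "terminal_cubic c"
  shows "\<not> has_zero (nr_field V) c"
proof
  assume "has_zero (nr_field V) c"
  then obtain x y z where xyz: "x \<in> nr_field V" "y \<in> nr_field V" "z \<in> nr_field V" "(x, y, z) \<noteq> (0, 0, 0)" "closure_form c x y z = 0"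
    unfolding has_zero_def by blast
  obtain i j k where ijk: "pc ^ i * x \<in> nr_integers V" "pc ^ j * y \<in> nr_integers V" "pc ^ k * z \<in> nr_integers V"
    using xyz(1-3) unfolding nr_field_def[OF V] by blast
  let ?r = "pc ^ (i + j + k) :: 'p padic_closure"
  have r: "?r * x \<in> nr_integers V" "?r * y \<in> nr_integers V" "?r * z \<in> nr_integers V"
    using nr_integers_pc[OF V ijk(1), of "j + k"] nr_integers_pc[OF V ijk(2), of "i + k"] nr_integers_pc[OF V ijk(3), of "i + j"]
    by (simp_all add: power_add mult_ac)
  have zero: "closure_form c (?r * x) (?r * y) (?r * z) = 0"
    using xyz(5) unfolding closure_form_def ternary_cubic_homogeneous by simp
  have div: "\<exists>a\<in>nr_integers V. \<exists>b\<in>nr_integers V. \<exists>e\<in>nr_integers V. ?r * x = pc ^ N * a \<and> ?r * y = pc ^ N * b \<and> ?r * z = pc ^ N * e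
      \<and> closure_form c a b e = 0" for N
  proof (induction N)
    case 0
    show ?case using r zero by (intro bexI[of _ "?r * x"] bexI[of _ "?r * y"] bexI[of _ "?r * z"]) simp_all
  next
    case (Suc N)
    then obtain a b e where abe: "a \<in> nr_integers V" "b \<in> nr_integers V" "e \<in> nr_integers V"
      "?r * x = pc ^ N * a" "?r * y = pc ^ N * b" "?r * z = pc ^ N * e" "closure_form c a b e = 0" by blast
    obtain a' b' e' where abe': "a' \<in> nr_integers V" "b' \<in> nr_integers V" "e' \<in> nr_integers V"
      "a = pc * a'" "b = pc * b'" "e = pc * e'" "closure_form c a' b' e' = 0"
      using terminal_cubic_descent[OF V c abe(1-3,7)] by blast
    show ?case
      using abe abe' by (intro bexI[of _ a'] bexI[of _ b'] bexI[of _ e']) (simp_all add: mult_ac)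
  qed
  have "w = 0" if w: "\<And>N. \<exists>a\<in>nr_integers V. ?r * w = pc ^ N * a" for w
  proof (rule ccontr)
    assume "w \<noteq> 0"
    then have "?r * w \<noteq> 0" by simp
    then obtain N where N: "\<And>v. v \<in> V \<Longrightarrow> ?r * w \<noteq> pc ^ N * v" using dominating_separated[OF V] by blast
    obtain a where "a \<in> nr_integers V" "?r * w = pc ^ N * a" using w by blast
    then show False using N nr_integers_subset[OF V] by blast
  qed
  note null = this
  have "x = 0" by (rule null) (use div in blast)
  moreover have "y = 0" by (rule null) (use div in blast)
  moreover have "z = 0" by (rule null) (use div in blast)
  ultimately show False using xyz(4) by simp
qed

text \<open>Being terminal depends only on the coefficients modulo p^3, which gives the radius of
  the ball.\<close>

lemma terminal_cubic_stably_insoluble: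
  fixes V :: "'p::prime_card padic_closure set"
  assumes V: "dominating_ring V" and c: "terminal_cubic c"
  shows "stably_insoluble (nr_field V) c"
proof -
  have "terminal_cubic (c + pp ^ 3 *s e)" for e :: "'p padic_int ^ 10"
  proof -
    have "pp dvd (pp ^ 3 :: 'p padic_int) * a" "pp ^ 2 dvd (pp ^ 3 :: 'p padic_int) * a" "pp ^ 3 dvd (pp ^ 3 :: 'p padic_int) * a" for a
      using le_imp_power_dvd[of 1 3 "pp :: 'p padic_int"] le_imp_power_dvd[of 2 3 "pp :: 'p padic_int"] by (simp_all add: dvd_mult2)
    then show ?thesis using c by (simp add: terminal_cubic_def dvd_add_left_iff)
  qed
  then show ?thesis unfolding stably_insoluble_def using terminal_cubic_insoluble[OF V] by blast
qed

subsection \<open>Bounding the number of divisions\<close>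

definition form_at :: "'a::comm_ring_1 ^ 10 \<Rightarrow> 'a ^ 3 \<Rightarrow> 'a" where
  "form_at c v = ternary_cubic c (v $ 1) (v $ 2) (v $ 3)"

lemma pp_power_dvd_ternary_cubic_diff:
  fixes c :: "'p::prime_card padic_int ^ 10"
  assumes "pp ^ n dvd x - x'" "pp ^ n dvd y - y'" "pp ^ n dvd z - z'"
  shows "pp ^ n dvd ternary_cubic c x y z - ternary_cubic c x' y' z'"
proof -
  let ?E = "\<lambda>a b :: 'p padic_int. pp ^ n dvd a - b"
  have add: "?E (a + a') (b + b')" if "?E a b" "?E a' b'" for a b a' b'
    using dvd_add[OF that] by (simp add: algebra_simps)
  have mult: "?E (a * a') (b * b')" if "?E a b" "?E a' b'" for a b a' b'
  proof -
    have "a * a' - b * b' = (a - b) * a' + b * (a' - b')" by (simp add: algebra_simps)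
    then show ?thesis using that by (simp only:) (intro dvd_add dvd_mult dvd_mult2)
  qed
  have refl: "?E a a" for a by simp
  have power: "?E (a ^ k) (b ^ k)" if "?E a b" for a b k
    by (induction k) (simp_all add: mult[OF that])
  show ?thesis
    unfolding ternary_cubic_def by (intro add mult power refl assms)
qed

text \<open>Compactness: primitive vectors whose values are divisible by ever higher powers of p
  would accumulate at a primitive zero.\<close>

lemma primitive_values_bounded:
  fixes c :: "'p::prime_card padic_int ^ 10"
  assumes no_zero: "\<And>v. form_at c v = 0 \<Longrightarrow> v = 0"
  shows "\<exists>K. \<forall>v. (\<exists>i. \<not> pp dvd v $ i) \<longrightarrow> \<not> pp ^ K dvd form_at c v"
proof (rule ccontr)
  assume "\<not> ?thesis"
  then have "\<forall>K. \<exists>v. (\<exists>i. \<not> pp dvd v $ i) \<and> pp ^ K dvd form_at c v" by simp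
  from choice[OF this] obtain v where v: "\<And>K. \<exists>i. \<not> pp dvd v K $ i" "\<And>K. pp ^ K dvd form_at c (v K)" by blast
  obtain w where w: "\<And>n. \<exists>m\<ge>n. \<forall>i. pp ^ n dvd v m $ i - w $ i" using padic_limit_point[of v] by blast
  have "pp ^ n dvd form_at c w" for n
  proof -
    obtain m where m: "m \<ge> n" "\<And>i. pp ^ n dvd v m $ i - w $ i" using w by blast
    have "pp ^ n dvd form_at c (v m)" by (rule pp_power_dvd_mono[OF v(2) m(1)])
    moreover have "pp ^ n dvd form_at c (v m) - form_at c w"
      unfolding form_at_def by (intro pp_power_dvd_ternary_cubic_diff m)
    from dvd_diff[OF calculation this] show ?thesis by simp
  qed
  then have "form_at c w = 0" using padic_eq_0_iff by blast
  then have "w = 0" by (rule no_zero)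
  moreover obtain m where "\<And>i. pp ^ 1 dvd v m $ i - w $ i" using w[of 1] by blast
  ultimately show False using v(1)[of m] by simp
qed

text \<open>
  A division by \<open>p\<^sup>k\<close> after a substitution of determinant \<open>p\<^sup>m\<close> is a gain of \<open>k - m\<close>. The total gain
  is bounded for a form without zeros over \<open>\<int>\<^sub>p\<close>, and this is what makes the reduction terminate.
\<close>

definition gain_bounded :: "'p::prime_card padic_int ^ 10 \<Rightarrow> nat \<Rightarrow> bool" where
  "gain_bounded c D \<longleftrightarrow> (\<forall>(G :: 'p padic_int ^ 3 ^ 3) k m c'.
     (\<forall>v. pp ^ k * form_at c' v = form_at c (G *v v)) \<longrightarrow> det G dvd pp ^ m \<longrightarrow> k \<le> m + D)"

lemma gain_boundedD:
  "gain_bounded c D \<Longrightarrow> (\<And>v. pp ^ k * form_at c' v = form_at c (G *v v)) \<Longrightarrow> det G dvd pp ^ m \<Longrightarrow> k \<le> m + D"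
  unfolding gain_bounded_def by blast

lemma pp_power_dvd_power: "(pp :: 'p::prime_card padic_int) ^ a dvd pp ^ b \<longleftrightarrow> a \<le> b"
proof
  assume *: "(pp :: 'p padic_int) ^ a dvd pp ^ b"
  show "a \<le> b"
  proof (rule ccontr)
    assume "\<not> a \<le> b"
    then obtain d where d: "a = b + Suc d" using less_imp_Suc_add[of b a] by auto
    have "pp ^ b * (pp * pp ^ d) dvd (pp ^ b * 1 :: 'p padic_int)" using * by (simp add: d power_add)
    moreover have "(pp :: 'p padic_int) ^ b \<noteq> 0" using pp_nonzero[where 'p='p] by simp
    ultimately have "pp * pp ^ d dvd (1 :: 'p padic_int)" by (simp only: dvd_mult_cancel_left simp_thms)
    then have "pp dvd (1 :: 'p padic_int)" by (rule dvd_mult_left)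
    then show False using pp_not_unit[where 'p='p] by contradiction
  qed
qed (rule le_imp_power_dvd)

text \<open>Let p^j be the largest power dividing all entries of \<open>G\<close>; the determinant
  gives 3j \<le> m. Some column is p^j times a primitive vector u, so p^k divides p^(3j) C(u), and
  the valuation of C(u) is bounded.\<close>

lemma exists_gain_bound:
  fixes c :: "'p::prime_card padic_int ^ 10"
  assumes no_zero: "\<And>v. form_at c v = 0 \<Longrightarrow> v = 0"
  shows "\<exists>D. gain_bounded c D"
proof -
  obtain K where K: "\<And>v. \<exists>i. \<not> pp dvd v $ i \<Longrightarrow> \<not> pp ^ K dvd form_at c v"
    using primitive_values_bounded[OF no_zero] by blast
  have "k \<le> m + K" if G: "\<And>v. pp ^ k * form_at c' v = form_at c (G *v v)" "det G dvd pp ^ m"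
    for G :: "'p padic_int ^ 3 ^ 3" and k m c'
  proof (rule ccontr)
    assume k: "\<not> k \<le> m + K"
    have "det G \<noteq> 0" using G(2) pp_nonzero[where 'p='p] by auto
    define Q where "Q = (\<lambda>j. \<forall>a b. pp ^ j dvd G $ a $ b)"
    have detQ: "3 * j \<le> m" if j: "Q j" for j
    proof -
      have "\<forall>a b. \<exists>g. G $ a $ b = pp ^ j * g" using j by (simp add: Q_def dvd_def)
      then obtain g where g: "\<And>a b. G $ a $ b = pp ^ j * g a b" by metis
      have "pp ^ (3 * j) dvd det G"
        unfolding Determinants.det_3 g power_mult power3_eq_cube
        by (intro dvd_add dvd_diff) (simp_all add: power_mult power3_eq_cube power_mult_distrib mult.commute[of 3] mult_ac)
      then show ?thesis using G(2) dvd_trans pp_power_dvd_power by blast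
    qed
    have Q0: "Q 0" by (simp add: Q_def)
    define j where "j = Greatest Q"
    have bnd: "j \<le> m" if "Q j" for j using detQ[OF that] by simp
    have Qj: "Q j" unfolding j_def by (rule GreatestI_nat[where P = Q and k = 0 and b = m]) (use Q0 bnd in auto)
    have "\<not> Q (Suc j)"
    proof
      assume "Q (Suc j)"
      then have "Suc j \<le> j" unfolding j_def by (rule Greatest_le_nat[where P = Q and b = m]) (use bnd in auto)
      then show False by simp
    qed
    then obtain a b where ab: "\<not> pp ^ Suc j dvd G $ a $ b" by (auto simp: Q_def)
    have "\<forall>a b. \<exists>g. G $ a $ b = pp ^ j * g" using Qj by (simp add: Q_def dvd_def)
    then obtain g where g: "\<And>a b. G $ a $ b = pp ^ j * g a b" by metis
    define u :: "'p padic_int ^ 3" where "u = (\<chi> i. g i b)"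
    have "\<not> pp dvd u $ a"
    proof
      assume "pp dvd u $ a"
      then have "pp ^ j * pp dvd pp ^ j * g a b" by (simp add: u_def)
      then show False using ab by (simp add: g mult.commute)
    qed
    then have nu: "\<not> pp ^ K dvd form_at c u" using K by blast
    have "(G *v axis b 1) $ i = pp ^ j * u $ i" for i
      unfolding matrix_vector_mult_def axis_def by (simp add: u_def g if_distrib[of "\<lambda>x. _ * x"] cong: if_cong)
    then have "form_at c (G *v axis b 1) = (pp ^ j) ^ 3 * form_at c u"
      unfolding form_at_def by (simp only: ternary_cubic_homogeneous)
    then have eq: "pp ^ k * form_at c' (axis b 1) = pp ^ (3 * j) * form_at c u"
      using G(1)[of "axis b 1"] by (simp add: mult.commute flip: power_mult)
    have "3 * j \<le> m" by (rule detQ[OF Qj])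
    then obtain r where r: "k = 3 * j + (K + r)" using k by (metis add.assoc add.commute le_Suc_ex nat_le_linear trans_le_add1 add_le_mono1 order_trans)
    have "pp ^ (3 * j) * (pp ^ (K + r) * form_at c' (axis b 1)) = pp ^ (3 * j) * form_at c u"
      using eq by (simp add: r power_add mult_ac)
    then have "form_at c u = pp ^ (K + r) * form_at c' (axis b 1)" using pp_nonzero[where 'p='p] by simp
    then have "pp ^ K dvd form_at c u" by (simp add: power_add)
    then show False using nu by blast
  qed
  then show ?thesis unfolding gain_bounded_def by blast
qed

text \<open>Under composition the divisions and the determinants add up. \<open>m \<le> k\<close>
  makes the truncated subtraction exact.\<close>

lemma gain_bounded_move:
  fixes c :: "'p::prime_card padic_int ^ 10"
  assumes c: "gain_bounded c D" and M: "\<And>v. pp ^ k * form_at c' v = form_at c (M *v v)" "det M dvd pp ^ m" "m \<le> k"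
  shows "k - m \<le> D" "gain_bounded c' (D - (k - m))"
proof -
  have kD: "k \<le> m + D" by (rule gain_boundedD[OF c M(1,2)])
  then show "k - m \<le> D" by simp
  have "k2 \<le> m2 + (D - (k - m))" if G: "\<And>v. pp ^ k2 * form_at c2 v = form_at c' (G *v v)" "det G dvd pp ^ m2" for G k2 m2 c2
  proof -
    have "pp ^ (k + k2) * form_at c2 v = form_at c ((M ** G) *v v)" for v
      unfolding matrix_vector_mul_assoc[symmetric] M(1)[symmetric] G(1)[symmetric] by (simp add: power_add mult_ac)
    moreover have "det (M ** G) dvd pp ^ (m + m2)"
      unfolding Determinants.det_mul power_add by (intro mult_dvd_mono M G)
    ultimately have "k + k2 \<le> m + m2 + D" by (rule gain_boundedD[OF c])
    then show ?thesis using kD M(3) by simp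
  qed
  then show "gain_bounded c' (D - (k - m))" unfolding gain_bounded_def by blast
qed

lemma gain_bounded_equiv:
  fixes c :: "'p::prime_card padic_int ^ 10"
  assumes c: "gain_bounded c D"
  shows "gain_bounded (shear s t c) D" "gain_bounded (swap_xy c) D" "gain_bounded (swap_xz c) D" "gain_bounded (swap_yz c) D"
proof -
  have *: "gain_bounded c' D" if "\<And>v. form_at c' v = form_at c (M *v v)" "det M dvd 1" for c' M
    using gain_bounded_move(2)[OF c, of 0 c' M 0] that by simp
  show "gain_bounded (shear s t c) D"
    by (rule *[of _ "vector [vector [1, s, t], vector [0, 1, 0], vector [0, 0, 1]]"])
      (simp_all add: form_at_def ternary_cubic_shear matrix_vector_mult_def sum_3 Determinants.det_3)
  show "gain_bounded (swap_xy c) D"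
    by (rule *[of _ "vector [vector [0, 1, 0], vector [1, 0, 0], vector [0, 0, 1]]"])
      (simp_all add: form_at_def ternary_cubic_swap matrix_vector_mult_def sum_3 Determinants.det_3)
  show "gain_bounded (swap_xz c) D"
    by (rule *[of _ "vector [vector [0, 0, 1], vector [0, 1, 0], vector [1, 0, 0]]"])
      (simp_all add: form_at_def ternary_cubic_swap matrix_vector_mult_def sum_3 Determinants.det_3)
  show "gain_bounded (swap_yz c) D"
    by (rule *[of _ "vector [vector [1, 0, 0], vector [0, 0, 1], vector [0, 1, 0]]"])
      (simp_all add: form_at_def ternary_cubic_swap matrix_vector_mult_def sum_3 Determinants.det_3)
qed

lemma gain_bounded_dilate:
  fixes c :: "'p::prime_card padic_int ^ 10"
  assumes c: "gain_bounded c D" and c': "pp ^ Suc (i + j) *s c' = dilate (pp ^ i) (pp ^ j) c"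
  shows "D > 0" "gain_bounded c' (D - 1)"
proof -
  let ?M = "vector [vector [pp ^ i, 0, 0], vector [0, pp ^ j, 0], vector [0, 0, 1]] :: 'p padic_int ^ 3 ^ 3"
  have 1: "pp ^ Suc (i + j) * form_at c' v = form_at c (?M *v v)" for v
    unfolding form_at_def ternary_cubic_scale[symmetric] c' ternary_cubic_dilate
    by (simp add: matrix_vector_mult_def sum_3)
  have 2: "det ?M dvd pp ^ (i + j)" by (simp add: Determinants.det_3 power_add)
  show "D > 0" "gain_bounded c' (D - 1)"
    using gain_bounded_move[OF c 1 2] by simp_all
qed

subsection \<open>Insoluble forms\<close>

text \<open>
  The zero is required to lie in a single finite extension, so that insolubility is a priori weaker than having
  no zero over \<^const>\<open>padic_nr\<close>.
\<close>

definition insoluble :: "'p::prime_card padic_int ^ 10 \<Rightarrow> bool" where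
  "insoluble c \<longleftrightarrow> (\<forall>L. unramified_extension L \<longrightarrow> \<not> has_zero L c)"

lemma insoluble_shear: "insoluble (shear s t c) \<longleftrightarrow> insoluble c"
  unfolding insoluble_def by (simp add: has_zero_shear unramified_extension_coeff_extension)

lemma insoluble_swap: "insoluble (swap_xy c) \<longleftrightarrow> insoluble c" "insoluble (swap_xz c) \<longleftrightarrow> insoluble c"
  "insoluble (swap_yz c) \<longleftrightarrow> insoluble c"
  unfolding insoluble_def by (simp_all add: has_zero_swap)

lemma insoluble_shear_yz: "insoluble (shear_yz t c) \<longleftrightarrow> insoluble c"
  by (simp add: shear_yz_def insoluble_swap insoluble_shear)

lemma insoluble_dilate:
  assumes "pp ^ k *s c' = dilate (pp ^ i) (pp ^ j) c"
  shows "insoluble c' \<longleftrightarrow> insoluble c"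
  unfolding insoluble_def using has_zero_dilate[OF unramified_extension_coeff_extension assms] by (simp add: pp_nonzero)

text \<open>By \<open>nz\<close> the parametrisation is injective, so a nontrivial zero of the
  binary form stays nontrivial. The factor p^k admits lines on which the form is divisible by
  p.\<close>

lemma insoluble_line:
  fixes c :: "'p::prime_card padic_int ^ 10"
  assumes c: "insoluble c"
    and eq: "\<And>s t. closure_form c (of_padic_int a1 * s + of_padic_int b1 * t) (of_padic_int a2 * s + of_padic_int b2 * t)
        (of_padic_int a3 * s + of_padic_int b3 * t) = pc ^ k * binary_form g0 g1 g2 g3 s t"
    and nz: "\<And>s t. (s, t) \<noteq> (0, 0) \<Longrightarrow> (of_padic_int a1 * s + of_padic_int b1 * t, of_padic_int a2 * s + of_padic_int b2 * t,
        of_padic_int a3 * s + of_padic_int b3 * t) \<noteq> (0, 0, 0)"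
  shows "cube_mod g0 g1 g2 g3"
proof (rule ccontr)
  assume "\<not> cube_mod g0 g1 g2 g3"
  then obtain L s t where L: "unramified_extension L" "s \<in> L" "t \<in> L" "(s, t) \<noteq> (0, 0)" "binary_form g0 g1 g2 g3 s t = 0"
    using binary_cubic_zero by blast
  note ce = coeff_extensionD[OF unramified_extension_coeff_extension[OF L(1)]]
  have "has_zero L c"
    by (rule has_zeroI[OF _ _ _ nz[OF L(4)]]) (simp_all add: eq L ce)
  then show False using c L(1) unfolding insoluble_def by blast
qed

text \<open>The lines Z = 0, Y = 0, X = 0 and Y = Z. The last one is there for the coefficient of
  XYZ, which the coordinate lines do not see.\<close>

lemma insoluble_lines:
  fixes c :: "'p::prime_card padic_int ^ 10"
  assumes c: "insoluble c"
  shows "cube_mod (c $ 0) (c $ 3) (c $ 5) (c $ 1)" "cube_mod (c $ 0) (c $ 4) (c $ 7) (c $ 2)"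
    "cube_mod (c $ 1) (c $ 6) (c $ 8) (c $ 2)"
    "cube_mod (c $ 0) (c $ 3 + c $ 4) (c $ 5 + c $ 7 + c $ 9) (c $ 1 + c $ 2 + c $ 6 + c $ 8)"
proof -
  show "cube_mod (c $ 0) (c $ 3) (c $ 5) (c $ 1)"
    by (rule insoluble_line[OF c, of 1 0 0 1 0 0 0])
      (auto simp: closure_form_def ternary_cubic_def binary_form_def mult_ac)
  show "cube_mod (c $ 0) (c $ 4) (c $ 7) (c $ 2)"
    by (rule insoluble_line[OF c, of 1 0 0 0 0 1 0])
      (auto simp: closure_form_def ternary_cubic_def binary_form_def mult_ac)
  show "cube_mod (c $ 1) (c $ 6) (c $ 8) (c $ 2)"
    by (rule insoluble_line[OF c, of 0 0 1 0 0 1 0])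
      (auto simp: closure_form_def ternary_cubic_def binary_form_def mult_ac)
  show "cube_mod (c $ 0) (c $ 3 + c $ 4) (c $ 5 + c $ 7 + c $ 9) (c $ 1 + c $ 2 + c $ 6 + c $ 8)"
    by (rule insoluble_line[OF c, of 1 0 0 1 0 1 0])
      (auto simp: closure_form_def ternary_cubic_def binary_form_def algebra_simps power2_eq_square power3_eq_cube)
qed

lemma insoluble_line_yz:
  fixes c :: "'p::prime_card padic_int ^ 10"
  assumes c: "insoluble c" "c $ 1 = pp * g0" "c $ 6 = pp * g1" "c $ 8 = pp * g2" "c $ 2 = pp * g3"
  shows "cube_mod g0 g1 g2 g3"
  by (rule insoluble_line[OF c(1), of 0 0 1 0 0 1 1])
    (auto simp: closure_form_def ternary_cubic_def binary_form_def c algebra_simps)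

text \<open>The restriction to (pX, 0, Z), divided by p^2. Its leading coefficient is a multiple of
  p, so \<open>cube_mod\<close> forces p to divide \<open>g2\<close>.\<close>

lemma insoluble_line_xz:
  fixes c :: "'p::prime_card padic_int ^ 10"
  assumes c: "insoluble c" "c $ 7 = pp * g2" "c $ 2 = pp ^ 2 * g3"
  shows "cube_mod (pp * c $ 0) (c $ 4) g2 g3"
  by (rule insoluble_line[OF c(1), of pp 0 0 0 0 1 2])
    (auto simp: closure_form_def ternary_cubic_def binary_form_def c algebra_simps power2_eq_square power3_eq_cube)

text \<open>
  \<open>S\<^sub>1\<close>: the form is congruent to \<open>c\<^sub>0 X\<^sup>3 \<noteq> 0\<close> modulo \<open>p\<close>. \<open>S\<^sub>2\<close>: moreover \<open>C(pX, Y, Z) / p\<close> is congruent to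
  \<open>(c\<^sub>1 / p) Y\<^sup>3 \<noteq> 0\<close>.
\<close>

definition cubic_S1 :: "'p::prime_card padic_int ^ 10 \<Rightarrow> bool" where
  "cubic_S1 c \<longleftrightarrow> \<not> pp dvd c $ 0 \<and> pp dvd c $ 1 \<and> pp dvd c $ 2 \<and> pp dvd c $ 3 \<and> pp dvd c $ 4 \<and> pp dvd c $ 5 \<and>
     pp dvd c $ 6 \<and> pp dvd c $ 7 \<and> pp dvd c $ 8 \<and> pp dvd c $ 9"

definition cubic_S2 :: "'p::prime_card padic_int ^ 10 \<Rightarrow> bool" where
  "cubic_S2 c \<longleftrightarrow> cubic_S1 c \<and> \<not> pp ^ 2 dvd c $ 1 \<and> pp ^ 2 dvd c $ 2 \<and> pp ^ 2 dvd c $ 6 \<and> pp ^ 2 dvd c $ 8"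

text \<open>The lines Z = 0 and Y = 0 supply the shifts that clear everything but X^3 from their
  restrictions modulo p. On X = 0 the coefficient of Y^3 is then divisible by p, hence so are those
  of the mixed terms.\<close>

lemma insoluble_reduce_S1:
  fixes c :: "'p::prime_card padic_int ^ 10"
  assumes c: "insoluble c" and c0: "\<not> pp dvd c $ 0"
  shows "\<exists>s<CARD('p). \<exists>t<CARD('p). cubic_S1 (shear (- of_nat s) (- of_nat t) c)"
proof -
  obtain s where s: "s < CARD('p)" "pp dvd c $ 3 - 3 * c $ 0 * of_nat s" "pp dvd c $ 5 - 3 * c $ 0 * of_nat s ^ 2"
      "pp dvd c $ 1 - c $ 0 * of_nat s ^ 3"
    using insoluble_lines(1)[OF c] c0 unfolding cube_mod_def by auto
  obtain t where t: "t < CARD('p)" "pp dvd c $ 4 - 3 * c $ 0 * of_nat t" "pp dvd c $ 7 - 3 * c $ 0 * of_nat t ^ 2"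
      "pp dvd c $ 2 - c $ 0 * of_nat t ^ 3"
    using insoluble_lines(2)[OF c] c0 unfolding cube_mod_def by auto
  define d where "d = shear (- of_nat s) (- of_nat t) c"
  have rs: "red (c $ 3) = 3 * red (c $ 0) * of_nat s" "red (c $ 5) = 3 * red (c $ 0) * of_nat s ^ 2"
      "red (c $ 1) = red (c $ 0) * of_nat s ^ 3"
    using s by (simp_all add: red_eq_0_iff[symmetric])
  have rt: "red (c $ 4) = 3 * red (c $ 0) * of_nat t" "red (c $ 7) = 3 * red (c $ 0) * of_nat t ^ 2"
      "red (c $ 2) = red (c $ 0) * of_nat t ^ 3"
    using t by (simp_all add: red_eq_0_iff[symmetric])
  have d0: "d $ 0 = c $ 0" by (simp add: d_def shear_def)
  have 1: "pp dvd d $ 1" "pp dvd d $ 2" "pp dvd d $ 3" "pp dvd d $ 4" "pp dvd d $ 5" "pp dvd d $ 7"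
    unfolding red_eq_0_iff[symmetric] d_def shear_def vec10_nth
    by (simp_all add: rs rt power2_eq_square power3_eq_cube algebra_simps)
  have d: "insoluble d" unfolding d_def insoluble_shear by (rule c)
  have 2: "pp dvd d $ 6" "pp dvd d $ 8"
    using insoluble_lines(3)[OF d] 1 by (simp_all add: cube_mod_def)
  \<comment> \<open>On Y = Z the cube satisfies 3 d0 k = 0 and d9 = 3 d0 k^2 modulo p. Nothing is
    divided by 3, so p = 3 is included.\<close>
  have 3: "pp dvd d $ 9"
  proof -
    obtain k where k: "pp dvd d $ 3 + d $ 4 - 3 * d $ 0 * of_nat k" "pp dvd d $ 5 + d $ 7 + d $ 9 - 3 * d $ 0 * of_nat k ^ 2"
      using insoluble_lines(4)[OF d] c0 unfolding cube_mod_def d0 by auto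
    have r0: "red (d $ 3) = 0" "red (d $ 4) = 0" "red (d $ 5) = 0" "red (d $ 7) = 0"
      using 1 by (simp_all add: red_eq_0_iff)
    have "3 * red (d $ 0) * of_nat k = 0" using k(1) by (simp add: red_eq_0_iff[symmetric] r0)
    moreover have "red (d $ 9) = (3 * red (d $ 0) * of_nat k) * of_nat k"
      using k(2) by (simp add: red_eq_0_iff[symmetric] r0 power2_eq_square)
    ultimately have "red (d $ 9) = 0" by (simp only: mult_zero_left)
    then show ?thesis by (simp add: red_eq_0_iff)
  qed
  have "cubic_S1 d" unfolding cubic_S1_def d0 using c0 1 2 3 by blast
  then show ?thesis unfolding d_def using s(1) t(1) by blast
qed

lemma insoluble_all_divisible:
  fixes c :: "'p::prime_card padic_int ^ 10"
  assumes c: "insoluble c" and "pp dvd c $ 0" "pp dvd c $ 1" "pp dvd c $ 2"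
  shows "pp dvd c $ i"
proof -
  have 1: "pp dvd c $ 3" "pp dvd c $ 4" "pp dvd c $ 5" "pp dvd c $ 6" "pp dvd c $ 7" "pp dvd c $ 8"
    using insoluble_lines(1-3)[OF c] assms(2-4) by (simp_all add: cube_mod_def)
  have "pp dvd c $ 5 + c $ 7 + c $ 9" using insoluble_lines(4)[OF c] assms(2) by (simp add: cube_mod_def)
  then have 2: "pp dvd c $ 9" using dvd_add[OF 1(3) 1(5)] by (simp add: dvd_add_right_iff)
  have "\<forall>i. pp dvd c $ i" unfolding forall_10 using assms(2-4) 1 2 by blast
  then show ?thesis by blast
qed

lemma shear_yz_nth:
  "shear_yz t c $ 0 = c $ 0" "shear_yz t c $ 1 = c $ 1"
  "shear_yz t c $ 2 = c $ 2 + t ^ 3 * c $ 1 + t ^ 2 * c $ 6 + t * c $ 8"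
  "shear_yz t c $ 3 = c $ 3" "shear_yz t c $ 4 = c $ 4 + t * c $ 3" "shear_yz t c $ 5 = c $ 5"
  "shear_yz t c $ 6 = c $ 6 + 3 * t * c $ 1" "shear_yz t c $ 7 = c $ 7 + t ^ 2 * c $ 5 + t * c $ 9"
  "shear_yz t c $ 8 = c $ 8 + 3 * t ^ 2 * c $ 1 + 2 * t * c $ 6" "shear_yz t c $ 9 = c $ 9 + 2 * t * c $ 5"
  by (simp_all add: shear_yz_def swap_xy_def shear_def)

lemma shear_yz_inverse: "shear_yz t (shear_yz (- t) c) = c"
  using shear_inverse[of 0 t "swap_xy c"] by (simp_all add: shear_yz_def)

text \<open>The restriction to X = 0, divided by p, has coefficients \<open>g0\<close>, ...,
  \<open>g3\<close>. If \<open>g0\<close> is a unit, it is modulo p a constant times (Y + tZ)^3, and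
  replacing Y by Y - tZ leaves only Y^3; otherwise the two middle coefficients vanish modulo
  p.\<close>

lemma insoluble_S1_cases:
  fixes c :: "'p::prime_card padic_int ^ 10"
  assumes c: "insoluble c" "cubic_S1 c"
  shows "\<not> pp ^ 2 dvd c $ 1 \<Longrightarrow> \<exists>t<CARD('p). cubic_S2 (shear_yz (- of_nat t) c)"
    "pp ^ 2 dvd c $ 1 \<Longrightarrow> pp ^ 2 dvd c $ 6 \<and> pp ^ 2 dvd c $ 8"
proof -
  obtain g0 where g0: "c $ 1 = pp * g0" using c(2) unfolding cubic_S1_def dvd_def by blast
  obtain g1 where g1: "c $ 6 = pp * g1" using c(2) unfolding cubic_S1_def dvd_def by blast
  obtain g2 where g2: "c $ 8 = pp * g2" using c(2) unfolding cubic_S1_def dvd_def by blast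
  obtain g3 where g3: "c $ 2 = pp * g3" using c(2) unfolding cubic_S1_def dvd_def by blast
  have p2: "pp ^ 2 dvd pp * x \<longleftrightarrow> pp dvd x" for x :: "'p padic_int"
    by (simp add: power2_eq_square pp_nonzero)
  have cube: "cube_mod g0 g1 g2 g3" by (rule insoluble_line_yz[OF c(1) g0 g1 g2 g3])
  show "pp ^ 2 dvd c $ 6 \<and> pp ^ 2 dvd c $ 8" if "pp ^ 2 dvd c $ 1"
    using cube that unfolding g0 g1 g2 p2 cube_mod_def by simp
  assume "\<not> pp ^ 2 dvd c $ 1"
  then obtain t where t: "t < CARD('p)" "pp dvd g1 - 3 * g0 * of_nat t" "pp dvd g2 - 3 * g0 * of_nat t ^ 2"
      "pp dvd g3 - g0 * of_nat t ^ 3" and n1: "\<not> pp dvd g0"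
    using cube unfolding g0 p2 cube_mod_def by auto
  let ?d = "shear_yz (- of_nat t) c"
  have 1: "?d $ 6 = pp * (g1 - 3 * g0 * of_nat t)" unfolding shear_yz_nth g0 g1 by (simp add: algebra_simps)
  have 2: "?d $ 8 = pp * ((g2 - 3 * g0 * of_nat t ^ 2) - 2 * of_nat t * (g1 - 3 * g0 * of_nat t))"
    unfolding shear_yz_nth g0 g1 g2 by (simp add: power2_eq_square algebra_simps)
  have 3: "?d $ 2 = pp * ((g3 - g0 * of_nat t ^ 3) + of_nat t ^ 2 * (g1 - 3 * g0 * of_nat t) - of_nat t * (g2 - 3 * g0 * of_nat t ^ 2))"
    unfolding shear_yz_nth g0 g1 g2 g3 by (simp add: power2_eq_square power3_eq_cube algebra_simps)
  have d: "pp ^ 2 dvd ?d $ 6" "pp ^ 2 dvd ?d $ 8" "pp ^ 2 dvd ?d $ 2"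
    unfolding 1 2 3 p2 by (intro dvd_add dvd_diff dvd_mult t)+
  then have d': "pp dvd ?d $ 6" "pp dvd ?d $ 8" "pp dvd ?d $ 2" unfolding power2_eq_square by (auto dest: dvd_mult_left)
  have "pp dvd ?d $ 1" "pp dvd ?d $ 3" "pp dvd ?d $ 4" "pp dvd ?d $ 5" "pp dvd ?d $ 7" "pp dvd ?d $ 9" "\<not> pp dvd ?d $ 0"
    "\<not> pp ^ 2 dvd ?d $ 1"
    using c(2) n1 unfolding cubic_S1_def shear_yz_nth g0 p2 by (simp_all add: dvd_add dvd_mult)
  then have "cubic_S2 ?d" unfolding cubic_S2_def cubic_S1_def using d d' by blast
  then show "\<exists>t<CARD('p). cubic_S2 (shear_yz (- of_nat t) c)" using t(1) by blast
qed

lemma insoluble_S2: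
  fixes c :: "'p::prime_card padic_int ^ 10"
  assumes c: "insoluble c" "cubic_S2 c"
  shows "pp ^ 2 dvd c $ 7"
proof -
  obtain g2 where g2: "c $ 7 = pp * g2" using c(2) unfolding cubic_S1_def cubic_S2_def dvd_def by blast
  obtain g3 where g3: "c $ 2 = pp ^ 2 * g3" using c(2) unfolding cubic_S2_def dvd_def by blast
  have "cube_mod (pp * c $ 0) (c $ 4) g2 g3" by (rule insoluble_line_xz[OF c(1) g2 g3])
  then have "pp dvd g2" by (simp add: cube_mod_def)
  then show ?thesis unfolding g2 power2_eq_square by simp
qed

lemma S2_terminal_iff:
  "terminal_cubic c \<longleftrightarrow> cubic_S2 c \<and> pp ^ 2 dvd c $ 7 \<and> \<not> pp ^ 3 dvd c $ 2"
proof -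
  have *: "pp dvd a" if "pp ^ 2 dvd a" for a :: "'a padic_int"
    using that unfolding power2_eq_square by (rule dvd_mult_left)
  show ?thesis unfolding terminal_cubic_def cubic_S2_def cubic_S1_def using * by blast
qed

lemma exists_scaled:
  fixes c :: "'p::prime_card padic_int ^ 10"
  assumes "\<forall>i. pp ^ k dvd c $ i"
  shows "\<exists>d. c = pp ^ k *s d"
proof -
  have "\<forall>i. \<exists>a. c $ i = pp ^ k * a" using assms by (simp add: dvd_def)
  then obtain a where "\<And>i. c $ i = pp ^ k * a i" by metis
  then have "c = pp ^ k *s (\<chi> i. a i)" by (simp add: Finite_Cartesian_Product.vec_eq_iff)
  then show ?thesis by blast
qed

text \<open>Strong induction on the gain bound: shears and swaps keep \<open>D\<close>, every
  division lowers it by one, and a form that allows no division is brought to a terminal one by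
  shears and swaps alone.\<close>

theorem insoluble_imp_stably_insoluble:
  fixes V :: "'p::prime_card padic_closure set"
  assumes V: "dominating_ring V" and c: "insoluble c" "gain_bounded c D"
  shows "stably_insoluble (nr_field V) c"
  using c
proof (induction D arbitrary: c rule: less_induct)
  case (less D)
  note ce = nr_field_coeff_extension[OF V]
  have dil: "stably_insoluble (nr_field V) c" if c: "insoluble c" "gain_bounded c D"
    and div: "\<forall>i. pp ^ Suc (i1 + j1) dvd dilate (pp ^ i1) (pp ^ j1) c $ i" for c i1 j1
  proof -
    obtain d where d: "dilate (pp ^ i1) (pp ^ j1) c = pp ^ Suc (i1 + j1) *s d" using exists_scaled[OF div] by blast
    note d' = d[symmetric]
    have "D > 0" "gain_bounded d (D - 1)" by (rule gain_bounded_dilate[OF c(2) d'])+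
    moreover have "insoluble d" using c(1) insoluble_dilate[OF d'] by blast
    ultimately have "stably_insoluble (nr_field V) d" by (intro less.IH[of "D - 1"]) simp_all
    then show ?thesis by (rule stably_insoluble_dilate[OF ce d'])
  qed
  have S2: "stably_insoluble (nr_field V) c" if c: "insoluble c" "gain_bounded c D" "cubic_S2 c" for c
  proof (cases "pp ^ 3 dvd c $ 2")
    case False
    then have "terminal_cubic c" using c insoluble_S2 by (simp add: S2_terminal_iff)
    then show ?thesis by (rule terminal_cubic_stably_insoluble[OF V])
  next
    case True
    have p3: "pp ^ 3 = pp ^ 2 * (pp :: 'p padic_int)" "pp ^ 3 = pp * (pp ^ 2 :: 'p padic_int)"
      by (simp_all add: power3_eq_cube power2_eq_square)
    have "pp ^ 2 dvd c $ 7" by (rule insoluble_S2[OF c(1,3)])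
    \<comment> \<open>C(pX, pY, Z) is divisible by p^3, one power more than the determinant p^2 of
      the substitution.\<close>
    then have "\<forall>i. pp ^ 3 dvd dilate pp pp c $ i"
      using True c(3) unfolding forall_10 dilate_def vec10_nth cubic_S2_def cubic_S1_def
      by (simp add: mult_dvd_mono p3(1) flip: power2_eq_square)
    then show ?thesis using dil[OF c(1,2), of 1 1] by (simp add: numeral_3_eq_3)
  qed
  have S1: "stably_insoluble (nr_field V) c" if c: "insoluble c" "gain_bounded c D" "cubic_S1 c" for c
  proof (cases "pp ^ 2 dvd c $ 1")
    case False
    then obtain t where t: "cubic_S2 (shear_yz (- of_nat t) c)" using insoluble_S1_cases(1)[OF c(1,3)] by blast
    have "gain_bounded (shear_yz (- of_nat t) c) D"
      unfolding shear_yz_def by (intro gain_bounded_equiv c)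
    from S2[OF insoluble_shear_yz[THEN iffD2, OF c(1)] this t]
    have "stably_insoluble (nr_field V) (swap_xy (shear 0 (- of_nat t) (swap_xy c)))" unfolding shear_yz_def .
    from stably_insoluble_swap(1)[OF stably_insoluble_shear[OF ce stably_insoluble_swap(1)[OF this]]]
    show ?thesis .
  next
    case True
    then have c68: "pp ^ 2 dvd c $ 6" "pp ^ 2 dvd c $ 8" using insoluble_S1_cases(2)[OF c(1,3)] by blast+
    show ?thesis
    proof (cases "pp ^ 2 dvd c $ 2")
      case False
      have "cubic_S2 (swap_yz c)"
        using c(3) c68 True False unfolding cubic_S2_def cubic_S1_def by (simp add: swap_yz_def)
      then have "stably_insoluble (nr_field V) (swap_yz c)"
        by (rule S2[OF insoluble_swap(3)[THEN iffD2, OF c(1)] gain_bounded_equiv(4)[OF c(2)]])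
      then show ?thesis by (rule stably_insoluble_swap)
    next
      case True
      then have "\<forall>i. pp ^ 2 dvd dilate pp 1 c $ i"
        using c(3) c68 \<open>pp ^ 2 dvd c $ 1\<close> unfolding forall_10 dilate_def vec10_nth cubic_S1_def
        by (simp add: power2_eq_square power3_eq_cube mult.assoc)
      then show ?thesis using dil[OF c(1,2), of 1 0] by (simp add: numeral_2_eq_2)
    qed
  qed
  have unit0: "stably_insoluble (nr_field V) c" if c: "insoluble c" "gain_bounded c D" "\<not> pp dvd c $ 0" for c
  proof -
    obtain s t where "cubic_S1 (shear (- of_nat s) (- of_nat t) c)" using insoluble_reduce_S1[OF c(1,3)] by blast
    then have "stably_insoluble (nr_field V) (shear (- of_nat s) (- of_nat t) c)"
      by (rule S1[OF insoluble_shear[THEN iffD2, OF c(1)] gain_bounded_equiv(1)[OF c(2)]])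
    then show ?thesis by (rule stably_insoluble_shear[OF ce])
  qed
  note c = less.prems
  consider "\<not> pp dvd c $ 0" | "\<not> pp dvd c $ 1" | "\<not> pp dvd c $ 2" | "pp dvd c $ 0" "pp dvd c $ 1" "pp dvd c $ 2" by blast
  then show ?case
  proof cases
    case 1
    then show ?thesis by (rule unit0[OF c])
  next
    case 2
    then have "\<not> pp dvd swap_xy c $ 0" by (simp add: swap_xy_def)
    then have "stably_insoluble (nr_field V) (swap_xy c)"
      by (rule unit0[OF insoluble_swap(1)[THEN iffD2, OF c(1)] gain_bounded_equiv(2)[OF c(2)]])
    then show ?thesis by (rule stably_insoluble_swap)
  next
    case 3
    then have "\<not> pp dvd swap_xz c $ 0" by (simp add: swap_xz_def)
    then have "stably_insoluble (nr_field V) (swap_xz c)"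
      by (rule unit0[OF insoluble_swap(2)[THEN iffD2, OF c(1)] gain_bounded_equiv(3)[OF c(2)]])
    then show ?thesis by (rule stably_insoluble_swap)
  next
    case 4
    then have "\<forall>i. pp ^ Suc (0 + 0) dvd dilate (pp ^ 0) (pp ^ 0) c $ i"
      using insoluble_all_divisible[OF c(1)] unfolding forall_10 by (simp add: dilate_def)
    then show ?thesis by (rule dil[OF c])
  qed
qed

lemma soluble_nr_eq_has_zero: "soluble_nr c \<longleftrightarrow> has_zero padic_nr c"
  by (simp add: soluble_nr_def has_zero_def closure_form_def)

lemma has_zero_mono: "K \<subseteq> K' \<Longrightarrow> has_zero K c \<Longrightarrow> has_zero K' c"
  unfolding has_zero_def by blast

lemma insoluble_imp_stable:
  fixes V :: "'p::prime_card padic_closure set"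
  assumes V: "dominating_ring V" and c: "insoluble c"
  shows "stably_insoluble (nr_field V) c"
proof -
  have "v = 0" if v: "form_at c v = 0" for v
  proof (rule ccontr)
    assume "v \<noteq> 0"
    then have "v $ 1 \<noteq> 0 \<or> v $ 2 \<noteq> 0 \<or> v $ 3 \<noteq> 0" by (auto simp: Finite_Cartesian_Product.vec_eq_iff forall_3)
    moreover obtain L :: "'p padic_closure set" where L: "unramified_extension L" using unramified_extension_of_padic_int by blast
    moreover have "closure_form c (of_padic_int (v $ 1)) (of_padic_int (v $ 2)) (of_padic_int (v $ 3)) = 0"
      using v unfolding closure_form_of_padic_int form_at_def by simp
    ultimately have "has_zero L c"
      by (intro has_zeroI[of "of_padic_int (v $ 1)" _ "of_padic_int (v $ 2)" "of_padic_int (v $ 3)"]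
          coeff_extensionD[OF unramified_extension_coeff_extension[OF L]]) auto
    then show False using c L unfolding insoluble_def by blast
  qed
  then obtain D where "gain_bounded c D" using exists_gain_bound by blast
  then show ?thesis by (rule insoluble_imp_stably_insoluble[OF V c])
qed

text \<open>A zero over \<open>padic_nr\<close> with coordinates in different extensions is still a
  zero over \<open>nr_field V\<close>, where an insoluble form has none. Conversely, each unramified
  extension is contained in \<open>padic_nr\<close>.\<close>

lemma soluble_nr_iff: "soluble_nr c \<longleftrightarrow> \<not> insoluble c"
proof -
  obtain V :: "'a padic_closure set" where V: "dominating_ring V" using exists_dominating_ring by blast
  have "\<not> soluble_nr c" if "insoluble c"
    using stably_insolubleD[OF insoluble_imp_stable[OF V that]] has_zero_mono[OF padic_nr_subset[OF V]]
    unfolding soluble_nr_eq_has_zero by blast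
  moreover have "soluble_nr c" if "\<not> insoluble c"
  proof -
    from that obtain L where L: "unramified_extension L" "has_zero L c" unfolding insoluble_def by blast
    have "L \<subseteq> padic_nr" using L(1) unfolding padic_nr_def unramified_extension_def by blast
    then show ?thesis unfolding soluble_nr_eq_has_zero using has_zero_mono L(2) by blast
  qed
  ultimately show ?thesis by blast
qed

text \<open>Insolubility amounts to having no zero over \<open>nr_field V\<close>, and
  \<open>stably_insoluble\<close> asserts just this on a ball.\<close>

lemma open_insoluble: "open {c :: 'p::prime_card padic_int ^ 10. insoluble c}"
proof -
  obtain V :: "'p padic_closure set" where V: "dominating_ring V" using exists_dominating_ring by blast
  have "insoluble c \<longleftrightarrow> \<not> has_zero (nr_field V) c" for c
  proof
    assume "insoluble c"
    then show "\<not> has_zero (nr_field V) c" by (intro stably_insolubleD insoluble_imp_stable[OF V])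
  next
    assume *: "\<not> has_zero (nr_field V) c"
    have "\<not> has_zero L c" if L: "unramified_extension L" for L
    proof -
      have "L \<subseteq> padic_nr" using L unfolding padic_nr_def unramified_extension_def by blast
      then have "L \<subseteq> nr_field V" using padic_nr_subset[OF V] by (rule order_trans)
      then show ?thesis using has_zero_mono * by blast
    qed
    then show "insoluble c" unfolding insoluble_def by blast
  qed
  note iff = this
  have "\<exists>n. \<forall>e. insoluble (c + pp ^ n *s e)" if "insoluble c" for c :: "'p padic_int ^ 10"
    using insoluble_imp_stable[OF V that] unfolding stably_insoluble_def iff .
  then show ?thesis unfolding open_padic_vec_iff by blast
qed

lemma terminal_cubic_imp_insoluble:
  assumes "terminal_cubic c"
  shows "insoluble c"
proof -
  obtain V :: "'a padic_closure set" where V: "dominating_ring V" using exists_dominating_ring by blast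
  have "\<not> has_zero padic_nr c"
    using terminal_cubic_insoluble[OF V assms] has_zero_mono[OF padic_nr_subset[OF V]] by blast
  then show ?thesis using soluble_nr_iff soluble_nr_eq_has_zero by blast
qed

section \<open>The measure of the insoluble forms\<close>

lemma pred_padic_dvd [measurable]:
  "Measurable.pred borel (\<lambda>c :: 'p::prime_card padic_int ^ 'n. pp ^ k dvd c $ i)"
  "Measurable.pred borel (\<lambda>c :: 'p padic_int ^ 'n. pp dvd c $ i)"
  using sets_padic_dvd[of k i] sets_padic_dvd'[of i] by (simp_all add: pred_def)

lemma pred_insoluble [measurable]: "Measurable.pred borel (insoluble :: 'p::prime_card padic_int ^ 10 \<Rightarrow> bool)"
  unfolding pred_def using borel_open[OF open_insoluble] by simp

lemma pred_cubic_S [measurable]: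
  "Measurable.pred borel (cubic_S1 :: 'p::prime_card padic_int ^ 10 \<Rightarrow> bool)"
  "Measurable.pred borel (cubic_S2 :: 'p padic_int ^ 10 \<Rightarrow> bool)"
proof -
  show 1: "Measurable.pred borel (cubic_S1 :: 'p padic_int ^ 10 \<Rightarrow> bool)"
    unfolding cubic_S1_def[abs_def] by measurable
  note [measurable] = 1
  show "Measurable.pred borel (cubic_S2 :: 'p padic_int ^ 10 \<Rightarrow> bool)"
    unfolding cubic_S2_def[abs_def] by measurable
qed

lemma pred_insoluble_vscale [measurable]:
  "Measurable.pred borel (\<lambda>c :: 'p::prime_card padic_int ^ 10. insoluble (vscale v c))"
proof -
  have "open {c :: 'p padic_int ^ 10. insoluble (vscale v c)}"
    unfolding open_padic_vec_iff
  proof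
    fix c :: "'p padic_int ^ 10" assume "c \<in> {c. insoluble (vscale v c)}"
    then have "vscale v c \<in> {c. insoluble c}" by simp
    from bspec[OF open_insoluble[unfolded open_padic_vec_iff] this]
    obtain n where n: "\<And>e. insoluble (vscale v c + pp ^ n *s e)" by blast
    have "vscale v (c + pp ^ n *s e) = vscale v c + pp ^ n *s vscale v e" for e
      by (simp add: Finite_Cartesian_Product.vec_eq_iff distrib_left mult_ac)
    then have "\<forall>e. c + pp ^ n *s e \<in> {c. insoluble (vscale v c)}" using n by simp
    then show "\<exists>n. \<forall>e. c + pp ^ n *s e \<in> {c. insoluble (vscale v c)}" by blast
  qed
  then show ?thesis unfolding pred_def using borel_open by simp
qed

lemma pred_sets: "Measurable.pred borel Q \<Longrightarrow> {c. Q c} \<in> sets borel"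
  by (simp add: pred_def)

lemma pp_dvd_of_nat_diff:
  assumes "pp dvd (of_nat s - of_nat t :: 'p::prime_card padic_int)" "s < CARD('p)" "t < CARD('p)"
  shows "s = t"
proof -
  have "padic_residue (of_nat s :: 'p padic_int) 1 = padic_residue (of_nat t :: 'p padic_int) 1"
    using assms(1) by (simp only: padic_residue_eq_iff power_one_right)
  then show ?thesis using assms(2,3) by (simp add: padic_residue_of_nat)
qed

text \<open>(s^3 - t^3) - 3 (s^2 - t^2) t + 3 (s - t) t^2 equals (s - t)^3. No division by 3 is
  made, so p = 3 is covered.\<close>

lemma cube_shift_unique:
  fixes g s t :: "'p::prime_card padic_int"
  assumes "\<not> pp dvd g" "pp dvd 3 * g * (s - t)" "pp dvd 3 * g * (s ^ 2 - t ^ 2)" "pp dvd g * (s ^ 3 - t ^ 3)"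
  shows "pp dvd s - t"
proof -
  have "g * (s - t) ^ 3 = g * (s ^ 3 - t ^ 3) - (3 * g * (s ^ 2 - t ^ 2)) * t + (3 * g * (s - t)) * t ^ 2"
    by (simp add: power2_eq_square power3_eq_cube algebra_simps)
  then have "pp dvd g * (s - t) ^ 3" by (simp only:) (rule dvd_add[OF dvd_diff[OF assms(4) dvd_mult2[OF assms(3)]] dvd_mult2[OF assms(2)]])
  then show ?thesis using assms(1) by (simp add: pp_dvd_mult_iff pp_dvd_power_iff)
qed

text \<open>The reduction is c0 (X + sY + tZ)^3 with c0 a unit, which determines the shift modulo p.
  This makes the images in the later unions disjoint.\<close>

lemma shear_S1_unique:
  fixes c d :: "'p::prime_card padic_int ^ 10"
  assumes c: "cubic_S1 c" "cubic_S1 d" and eq: "shear s t c = shear s' t' d"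
  shows "pp dvd s - s'" "pp dvd t - t'"
proof -
  have n: "shear s t c $ i = shear s' t' d $ i" for i by (simp only: eq)
  have 0: "d $ 0 = c $ 0" using n[of 0] by (simp add: shear_def)
  have r: "red (c $ i) = 0 \<and> red (d $ i) = 0" if "i \<in> {1,2,3,4,5,7}" for i
    using c that by (auto simp: cubic_S1_def red_eq_0_iff)
  have r': "red (shear s t c $ i) = red (shear s' t' d $ i)" for i by (simp only: n)
  have u: "\<not> pp dvd c $ 0" using c by (simp add: cubic_S1_def)
  show "pp dvd s - s'"
    by (rule cube_shift_unique[OF u]; unfold red_eq_0_iff[symmetric])
      (use r'[of 3] r'[of 5] r'[of 1] in \<open>simp_all add: shear_def r 0 algebra_simps\<close>)
  show "pp dvd t - t'"
    by (rule cube_shift_unique[OF u]; unfold red_eq_0_iff[symmetric])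
      (use r'[of 4] r'[of 7] r'[of 2] in \<open>simp_all add: shear_def r 0 algebra_simps\<close>)
qed

text \<open>Here the cube is the restriction to X = 0 divided by p, whence the congruences modulo
  p^2.\<close>

lemma shear_yz_S2_unique:
  fixes c d :: "'p::prime_card padic_int ^ 10"
  assumes c: "cubic_S2 c" "cubic_S2 d" and eq: "shear_yz t c = shear_yz t' d"
  shows "pp dvd t - t'"
proof -
  have n: "shear_yz t c $ i = shear_yz t' d $ i" for i by (simp only: eq)
  have 1: "d $ 1 = c $ 1" using n[of 1] by (simp add: shear_yz_nth)
  obtain g where g: "c $ 1 = pp * g" using c unfolding cubic_S2_def cubic_S1_def dvd_def by blast
  have p2: "pp ^ 2 dvd pp * x \<longleftrightarrow> pp dvd x" for x :: "'p padic_int"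
    by (simp add: power2_eq_square pp_nonzero)
  have gu: "\<not> pp dvd g" using c unfolding cubic_S2_def g p2 by blast
  have dv: "pp ^ 2 dvd c $ 2" "pp ^ 2 dvd c $ 6" "pp ^ 2 dvd c $ 8" "pp ^ 2 dvd d $ 2" "pp ^ 2 dvd d $ 6" "pp ^ 2 dvd d $ 8"
    using c unfolding cubic_S2_def by blast+
  have "pp * (3 * g * (t - t')) = d $ 6 - c $ 6"
    using n[of 6] unfolding shear_yz_nth 1 g by (simp add: algebra_simps)
  then have a: "pp dvd 3 * g * (t - t')" unfolding p2[symmetric] using dvd_diff[OF dv(5) dv(2)] by (simp only:)
  have "pp * (3 * g * (t ^ 2 - t' ^ 2)) = d $ 8 - c $ 8 + 2 * t' * d $ 6 - 2 * t * c $ 6"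
    using n[of 8] unfolding shear_yz_nth 1 g by (simp add: algebra_simps)
  then have b: "pp dvd 3 * g * (t ^ 2 - t' ^ 2)"
    unfolding p2[symmetric] by (simp only:) (rule dvd_diff[OF dvd_add[OF dvd_diff[OF dv(6,3)] dvd_mult[OF dv(5)]] dvd_mult[OF dv(2)]])
  have "pp * (g * (t ^ 3 - t' ^ 3)) = d $ 2 - c $ 2 + (t' ^ 2 * d $ 6 - t ^ 2 * c $ 6) + (t' * d $ 8 - t * c $ 8)"
    using n[of 2] unfolding shear_yz_nth 1 g by (simp add: algebra_simps)
  then have e: "pp dvd g * (t ^ 3 - t' ^ 3)"
    unfolding p2[symmetric] by (simp only:)
      (rule dvd_add[OF dvd_add[OF dvd_diff[OF dv(4,1)] dvd_diff[OF dvd_mult[OF dv(5)] dvd_mult[OF dv(2)]]]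
        dvd_diff[OF dvd_mult[OF dv(6)] dvd_mult[OF dv(3)]]])
  show ?thesis by (rule cube_shift_unique[OF gu a b e])
qed

lemma shear_0 [simp]: "shear 0 0 c = c"
  by (simp add: vec10_eq_iff shear_def)

lemma swap_nth:
  "swap_xy c $ 0 = c $ 1" "swap_xy c $ 1 = c $ 0" "swap_xy c $ 2 = c $ 2" "swap_xy c $ 3 = c $ 5" "swap_xy c $ 4 = c $ 6"
  "swap_xy c $ 5 = c $ 3" "swap_xy c $ 6 = c $ 4" "swap_xy c $ 7 = c $ 8" "swap_xy c $ 8 = c $ 7" "swap_xy c $ 9 = c $ 9"
  "swap_xz c $ 0 = c $ 2" "swap_xz c $ 1 = c $ 1" "swap_xz c $ 2 = c $ 0" "swap_xz c $ 3 = c $ 8" "swap_xz c $ 4 = c $ 7"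
  "swap_xz c $ 5 = c $ 6" "swap_xz c $ 6 = c $ 5" "swap_xz c $ 7 = c $ 4" "swap_xz c $ 8 = c $ 3" "swap_xz c $ 9 = c $ 9"
  "swap_yz c $ 0 = c $ 0" "swap_yz c $ 1 = c $ 2" "swap_yz c $ 2 = c $ 1" "swap_yz c $ 3 = c $ 4" "swap_yz c $ 4 = c $ 3"
  "swap_yz c $ 5 = c $ 7" "swap_yz c $ 6 = c $ 8" "swap_yz c $ 7 = c $ 5" "swap_yz c $ 8 = c $ 6" "swap_yz c $ 9 = c $ 9"
  by (simp_all add: swap_xy_def swap_xz_def swap_yz_def)

text \<open>The last two clauses hold because the coefficients of Y^3 and Z^3 are s^3 and t^3 times
  \<open>d $ 0\<close> modulo p; they cut down the number of shears in the later cases.\<close>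

lemma insoluble_unit_cases:
  fixes c :: "'p::prime_card padic_int ^ 10"
  assumes "insoluble c" "\<not> pp dvd c $ 0"
  obtains s t d where "s < CARD('p)" "t < CARD('p)" "insoluble d" "cubic_S1 d" "c = shear (of_nat s) (of_nat t) d"
    "pp dvd c $ 1 \<Longrightarrow> s = 0" "pp dvd c $ 2 \<Longrightarrow> t = 0"
proof -
  obtain s t where st: "s < CARD('p)" "t < CARD('p)" "cubic_S1 (shear (- of_nat s) (- of_nat t) c)"
    using insoluble_reduce_S1[OF assms] by blast
  define d where "d = shear (- of_nat s) (- of_nat t) c"
  have c: "c = shear (of_nat s) (of_nat t) d" by (simp add: d_def shear_inverse)
  have d: "insoluble d" using assms(1) by (simp add: d_def insoluble_shear)
  have S1: "cubic_S1 d" using st(3) by (simp add: d_def)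
  have z: "k = 0" if "pp dvd (of_nat k ^ 3 * d $ 0 + r :: 'p padic_int)" "pp dvd r" "k < CARD('p)" for k r
  proof -
    have "pp dvd of_nat k ^ 3 * d $ 0" using that(1,2) by (simp only: dvd_add_left_iff)
    then have "pp dvd (of_nat k - of_nat 0 :: 'p padic_int)"
      using S1 by (auto simp: cubic_S1_def pp_dvd_mult_iff pp_dvd_power_iff)
    then show ?thesis by (rule pp_dvd_of_nat_diff) (use that(3) in auto)
  qed
  have "s = 0" if "pp dvd c $ 1"
  proof (rule z)
    show "pp dvd of_nat s ^ 3 * d $ 0 + (d $ 1 + of_nat s ^ 2 * d $ 3 + of_nat s * d $ 5)"
      using that unfolding c shear_def vec10_nth by (simp add: add_ac)
    show "pp dvd d $ 1 + of_nat s ^ 2 * d $ 3 + of_nat s * d $ 5"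
      using S1 unfolding cubic_S1_def by (intro dvd_add dvd_mult) blast+
  qed (rule st)
  moreover have "t = 0" if "pp dvd c $ 2"
  proof (rule z)
    show "pp dvd of_nat t ^ 3 * d $ 0 + (d $ 2 + of_nat t ^ 2 * d $ 4 + of_nat t * d $ 7)"
      using that unfolding c shear_def vec10_nth by (simp add: add_ac)
    show "pp dvd d $ 2 + of_nat t ^ 2 * d $ 4 + of_nat t * d $ 7"
      using S1 unfolding cubic_S1_def by (intro dvd_add dvd_mult) blast+
  qed (rule st)
  ultimately show ?thesis using that[OF st(1,2) d S1 c] by blast
qed

lemma insoluble_unit_cases_dvd:
  fixes c :: "'p::prime_card padic_int ^ 10"
  assumes "insoluble c" "\<not> pp dvd c $ 0" "pp dvd c $ 1"
  obtains t d where "t < CARD('p)" "insoluble d" "cubic_S1 d" "c = shear 0 (of_nat t) d"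
proof (rule insoluble_unit_cases[OF assms(1,2)])
  fix s t d assume *: "t < CARD('p)" "insoluble d" "cubic_S1 d" "c = shear (of_nat s) (of_nat t) d"
    "pp dvd c $ 1 \<Longrightarrow> s = 0" "pp dvd c $ 2 \<Longrightarrow> t = 0"
  have c: "c = shear 0 (of_nat t) d" using *(4) *(5)[OF assms(3)] by simp
  show ?thesis by (rule that[OF *(1-3) c])
qed

lemma insoluble_unit_imp_S1:
  assumes "insoluble c" "\<not> pp dvd c $ 0" "pp dvd c $ 1" "pp dvd c $ 2"
  shows "cubic_S1 c"
proof (rule insoluble_unit_cases[OF assms(1,2)])
  fix s t d assume *: "cubic_S1 d" "c = shear (of_nat s) (of_nat t) d" "pp dvd c $ 1 \<Longrightarrow> s = 0" "pp dvd c $ 2 \<Longrightarrow> t = 0"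
  have "s = 0" "t = 0" using *(3)[OF assms(3)] *(4)[OF assms(4)] .
  with *(2) have "c = d" by simp
  with *(1) show ?thesis by simp
qed

lemma vscale_image_eqI:
  assumes "\<And>c. c \<in> B \<Longrightarrow> \<forall>i. pp ^ v i dvd c $ i" "\<And>c. vscale v c \<in> B \<longleftrightarrow> c \<in> A"
  shows "B = vscale v ` A"
proof (intro equalityI subsetI)
  fix c assume c: "c \<in> B"
  then have "c \<in> range (vscale v)" using assms(1) unfolding range_vscale by blast
  then show "c \<in> vscale v ` A" using c assms(2) by blast
qed (use assms(2) in blast)

text \<open>\<open>w\<close>, \<open>s2\<close>, \<open>s1\<close>, \<open>t\<close>,
  \<open>x\<close> are the measures of \<open>IW\<close>, \<open>IS2\<close>, \<open>IS1\<close>,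
  \<open>IT\<close> and of all insoluble forms. The system is block triangular: \<open>w\<close> and
  \<open>s2\<close> determine each other, then \<open>s1\<close> and \<open>t\<close>, then
  \<open>x\<close>.\<close>

lemma insoluble_recursion_solution:
  fixes q x w s2 s1 t :: real
  assumes q1: "q > 1" and w: "w = q * s2" and s2: "s2 = (1 - 1 / q) ^ 3 / q ^ 13 + q * w / q ^ 10"
    and t: "t = q * w + w + q ^ 2 * s1 / q ^ 10" and s1: "s1 = w + s2 + t / q ^ 10"
    and x: "x = (q ^ 2 + q + 1) * s1 + x / q ^ 10"
  shows "x = q ^ 11 * (q - 1) * (q ^ 2 - 1) * (q ^ 3 - 1) / ((q ^ 8 - 1) * (q ^ 9 - 1) * (q ^ 10 - 1))"
proof -
  define a where "a = q ^ 8"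
  have gt: "q ^ n > 1" if "n > 0" for n using one_less_power[OF q1 that] .
  have pw: "q ^ 9 = a * q" "q ^ 10 = a * q ^ 2" "q ^ 11 = a * q ^ 3" "q ^ 3 * q ^ 13 = a * a"
    unfolding a_def by (simp_all flip: power_add power_Suc2)
  have nz: "q \<noteq> 0" "a \<noteq> 0" using q1 gt[of 8] by (auto simp: a_def)
  have nz': "(q ^ 8 - 1) * (q ^ 9 - 1) * (q ^ 10 - 1) \<noteq> 0"
    using gt[of 8] gt[of 9] gt[of 10] by simp
  have cancel: "q ^ 2 * u / q ^ 10 = u / a" for u
    using nz unfolding pw by simp
  have "(1 - 1 / q) ^ 3 / q ^ 13 = ((q - 1) / q) ^ 3 / q ^ 13"
    using nz by (simp add: diff_divide_distrib)
  also have "\<dots> = (q - 1) ^ 3 / (a * a)"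
    by (simp only: power_divide divide_divide_eq_left pw)
  finally have "s2 = (q - 1) ^ 3 / (a * a) + s2 / a"
    using s2 cancel[of s2] unfolding w by (simp add: power2_eq_square)
  then have s2': "a * (a - 1) * s2 = (q - 1) ^ 3"
    using nz by (simp add: field_simps)
  have t': "a * t = a * (q + 1) * w + s1"
    by (subst t) (simp add: cancel nz distrib_left distrib_right)
  have "a * q ^ 2 * s1 = a * q ^ 2 * (w + s2) + t"
    by (subst s1) (simp add: pw nz distrib_left)
  then have "a * (a * q ^ 2 * s1) = a * (a * q ^ 2 * (w + s2)) + a * t"
    by (simp only: distrib_left)
  \<comment> \<open>Eliminating \<open>t\<close> produces q^18 - 1; its factor q^9 + 1 also occurs
    on the right, so only q^9 - 1 survives.\<close>
  then have "(a * q + 1) * ((a * q - 1) * s1) = (a * q + 1) * (a * q * (q + 1) * s2)"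
    unfolding t' w by (simp add: algebra_simps power2_eq_square)
  moreover have "a * q + 1 \<noteq> 0" using gt[of 9] by (simp add: pw)
  ultimately have s1': "(a * q - 1) * s1 = a * q * (q + 1) * s2"
    by (simp only: mult_cancel_left simp_thms)
  have x': "(a * q ^ 2 - 1) * x = a * q ^ 2 * (q ^ 2 + q + 1) * s1"
    using x nz unfolding pw by (simp add: field_simps)
  have "x * ((a - 1) * (a * q - 1) * (a * q ^ 2 - 1)) = (a - 1) * (a * q - 1) * ((a * q ^ 2 - 1) * x)"
    by (simp only: mult_ac)
  also have "\<dots> = (a - 1) * (a * q ^ 2 * (q ^ 2 + q + 1)) * ((a * q - 1) * s1)"
    unfolding x' by (simp only: mult_ac)
  also have "\<dots> = a * q ^ 3 * ((q ^ 2 + q + 1) * (q + 1)) * (a * (a - 1) * s2)"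
    unfolding s1' by (simp add: power2_eq_square power3_eq_cube)
  also have "\<dots> = a * q ^ 3 * (q - 1) * (q ^ 2 - 1) * (q ^ 3 - 1)"
    unfolding s2' by (simp add: algebra_simps power2_eq_square power3_eq_cube)
  finally show ?thesis
    by (subst nonzero_eq_divide_eq[OF nz']) (simp only: pw a_def[symmetric])
qed

section \<open>The linear system for the measures of the states\<close>

context
  fixes \<mu> :: "('p::prime_card padic_int ^ 10) measure"
  assumes \<mu>: "normalized_haar \<mu>"
begin

lemma measure_split:
  assumes [measurable]: "Measurable.pred borel Q" "Measurable.pred borel R"
  shows "measure \<mu> {c. Q c} = measure \<mu> {c. Q c \<and> R c} + measure \<mu> {c. Q c \<and> \<not> R c}"
proof -
  note \<mu>' = normalized_haar_translation_invariant[OF \<mu>]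
  interpret finite_measure \<mu> by (rule \<mu>')
  have "{c. Q c} = {c. Q c \<and> R c} \<union> {c. Q c \<and> \<not> R c}" by auto
  moreover have "{c. Q c \<and> R c} \<in> sets \<mu>" "{c. Q c \<and> \<not> R c} \<in> sets \<mu>"
    unfolding \<mu>'(3) by (intro pred_sets; measurable)+
  moreover have "{c. Q c \<and> R c} \<inter> {c. Q c \<and> \<not> R c} = {}" by auto
  ultimately show ?thesis by (simp only: finite_measure_Union)
qed

lemma measure_disjoint_images:
  assumes fin: "finite J" and f: "\<And>j. j \<in> J \<Longrightarrow> f j ` A \<in> sets borel" "\<And>j. j \<in> J \<Longrightarrow> measure \<mu> (f j ` A) = measure \<mu> A"
    and disj: "\<And>j k x y. j \<in> J \<Longrightarrow> k \<in> J \<Longrightarrow> x \<in> A \<Longrightarrow> y \<in> A \<Longrightarrow> f j x = f k y \<Longrightarrow> j = k"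
  shows "measure \<mu> (\<Union>j\<in>J. f j ` A) = real (card J) * measure \<mu> A"
proof -
  note \<mu>' = normalized_haar_translation_invariant[OF \<mu>]
  interpret finite_measure \<mu> by (rule \<mu>')
  have "disjoint_family_on (\<lambda>j. f j ` A) J"
    unfolding disjoint_family_on_def
  proof (intro ballI impI)
    fix j k assume jk: "j \<in> J" "k \<in> J" "j \<noteq> k"
    show "f j ` A \<inter> f k ` A = {}"
    proof (rule ccontr)
      assume "f j ` A \<inter> f k ` A \<noteq> {}"
      then obtain x y where "x \<in> A" "y \<in> A" "f j x = f k y" by auto
      then show False using disj[OF jk(1,2)] jk(3) by blast
    qed
  qed
  then have "measure \<mu> (\<Union>j\<in>J. f j ` A) = (\<Sum>j\<in>J. measure \<mu> (f j ` A))"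
    by (intro finite_measure_finite_Union[OF fin]) (auto simp: \<mu>'(3) f(1))
  then show ?thesis by (simp add: f(2))
qed

lemma measure_shear_image:
  assumes "A \<in> sets borel"
  shows "shear s t ` A \<in> sets borel" "measure \<mu> (shear s t ` A) = measure \<mu> A"
  by (rule measure_image_bij[OF \<mu> shear_linear shear_inverse assms])+

lemma measure_swap_image:
  assumes "A \<in> sets borel"
  shows "swap_xy ` A \<in> sets borel" "measure \<mu> (swap_xy ` A) = measure \<mu> A"
    "swap_xz ` A \<in> sets borel" "measure \<mu> (swap_xz ` A) = measure \<mu> A"
    "swap_yz ` A \<in> sets borel" "measure \<mu> (swap_yz ` A) = measure \<mu> A"
  by (rule measure_image_bij[OF \<mu> swap_linear(1,2) swap_inverse(1,1) assms]
      measure_image_bij[OF \<mu> swap_linear(3,4) swap_inverse(2,2) assms]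
      measure_image_bij[OF \<mu> swap_linear(5,6) swap_inverse(3,3) assms])+

lemma measure_shear_yz_image:
  assumes "A \<in> sets borel"
  shows "shear_yz t ` A \<in> sets borel" "measure \<mu> (shear_yz t ` A) = measure \<mu> A"
proof -
  have "shear_yz t ` A = swap_xy ` shear 0 t ` swap_xy ` A" by (simp add: image_image shear_yz_def)
  then show "shear_yz t ` A \<in> sets borel" "measure \<mu> (shear_yz t ` A) = measure \<mu> A"
    by (simp_all add: measure_swap_image measure_shear_image assms)
qed

abbreviation IS1 where "IS1 \<equiv> {c :: 'p padic_int ^ 10. insoluble c \<and> cubic_S1 c}"
abbreviation IS2 where "IS2 \<equiv> {c :: 'p padic_int ^ 10. insoluble c \<and> cubic_S2 c}"
abbreviation IW where "IW \<equiv> {c :: 'p padic_int ^ 10. (insoluble c \<and> cubic_S1 c) \<and> \<not> pp ^ 2 dvd c $ 1}"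

lemma sets_I: "IS1 \<in> sets borel" "IS2 \<in> sets borel" "IW \<in> sets borel"
  by (rule pred_sets, measurable)+

lemma measure_unit: "measure \<mu> {c. insoluble c \<and> \<not> pp dvd c $ 0} = real CARD('p) ^ 2 * measure \<mu> IS1"
proof -
  let ?J = "{..<CARD('p)} \<times> {..<CARD('p)}"
  let ?f = "\<lambda>(s, t). shear (of_nat s) (of_nat t) :: 'p padic_int ^ 10 \<Rightarrow> _"
  have "{c. insoluble c \<and> \<not> pp dvd c $ 0} = (\<Union>j\<in>?J. ?f j ` IS1)"
  proof (intro equalityI subsetI)
    fix c :: "'p padic_int ^ 10" assume "c \<in> {c. insoluble c \<and> \<not> pp dvd c $ 0}"
    then obtain s t d where "s < CARD('p)" "t < CARD('p)" "insoluble d" "cubic_S1 d" "c = shear (of_nat s) (of_nat t) d"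
      using insoluble_unit_cases[of c] by blast
    then show "c \<in> (\<Union>j\<in>?J. ?f j ` IS1)" by (intro UN_I[of "(s, t)"]) auto
  next
    fix c assume "c \<in> (\<Union>j\<in>?J. ?f j ` IS1)"
    then obtain s t d where "insoluble d" "cubic_S1 d" "c = shear s t d" by auto
    then show "c \<in> {c. insoluble c \<and> \<not> pp dvd c $ 0}"
      by (simp add: insoluble_shear) (simp add: shear_def cubic_S1_def)
  qed
  moreover have "measure \<mu> (\<Union>j\<in>?J. ?f j ` IS1) = real (card ?J) * measure \<mu> IS1"
  proof (rule measure_disjoint_images)
    show "?f j ` IS1 \<in> sets borel" "measure \<mu> (?f j ` IS1) = measure \<mu> IS1" for j
      by (cases j, simp add: measure_shear_image sets_I)+
    fix j k x y assume *: "j \<in> ?J" "k \<in> ?J" "x \<in> IS1" "y \<in> IS1" "?f j x = ?f k y"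
    obtain s t s' t' where jk: "j = (s, t)" "k = (s', t')" by (cases j, cases k) auto
    have S: "cubic_S1 x" "cubic_S1 y" and eq: "shear (of_nat s) (of_nat t) x = shear (of_nat s') (of_nat t') y"
      using * by (simp_all add: jk)
    show "j = k" using shear_S1_unique[OF S eq] * by (auto simp: jk dest: pp_dvd_of_nat_diff)
  qed simp
  ultimately show ?thesis by (simp add: power2_eq_square)
qed

text \<open>Meant for forms whose coefficient of Y^3 is divisible by p, where s = 0 and only
  \<open>t\<close> varies. The predicate \<open>R\<close> serves \<open>IS1\<close> and
  \<open>IW\<close> at once.\<close>

lemma measure_shear_xz:
  assumes [measurable]: "Measurable.pred borel R"
  shows "measure \<mu> (\<Union>t\<in>{..<CARD('p)}. shear 0 (of_nat t) ` {c. (insoluble c \<and> cubic_S1 c) \<and> R c}) =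
      real CARD('p) * measure \<mu> {c. (insoluble c \<and> cubic_S1 c) \<and> R c}" (is "measure \<mu> (\<Union>t\<in>_. _ ` ?A) = _")
    and "(\<Union>t\<in>{..<CARD('p)}. shear 0 (of_nat t) ` {c. (insoluble c \<and> cubic_S1 c) \<and> R c}) \<in> sets borel"
proof -
  have A: "?A \<in> sets borel" by (rule pred_sets) measurable
  have "measure \<mu> (\<Union>t\<in>{..<CARD('p)}. shear 0 (of_nat t) ` ?A) = real (card {..<CARD('p)}) * measure \<mu> ?A"
  proof (rule measure_disjoint_images)
    fix j k x y assume *: "j \<in> {..<CARD('p)}" "k \<in> {..<CARD('p)}" "x \<in> ?A" "y \<in> ?A" "shear 0 (of_nat j) x = shear 0 (of_nat k) y"
    have S: "cubic_S1 x" "cubic_S1 y" using * by simp_all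
    show "j = k" using shear_S1_unique(2)[OF S *(5)] *(1,2) by (auto dest: pp_dvd_of_nat_diff)
  qed (simp_all add: measure_shear_image A)
  then show "measure \<mu> (\<Union>t\<in>{..<CARD('p)}. shear 0 (of_nat t) ` ?A) = real CARD('p) * measure \<mu> ?A" by simp
  show "(\<Union>t\<in>{..<CARD('p)}. shear 0 (of_nat t) ` ?A) \<in> sets borel"
    by (intro sets.finite_UN measure_shear_image A) auto
qed

text \<open>Sorting by the first unit among the coefficients of X^3, Y^3, Z^3 gives p^2 + p + 1
  classes, one for each line of the projective plane over the prime field, all with the measure of
  \<open>IS1\<close>. Forms divisible by p give the last term.\<close>

lemma measure_insoluble:
  "measure \<mu> {c. insoluble c} = (real CARD('p) ^ 2 + real CARD('p) + 1) * measure \<mu> IS1 + measure \<mu> {c. insoluble c} / real CARD('p) ^ 10"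
proof -
  have a: "measure \<mu> {c. (insoluble c \<and> pp dvd c $ 0) \<and> \<not> pp dvd c $ 1} = real CARD('p) * measure \<mu> IS1"
  proof -
    let ?U = "\<Union>t\<in>{..<CARD('p)}. shear 0 (of_nat t) ` {c :: 'p padic_int ^ 10. (insoluble c \<and> cubic_S1 c) \<and> True}"
    have "{c :: 'p padic_int ^ 10. (insoluble c \<and> pp dvd c $ 0) \<and> \<not> pp dvd c $ 1} = swap_xy ` ?U"
    proof (intro equalityI subsetI)
      fix c :: "'p padic_int ^ 10" assume c: "c \<in> {c. (insoluble c \<and> pp dvd c $ 0) \<and> \<not> pp dvd c $ 1}"
      then have "insoluble (swap_xy c)" "\<not> pp dvd swap_xy c $ 0" "pp dvd swap_xy c $ 1"
        by (simp_all add: insoluble_swap swap_nth)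
      then obtain t d where "t < CARD('p)" "insoluble d" "cubic_S1 d" "swap_xy c = shear 0 (of_nat t) d"
        by (rule insoluble_unit_cases_dvd)
      then have "swap_xy c \<in> ?U" by (intro UN_I[of t]) auto
      then show "c \<in> swap_xy ` ?U" by (rule rev_image_eqI) simp
    next
      fix c assume "c \<in> swap_xy ` ?U"
      then obtain t d where "insoluble d" "cubic_S1 d" "c = swap_xy (shear 0 (of_nat t) d)" by auto
      then show "c \<in> {c. (insoluble c \<and> pp dvd c $ 0) \<and> \<not> pp dvd c $ 1}"
        by (simp add: insoluble_swap insoluble_shear swap_nth) (simp add: shear_def cubic_S1_def)
    qed
    also have "measure \<mu> (swap_xy ` ?U) = measure \<mu> ?U"
      by (intro measure_swap_image measure_shear_xz) measurable
    also have "\<dots> = real CARD('p) * measure \<mu> {c :: 'p padic_int ^ 10. (insoluble c \<and> cubic_S1 c) \<and> True}"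
      by (rule measure_shear_xz) measurable
    finally show ?thesis by (simp only: simp_thms)
  qed
  have b: "measure \<mu> {c. ((insoluble c \<and> pp dvd c $ 0) \<and> pp dvd c $ 1) \<and> \<not> pp dvd c $ 2} = measure \<mu> IS1"
  proof -
    have "{c :: 'p padic_int ^ 10. ((insoluble c \<and> pp dvd c $ 0) \<and> pp dvd c $ 1) \<and> \<not> pp dvd c $ 2} = swap_xz ` IS1"
    proof (intro equalityI subsetI)
      fix c :: "'p padic_int ^ 10" assume c: "c \<in> {c. ((insoluble c \<and> pp dvd c $ 0) \<and> pp dvd c $ 1) \<and> \<not> pp dvd c $ 2}"
      then have "insoluble (swap_xz c)" "\<not> pp dvd swap_xz c $ 0" "pp dvd swap_xz c $ 1" "pp dvd swap_xz c $ 2"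
        by (simp_all add: insoluble_swap swap_nth)
      then have "swap_xz c \<in> IS1" by (simp add: insoluble_unit_imp_S1)
      then show "c \<in> swap_xz ` IS1" by (rule rev_image_eqI) simp
    qed (auto simp: insoluble_swap swap_nth cubic_S1_def)
    then show ?thesis by (simp add: measure_swap_image sets_I)
  qed
  have c: "measure \<mu> {c. ((insoluble c \<and> pp dvd c $ 0) \<and> pp dvd c $ 1) \<and> pp dvd c $ 2} = measure \<mu> {c. insoluble c} / real CARD('p) ^ 10"
  proof -
    have "{c :: 'p padic_int ^ 10. ((insoluble c \<and> pp dvd c $ 0) \<and> pp dvd c $ 1) \<and> pp dvd c $ 2} = vscale (\<lambda>_. 1) ` {c. insoluble c}"
    proof (rule vscale_image_eqI)
      fix c :: "'p padic_int ^ 10" assume "c \<in> {c. ((insoluble c \<and> pp dvd c $ 0) \<and> pp dvd c $ 1) \<and> pp dvd c $ 2}"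
      then show "\<forall>i. pp ^ 1 dvd c $ i" using insoluble_all_divisible by auto
    next
      fix c :: "'p padic_int ^ 10"
      have "pp ^ 1 *s c = dilate (pp ^ 0) (pp ^ 0) (vscale (\<lambda>_. 1) c)" by (simp add: vec10_eq_iff dilate_def)
      from insoluble_dilate[OF this]
      show "vscale (\<lambda>_. 1) c \<in> {c. ((insoluble c \<and> pp dvd c $ 0) \<and> pp dvd c $ 1) \<and> pp dvd c $ 2} \<longleftrightarrow> c \<in> {c. insoluble c}"
        by simp
    qed
    moreover have "{c. insoluble c} \<in> sets borel" by (rule pred_sets) measurable
    ultimately show ?thesis using measure_vscale(2)[OF \<mu>, of "{c. insoluble c}" "\<lambda>_. 1"] by simp
  qed
  have "measure \<mu> {c. insoluble c} = measure \<mu> {c. insoluble c \<and> pp dvd c $ 0} + measure \<mu> {c. insoluble c \<and> \<not> pp dvd c $ 0}"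
    by (rule measure_split) measurable
  also have "measure \<mu> {c. insoluble c \<and> pp dvd c $ 0} = measure \<mu> {c. (insoluble c \<and> pp dvd c $ 0) \<and> pp dvd c $ 1}
      + measure \<mu> {c. (insoluble c \<and> pp dvd c $ 0) \<and> \<not> pp dvd c $ 1}"
    by (rule measure_split) measurable
  also have "measure \<mu> {c. (insoluble c \<and> pp dvd c $ 0) \<and> pp dvd c $ 1} =
      measure \<mu> {c. ((insoluble c \<and> pp dvd c $ 0) \<and> pp dvd c $ 1) \<and> pp dvd c $ 2}
      + measure \<mu> {c. ((insoluble c \<and> pp dvd c $ 0) \<and> pp dvd c $ 1) \<and> \<not> pp dvd c $ 2}"
    by (rule measure_split) measurable
  finally show ?thesis
    by (rule trans) (simp only: a b c measure_unit distrib_right mult_1 add_ac)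
qed

lemma measure_W: "measure \<mu> IW = real CARD('p) * measure \<mu> IS2"
proof -
  have "IW = (\<Union>t\<in>{..<CARD('p)}. shear_yz (of_nat t) ` IS2)"
  proof (intro equalityI subsetI)
    fix c assume c: "c \<in> IW"
    then obtain t where t: "t < CARD('p)" "cubic_S2 (shear_yz (- of_nat t) c)" using insoluble_S1_cases(1)[of c] by auto
    have "shear_yz (- of_nat t) c \<in> IS2" using c t(2) by (simp add: insoluble_shear_yz)
    moreover have "c = shear_yz (of_nat t) (shear_yz (- of_nat t) c)" by (simp add: shear_yz_inverse)
    ultimately show "c \<in> (\<Union>t\<in>{..<CARD('p)}. shear_yz (of_nat t) ` IS2)" using t(1) by blast
  next
    fix c assume "c \<in> (\<Union>t\<in>{..<CARD('p)}. shear_yz (of_nat t) ` IS2)"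
    then obtain t d where d: "insoluble d" "cubic_S2 d" "c = shear_yz (of_nat t) d" by auto
    then show "c \<in> IW"
      by (simp add: insoluble_shear_yz) (simp add: cubic_S2_def cubic_S1_def shear_yz_nth)
  qed
  moreover have "measure \<mu> (\<Union>t\<in>{..<CARD('p)}. shear_yz (of_nat t) ` IS2) = real (card {..<CARD('p)}) * measure \<mu> IS2"
  proof (rule measure_disjoint_images)
    fix j k x y assume *: "j \<in> {..<CARD('p)}" "k \<in> {..<CARD('p)}" "x \<in> IS2" "y \<in> IS2" "shear_yz (of_nat j) x = shear_yz (of_nat k) y"
    have S: "cubic_S2 x" "cubic_S2 y" using * by simp_all
    show "j = k" using shear_yz_S2_unique[OF S *(5)] *(1,2) by (auto dest: pp_dvd_of_nat_diff)
  qed (simp_all add: measure_shear_yz_image sets_I)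
  ultimately show ?thesis by simp
qed

text \<open>
  Lower bounds for the valuations of the ten coefficients. If \<open>C\<close> satisfies the bounds \<open>scale_S1'\<close>, then
  \<open>C(pX, Y, Z) / p\<^sup>2\<close> satisfies \<open>scale_T\<close>. In the same way \<open>C(pX, pY, Z) / p\<^sup>3\<close> leads from
  \<open>scale_S2'\<close> to \<open>scale_Q\<close>.
\<close>

definition scale_T :: "10 \<Rightarrow> nat" where "scale_T i = vec10 1 0 0 1 1 0 0 0 0 0 $ i"
definition scale_S1' :: "10 \<Rightarrow> nat" where "scale_S1' i = vec10 0 2 2 1 1 1 2 1 2 1 $ i"
definition scale_terminal :: "10 \<Rightarrow> nat" where "scale_terminal i = vec10 0 1 2 1 1 1 2 2 2 1 $ i"
definition scale_S2' :: "10 \<Rightarrow> nat" where "scale_S2' i = vec10 0 1 3 1 1 1 2 2 2 1 $ i"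
definition scale_Q :: "10 \<Rightarrow> nat" where "scale_Q i = vec10 0 1 0 1 0 1 1 0 0 0 $ i"

lemmas scale_defs = scale_T_def scale_S1'_def scale_terminal_def scale_S2'_def scale_Q_def

lemma sum_scale: "(\<Sum>i\<in>UNIV. scale_T i) = 3" "(\<Sum>i\<in>UNIV. scale_S1' i) = 13" "(\<Sum>i\<in>UNIV. scale_terminal i) = 13"
  "(\<Sum>i\<in>UNIV. scale_S2' i) = 14" "(\<Sum>i\<in>UNIV. scale_Q i) = 4"
  by (simp_all add: sum_10 scale_defs)

lemma pp_power_cancel: "(pp :: 'p padic_int) ^ 2 dvd pp * x \<longleftrightarrow> pp dvd x" "(pp :: 'p padic_int) ^ 3 dvd pp ^ 2 * x \<longleftrightarrow> pp dvd x"
  by (simp_all add: power2_eq_square power3_eq_cube pp_nonzero mult.assoc)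

lemma pp_power_dvd_trivial: "(pp :: 'p padic_int) dvd pp ^ 2 * x" "(pp :: 'p padic_int) dvd pp ^ 3 * x" "(pp :: 'p padic_int) ^ 2 dvd pp ^ 3 * x"
  by (simp_all add: power2_eq_square power3_eq_cube mult.assoc)

text \<open>The states reached by a division: in C(pX, Y, Z) / p^2 the coefficient of X^3 has
  valuation exactly 1; in C(pX, pY, Z) / p^3 it stays a unit and that of Y^3 has valuation exactly
  1.\<close>

abbreviation IT where "IT \<equiv> {c :: 'p padic_int ^ 10. insoluble c \<and> pp dvd c $ 0 \<and> \<not> pp ^ 2 dvd c $ 0 \<and> pp dvd c $ 3 \<and> pp dvd c $ 4}"
abbreviation IQ where "IQ \<equiv> {c :: 'p padic_int ^ 10. insoluble c \<and> \<not> pp dvd c $ 0 \<and> pp dvd c $ 1 \<and> \<not> pp ^ 2 dvd c $ 1 \<and>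
  pp dvd c $ 3 \<and> pp dvd c $ 5 \<and> pp dvd c $ 6}"

text \<open>Both sets are images of the same \<open>?J\<close> under diagonal scalings, of index
  p^13 and p^3, and the substitution matches their insolubility conditions.\<close>

lemma measure_S1':
  "measure \<mu> {c. ((insoluble c \<and> cubic_S1 c) \<and> pp ^ 2 dvd c $ 1) \<and> pp ^ 2 dvd c $ 2} = measure \<mu> IT / real CARD('p) ^ 10"
proof -
  let ?J = "{c :: 'p padic_int ^ 10. \<not> pp dvd c $ 0 \<and> insoluble (vscale scale_T c)}"
  have J: "?J \<in> sets borel" by (rule pred_sets) measurable
  have "IT = vscale scale_T ` ?J"
    by (rule vscale_image_eqI) (auto simp: forall_10 scale_T_def pp_power_cancel)
  then have 1: "measure \<mu> IT = measure \<mu> ?J / real CARD('p) ^ 3"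
    using measure_vscale(2)[OF \<mu> J, of scale_T] by (simp add: sum_scale)
  have iff: "insoluble (vscale scale_S1' c) \<longleftrightarrow> insoluble (vscale scale_T c)" for c :: "'p padic_int ^ 10"
  proof -
    have "pp ^ 2 *s vscale scale_T c = dilate (pp ^ 1) (pp ^ 0) (vscale scale_S1' c)"
      by (simp add: vec10_eq_iff dilate_def scale_defs power2_eq_square power3_eq_cube mult_ac)
    from insoluble_dilate[OF this] show ?thesis by blast
  qed
  have "{c :: 'p padic_int ^ 10. ((insoluble c \<and> cubic_S1 c) \<and> pp ^ 2 dvd c $ 1) \<and> pp ^ 2 dvd c $ 2} = vscale scale_S1' ` ?J"
  proof (rule vscale_image_eqI)
    fix c :: "'p padic_int ^ 10" assume c: "c \<in> {c. ((insoluble c \<and> cubic_S1 c) \<and> pp ^ 2 dvd c $ 1) \<and> pp ^ 2 dvd c $ 2}"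
    then have "pp ^ 2 dvd c $ 6 \<and> pp ^ 2 dvd c $ 8" using insoluble_S1_cases(2)[of c] by blast
    then show "\<forall>i. pp ^ scale_S1' i dvd c $ i" using c unfolding forall_10 by (simp add: scale_S1'_def cubic_S1_def)
  next
    fix c :: "'p padic_int ^ 10"
    have "cubic_S1 (vscale scale_S1' c) \<longleftrightarrow> \<not> pp dvd c $ 0"
      by (simp add: cubic_S1_def scale_S1'_def pp_power_dvd_trivial)
    moreover have "pp ^ 2 dvd vscale scale_S1' c $ 1" "pp ^ 2 dvd vscale scale_S1' c $ 2" by (simp_all add: scale_S1'_def)
    ultimately show "vscale scale_S1' c \<in> {c. ((insoluble c \<and> cubic_S1 c) \<and> pp ^ 2 dvd c $ 1) \<and> pp ^ 2 dvd c $ 2} \<longleftrightarrow> c \<in> ?J"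
      using iff by blast
  qed
  then have "measure \<mu> {c. ((insoluble c \<and> cubic_S1 c) \<and> pp ^ 2 dvd c $ 1) \<and> pp ^ 2 dvd c $ 2} = measure \<mu> ?J / real CARD('p) ^ 13"
    using measure_vscale(2)[OF \<mu> J, of scale_S1'] by (simp add: sum_scale)
  then show ?thesis using 1 by (simp flip: power_add)
qed

text \<open>If p^2 divides the coefficient of Y^3 but not that of Z^3, swapping Y and Z leads to
  \<open>IS2\<close> directly, with no shear left to choose; this is why \<open>IS2\<close> appears
  once here but p times in \<open>IW\<close>.\<close>

lemma measure_S1: "measure \<mu> IS1 = measure \<mu> IW + measure \<mu> IS2 + measure \<mu> IT / real CARD('p) ^ 10"
proof -
  have "{c :: 'p padic_int ^ 10. ((insoluble c \<and> cubic_S1 c) \<and> pp ^ 2 dvd c $ 1) \<and> \<not> pp ^ 2 dvd c $ 2} = swap_yz ` IS2"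
  proof (intro equalityI subsetI)
    fix c :: "'p padic_int ^ 10" assume c: "c \<in> {c. ((insoluble c \<and> cubic_S1 c) \<and> pp ^ 2 dvd c $ 1) \<and> \<not> pp ^ 2 dvd c $ 2}"
    then have "pp ^ 2 dvd c $ 6 \<and> pp ^ 2 dvd c $ 8" using insoluble_S1_cases(2)[of c] by blast
    then have "swap_yz c \<in> IS2" using c by (simp add: insoluble_swap cubic_S2_def cubic_S1_def swap_nth)
    then show "c \<in> swap_yz ` IS2" by (rule rev_image_eqI) simp
  qed (auto simp: insoluble_swap cubic_S2_def cubic_S1_def swap_nth)
  then have b: "measure \<mu> {c. ((insoluble c \<and> cubic_S1 c) \<and> pp ^ 2 dvd c $ 1) \<and> \<not> pp ^ 2 dvd c $ 2} = measure \<mu> IS2"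
    by (simp add: measure_swap_image sets_I)
  have "measure \<mu> IS1 = measure \<mu> {c. (insoluble c \<and> cubic_S1 c) \<and> pp ^ 2 dvd c $ 1} + measure \<mu> IW"
    by (rule measure_split) measurable
  also have "measure \<mu> {c. (insoluble c \<and> cubic_S1 c) \<and> pp ^ 2 dvd c $ 1} =
      measure \<mu> {c. ((insoluble c \<and> cubic_S1 c) \<and> pp ^ 2 dvd c $ 1) \<and> pp ^ 2 dvd c $ 2}
      + measure \<mu> {c. ((insoluble c \<and> cubic_S1 c) \<and> pp ^ 2 dvd c $ 1) \<and> \<not> pp ^ 2 dvd c $ 2}"
    by (rule measure_split) measurable
  finally show ?thesis by (rule trans) (simp only: b measure_S1' add_ac)
qed

text \<open>If Y^3 or Z^3 has a unit coefficient, that variable moves to the place of X, and the old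
  X, whose cube has valuation exactly 1, to the place of Y; this gives \<open>IW\<close> p times and
  once. Otherwise the whole form is divisible by p, and dividing makes the coefficient of X^3 a
  unit, which leads to p^2 copies of \<open>IS1\<close>.\<close>

lemma measure_T: "measure \<mu> IT = real CARD('p) * measure \<mu> IW + measure \<mu> IW + real CARD('p) ^ 2 * measure \<mu> IS1 / real CARD('p) ^ 10"
proof -
  let ?T = "\<lambda>c :: 'p padic_int ^ 10. insoluble c \<and> pp dvd c $ 0 \<and> \<not> pp ^ 2 dvd c $ 0 \<and> pp dvd c $ 3 \<and> pp dvd c $ 4"
  have T: "Measurable.pred borel ?T" by measurable
  note [measurable] = T
  have a: "measure \<mu> {c. ?T c \<and> \<not> pp dvd c $ 1} = real CARD('p) * measure \<mu> IW"
  proof -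
    let ?U = "\<Union>t\<in>{..<CARD('p)}. shear 0 (of_nat t) ` IW"
    have "{c. ?T c \<and> \<not> pp dvd c $ 1} = swap_xy ` ?U"
    proof (intro equalityI subsetI)
      fix c assume c: "c \<in> {c. ?T c \<and> \<not> pp dvd c $ 1}"
      then have "insoluble (swap_xy c)" "\<not> pp dvd swap_xy c $ 0" "pp dvd swap_xy c $ 1"
        by (simp_all add: insoluble_swap swap_nth)
      then obtain t d where d: "t < CARD('p)" "insoluble d" "cubic_S1 d" "swap_xy c = shear 0 (of_nat t) d"
        by (rule insoluble_unit_cases_dvd)
      have "d $ 1 = swap_xy c $ 1" unfolding d(4) by (simp add: shear_def)
      then have "\<not> pp ^ 2 dvd d $ 1" using c by (simp add: swap_nth)
      then have "swap_xy c \<in> ?U" using d by (intro UN_I[of t]) auto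
      then show "c \<in> swap_xy ` ?U" by (rule rev_image_eqI) simp
    next
      fix c assume "c \<in> swap_xy ` ?U"
      then obtain t d where "insoluble d" "cubic_S1 d" "\<not> pp ^ 2 dvd d $ 1" "c = swap_xy (shear 0 (of_nat t) d)" by auto
      then show "c \<in> {c. ?T c \<and> \<not> pp dvd c $ 1}"
        by (simp add: insoluble_swap insoluble_shear swap_nth) (simp add: shear_def cubic_S1_def)
    qed
    also have "measure \<mu> (swap_xy ` ?U) = measure \<mu> ?U"
      by (intro measure_swap_image measure_shear_xz) measurable
    also have "\<dots> = real CARD('p) * measure \<mu> IW" by (rule measure_shear_xz) measurable
    finally show ?thesis .
  qed
  have b: "measure \<mu> {c. (?T c \<and> pp dvd c $ 1) \<and> \<not> pp dvd c $ 2} = measure \<mu> IW"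
  proof -
    have "{c. (?T c \<and> pp dvd c $ 1) \<and> \<not> pp dvd c $ 2} = swap_xz ` swap_yz ` IW"
    proof (intro equalityI subsetI)
      fix c assume c: "c \<in> {c. (?T c \<and> pp dvd c $ 1) \<and> \<not> pp dvd c $ 2}"
      then have "insoluble (swap_xz c)" "\<not> pp dvd swap_xz c $ 0" "pp dvd swap_xz c $ 1" "pp dvd swap_xz c $ 2"
        by (simp_all add: insoluble_swap swap_nth)
      then have "swap_xz c \<in> IS1" by (simp add: insoluble_unit_imp_S1)
      then have "swap_yz (swap_xz c) \<in> IW"
        using c by (simp add: insoluble_swap cubic_S1_def swap_nth)
      moreover have "c = swap_xz (swap_yz (swap_yz (swap_xz c)))" by simp
      ultimately show "c \<in> swap_xz ` swap_yz ` IW" by blast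
    qed (auto simp: insoluble_swap swap_nth cubic_S1_def)
    then show ?thesis by (simp add: measure_swap_image sets_I)
  qed
  have c: "measure \<mu> {c. (?T c \<and> pp dvd c $ 1) \<and> pp dvd c $ 2} = real CARD('p) ^ 2 * measure \<mu> IS1 / real CARD('p) ^ 10"
  proof -
    let ?I0 = "{c :: 'p padic_int ^ 10. insoluble c \<and> \<not> pp dvd c $ 0}"
    have "{c. (?T c \<and> pp dvd c $ 1) \<and> pp dvd c $ 2} = vscale (\<lambda>_. 1) ` ?I0"
    proof (rule vscale_image_eqI)
      fix c assume "c \<in> {c. (?T c \<and> pp dvd c $ 1) \<and> pp dvd c $ 2}"
      then show "\<forall>i. pp ^ 1 dvd c $ i" using insoluble_all_divisible by auto
    next
      fix c :: "'p padic_int ^ 10"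
      have "pp ^ 1 *s c = dilate (pp ^ 0) (pp ^ 0) (vscale (\<lambda>_. 1) c)" by (simp add: vec10_eq_iff dilate_def)
      from insoluble_dilate[OF this]
      show "vscale (\<lambda>_. 1) c \<in> {c. (?T c \<and> pp dvd c $ 1) \<and> pp dvd c $ 2} \<longleftrightarrow> c \<in> ?I0"
        by (auto simp: pp_power_cancel)
    qed
    moreover have "?I0 \<in> sets borel" by (rule pred_sets) measurable
    ultimately show ?thesis using measure_vscale(2)[OF \<mu>, of ?I0 "\<lambda>_. 1"] by (simp add: measure_unit)
  qed
  have "measure \<mu> IT = measure \<mu> {c. ?T c \<and> pp dvd c $ 1} + measure \<mu> {c. ?T c \<and> \<not> pp dvd c $ 1}"
    by (rule measure_split) measurable
  also have "measure \<mu> {c. ?T c \<and> pp dvd c $ 1} = measure \<mu> {c. (?T c \<and> pp dvd c $ 1) \<and> pp dvd c $ 2}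
      + measure \<mu> {c. (?T c \<and> pp dvd c $ 1) \<and> \<not> pp dvd c $ 2}"
    by (rule measure_split) measurable
  finally show ?thesis by (rule trans) (simp only: a b c add_ac)
qed

text \<open>The terminal forms are the inhomogeneous term of the system: three exact valuations and
  thirteen forced factors p. If p^3 divides the coefficient of Z^3, the division leads to
  \<open>IQ\<close>, which consists of p shears of \<open>IW\<close>.\<close>

lemma measure_S2: "measure \<mu> IS2 = (1 - 1 / real CARD('p)) ^ 3 / real CARD('p) ^ 13 + real CARD('p) * measure \<mu> IW / real CARD('p) ^ 10"
proof -
  have a: "measure \<mu> {c. (insoluble c \<and> cubic_S2 c) \<and> \<not> pp ^ 3 dvd c $ 2} = (1 - 1 / real CARD('p)) ^ 3 / real CARD('p) ^ 13"
  proof -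
    let ?J = "{c :: 'p padic_int ^ 10. \<forall>i\<in>{0, 1, 2}. \<not> pp dvd c $ i}"
    have J: "?J \<in> sets borel" by (rule pred_sets) measurable
    have "{c :: 'p padic_int ^ 10. (insoluble c \<and> cubic_S2 c) \<and> \<not> pp ^ 3 dvd c $ 2} = {c. terminal_cubic c}"
      using insoluble_S2 terminal_cubic_imp_insoluble by (auto simp: S2_terminal_iff)
    also have "\<dots> = vscale scale_terminal ` ?J"
      by (rule vscale_image_eqI)
        (auto simp: forall_10 scale_terminal_def terminal_cubic_def pp_power_cancel pp_power_dvd_trivial)
    finally show ?thesis
      using measure_vscale(2)[OF \<mu> J, of scale_terminal] measure_units[OF \<mu>, of "{0, 1, 2}"] by (simp add: sum_scale power3_eq_cube)
  qed
  have b: "measure \<mu> {c. (insoluble c \<and> cubic_S2 c) \<and> pp ^ 3 dvd c $ 2} = measure \<mu> IQ / real CARD('p) ^ 10"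
  proof -
    let ?J = "{c :: 'p padic_int ^ 10. \<not> pp dvd c $ 0 \<and> \<not> pp dvd c $ 1 \<and> insoluble (vscale scale_Q c)}"
    have J: "?J \<in> sets borel" by (rule pred_sets) measurable
    have "IQ = vscale scale_Q ` ?J"
      by (rule vscale_image_eqI) (auto simp: forall_10 scale_Q_def pp_power_cancel)
    then have 1: "measure \<mu> IQ = measure \<mu> ?J / real CARD('p) ^ 4"
      using measure_vscale(2)[OF \<mu> J, of scale_Q] by (simp add: sum_scale)
    have iff: "insoluble (vscale scale_S2' c) \<longleftrightarrow> insoluble (vscale scale_Q c)" for c :: "'p padic_int ^ 10"
    proof -
      have "pp ^ 3 *s vscale scale_Q c = dilate (pp ^ 1) (pp ^ 1) (vscale scale_S2' c)"
        by (simp add: vec10_eq_iff dilate_def scale_defs power2_eq_square power3_eq_cube mult_ac)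
      from insoluble_dilate[OF this] show ?thesis by blast
    qed
    have "{c :: 'p padic_int ^ 10. (insoluble c \<and> cubic_S2 c) \<and> pp ^ 3 dvd c $ 2} = vscale scale_S2' ` ?J"
    proof (rule vscale_image_eqI)
      fix c :: "'p padic_int ^ 10" assume c: "c \<in> {c. (insoluble c \<and> cubic_S2 c) \<and> pp ^ 3 dvd c $ 2}"
      then have "pp ^ 2 dvd c $ 7" using insoluble_S2[of c] by blast
      then show "\<forall>i. pp ^ scale_S2' i dvd c $ i" using c unfolding forall_10 by (simp add: scale_S2'_def cubic_S1_def cubic_S2_def)
    next
      fix c :: "'p padic_int ^ 10"
      have "cubic_S2 (vscale scale_S2' c) \<longleftrightarrow> \<not> pp dvd c $ 0 \<and> \<not> pp dvd c $ 1"
        by (simp add: cubic_S2_def cubic_S1_def scale_S2'_def pp_power_dvd_trivial pp_power_cancel)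
      moreover have "pp ^ 3 dvd vscale scale_S2' c $ 2" by (simp add: scale_S2'_def)
      ultimately show "vscale scale_S2' c \<in> {c. (insoluble c \<and> cubic_S2 c) \<and> pp ^ 3 dvd c $ 2} \<longleftrightarrow> c \<in> ?J"
        using iff by blast
    qed
    then have "measure \<mu> {c. (insoluble c \<and> cubic_S2 c) \<and> pp ^ 3 dvd c $ 2} = measure \<mu> ?J / real CARD('p) ^ 14"
      using measure_vscale(2)[OF \<mu> J, of scale_S2'] by (simp add: sum_scale)
    then show ?thesis using 1 by (simp flip: power_add)
  qed
  have c: "measure \<mu> IQ = real CARD('p) * measure \<mu> IW"
  proof -
    let ?U = "\<Union>t\<in>{..<CARD('p)}. shear 0 (of_nat t) ` IW"
    have "IQ = ?U"
    proof (intro equalityI subsetI)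
      fix c assume c: "c \<in> IQ"
      then have "insoluble c" "\<not> pp dvd c $ 0" "pp dvd c $ 1" by simp_all
      then obtain t d where d: "t < CARD('p)" "insoluble d" "cubic_S1 d" "c = shear 0 (of_nat t) d"
        by (rule insoluble_unit_cases_dvd)
      have "d $ 1 = c $ 1" unfolding d(4) by (simp add: shear_def)
      then have "\<not> pp ^ 2 dvd d $ 1" using c by simp
      then show "c \<in> ?U" using d by (intro UN_I[of t]) auto
    next
      fix c assume "c \<in> ?U"
      then obtain t d where "insoluble d" "cubic_S1 d" "\<not> pp ^ 2 dvd d $ 1" "c = shear 0 (of_nat t) d" by auto
      then show "c \<in> IQ" by (simp add: insoluble_shear) (simp add: shear_def cubic_S1_def)
    qed
    also have "measure \<mu> ?U = real CARD('p) * measure \<mu> IW" by (rule measure_shear_xz) measurable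
    finally show ?thesis .
  qed
  have "measure \<mu> IS2 = measure \<mu> {c. (insoluble c \<and> cubic_S2 c) \<and> pp ^ 3 dvd c $ 2}
      + measure \<mu> {c. (insoluble c \<and> cubic_S2 c) \<and> \<not> pp ^ 3 dvd c $ 2}"
    by (rule measure_split) measurable
  then show ?thesis by (rule trans) (simp only: a b c add_ac)
qed

lemma measure_insoluble_eq:
  fixes q :: real
  defines "q \<equiv> real CARD('p)"
  shows "measure \<mu> {c. insoluble c} =
    q ^ 11 * (q - 1) * (q ^ 2 - 1) * (q ^ 3 - 1) / ((q ^ 8 - 1) * (q ^ 9 - 1) * (q ^ 10 - 1))"
proof (rule insoluble_recursion_solution)
  show "q > 1" unfolding q_def using prime_gt_1_nat[OF prime_card[where 'a='p]] by simp
  show "measure \<mu> IW = q * measure \<mu> IS2" unfolding q_def by (rule measure_W)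
  show "measure \<mu> IS2 = (1 - 1 / q) ^ 3 / q ^ 13 + q * measure \<mu> IW / q ^ 10" unfolding q_def by (rule measure_S2)
  show "measure \<mu> IT = q * measure \<mu> IW + measure \<mu> IW + q ^ 2 * measure \<mu> IS1 / q ^ 10"
    unfolding q_def by (rule measure_T)
  show "measure \<mu> IS1 = measure \<mu> IW + measure \<mu> IS2 + measure \<mu> IT / q ^ 10" unfolding q_def by (rule measure_S1)
  show "measure \<mu> {c. insoluble c} = (q ^ 2 + q + 1) * measure \<mu> IS1 + measure \<mu> {c. insoluble c} / q ^ 10"
    unfolding q_def by (rule measure_insoluble)
qed

end

theorem theorem15:
  fixes \<mu> :: "('p::prime_card padic_int ^ 10) measure" and p :: nat
  assumes "normalized_haar \<mu>" and "p = CARD('p)"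
  shows "measure \<mu> {c. soluble_nr c} =
    1 - real p ^ 11 * (real p - 1) * (real p ^ 2 - 1) * (real p ^ 3 - 1) /
        ((real p ^ 8 - 1) * (real p ^ 9 - 1) * (real p ^ 10 - 1))"
proof -
  note \<mu> = normalized_haar_translation_invariant[OF assms(1)]
  interpret prob_space \<mu> using assms(1) by (simp add: normalized_haar_def)
  have "{c :: 'p padic_int ^ 10. insoluble c} \<in> sets \<mu>" unfolding \<mu>(3) by (rule pred_sets) measurable
  from prob_compl[OF this] have "measure \<mu> {c. soluble_nr c} = 1 - measure \<mu> {c. insoluble c}"
    by (simp add: \<mu>(4) soluble_nr_iff Compl_eq_Diff_UNIV[symmetric] Collect_neg_eq)
  then show ?thesis unfolding assms(2) measure_insoluble_eq[OF assms(1)] .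
qed

end
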